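(* Let $G$ be a finitely generated virtually abelian group, let $\mathcal{E}$ be a finite system of equations in $G$ over variables $X_1,\dots,X_m$, together with finitely many constraints each of which is a linear length constraint (with respect to any weighted word metric), an abelianisation constraint, a context-free constraint or a lexicographic order constraint. Let $\mathcal{S}\subseteq G^m$ be the set of solutions of $\mathcal{E}$ satisfying all the constraints. Then $\mathcal{S}$ may be expressed as an EDT0L language with respect to a natural normal form (the subgroup-transversal normal form $\eta$), and also as an EDT0L language with respect to a geodesic normal form: for any finite generating set $\Sigma$ of $G$ with weight function $\omega$, there is a geodesic normal form $\mu\colon G\to\Sigma^*$ such that $\mathcal{S}$ is expressed as an EDT0L language with respect to $\mu$.
   Context: **Normal forms.** A normal form for $G$ over a finite generating set $\Sigma$ is a function $\mu\colon G\to\Sigma^*$ such that $\mu(g)$ represents $g$ for all $g$. Let $A\trianglelefteq G$ be a finite-index free abelian normal subgroup with ordered free basis $B=\{b_1<\dots<b_n\}$ and let $T$ be a finite transversal of $A$ in $G$. The subgroup-transversal normal form $\eta$ sends $g\in G$ to the unique word $b_1^{i_1}\cdots b_n^{i_n}t$ ($i_j\in\mathbb{Z}$, $t\in T$) representing it. Given a finite generating set $\Sigma$ (every element being represented by a word in $\Sigma^*$) and weights $\omega\colon\Sigma\to\mathbb{N}\setminus\{0\}$, the weight of $g\in G$ is $\omega(g)=\min\{\sum_{i=1}^k\omega(\sigma_i): \sigma_1\cdots\sigma_k=_G g,\ \sigma_i\in\Sigma\}$; a word is geodesic if its weight (the sum of the weights of its letters) equals the weight of the element it represents; a geodesic normal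 form is a normal form all of whose words are geodesic. **EDT0L.** A language $L$ over a finite alphabet $\Omega$ is EDT0L if there are a finite alphabet $C\supseteq\Omega$, a word $w\in C^*$ and a rational (regular) set $R$ of endomorphisms of $C^*$ (i.e. the set of all compositions spelled by a regular language over a finite set of endomorphisms) such that $L=\{\varphi(w):\varphi\in R\}\cap\Omega^*$. A set $\mathcal{S}\subseteq G^m$ is expressed as an EDT0L language with respect to a normal form $\mu$ over $\Sigma$ if $\{\mu(g_1)\#\mu(g_2)\#\cdots\#\mu(g_m):(g_1,\dots,g_m)\in\mathcal{S}\}$ is an EDT0L language over $\Sigma\cup\{\#\}$, where $\#\notin\Sigma$ (with $\Sigma$ replaced by $B^{\pm}\cup T$ for $\eta$). **Equations.** A finite system of equations is a finite subset $\{w_1,\dots,w_r\}$ of $G*F(X_1,\dots,X_m)$; a solution is a homomorphism to $G$ fixing $G$ pointwise and sending every $w_i$ to $1$, identified with the tuple $(g_1,\dots,g_m)$ of images of the variables. **Constraints on $(g_1,\dots,g_m)$.** Linear length constraints: finite systems of conditions $\sum_i\alpha_i\omega(g_i)=\beta$ or $\sum_i\alpha_i\omega(g_i)\le\beta$, with $\alpha_i,\beta\in\mathbb{Z}$. Abelianisation constraints: a finite system of equations in $G^{\mathrm{ab}}=G/[G,G]$ to be satisfied by the images of the $g_i$. Context-free constraints: $g_i\in C$, where $C\subseteq G$ is the image under the natural projection $S^*\to G$ ($S$ a finite inverse-closed generating set) of a context-free language. Lexicographic order constraints: relations $g_i\le_{\mathrm{lex}}g_j$, meaning that $\eta(g_i)$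 is lexicographically at most $\eta(g_j)$ for a fixed total order on the alphabet $B^{\pm}\sqcup T$ extending the order $b_1<b_1^{-1}<\dots<b_n<b_n^{-1}$ and a given order on $T$. *)

theory Defs
  imports "HOL-Algebra.Generated_Groups"
begin

section \<open>Virtually abelian groups\<close>

definition finitely_generated_group :: "('a, 'b) monoid_scheme \<Rightarrow> bool" where
  "finitely_generated_group G \<longleftrightarrow>
     group G \<and> (\<exists>X. finite X \<and> X \<subseteq> carrier G \<and> generate G X = carrier G)"

definition virtually_abelian_group :: "('a, 'b) monoid_scheme \<Rightarrow> bool" where
  "virtually_abelian_group G \<longleftrightarrow>
     group G \<and> (\<exists>H. subgroup H G \<and> finite (rcosets\<^bsub>G\<^esub> H) \<and> comm_group (G\<lparr>carrier := H\<rparr>))"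


section \<open>Words, normal forms and weights\<close>

text \<open>Letters are interpreted in the group by a map \<open>ev\<close>. For a generating set
  \<open>\<Sigma> \<subseteq> carrier G\<close> the letters are group elements and \<open>ev = id\<close>; for the
  subgroup-transversal normal form the letters are formal symbols.\<close>

definition word_value :: "('a, 'b) monoid_scheme \<Rightarrow> ('x \<Rightarrow> 'a) \<Rightarrow> 'x list \<Rightarrow> 'a" where
  "word_value G ev w = foldr (\<lambda>x g. ev x \<otimes>\<^bsub>G\<^esub> g) w \<one>\<^bsub>G\<^esub>"

definition normal_form ::
    "('a, 'b) monoid_scheme \<Rightarrow> 'x set \<Rightarrow> ('x \<Rightarrow> 'a) \<Rightarrow> ('a \<Rightarrow> 'x list) \<Rightarrow> bool" where
  "normal_form G \<Sigma> ev \<mu> \<longleftrightarrow>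
     (\<forall>g\<in>carrier G. \<mu> g \<in> lists \<Sigma> \<and> word_value G ev (\<mu> g) = g)"

text \<open>Generation is as a monoid: inverses of elements of \<open>\<Sigma>\<close> are not letters.\<close>

definition finite_generating_set :: "('a, 'b) monoid_scheme \<Rightarrow> 'a set \<Rightarrow> bool" where
  "finite_generating_set G \<Sigma> \<longleftrightarrow>
     finite \<Sigma> \<and> \<Sigma> \<subseteq> carrier G \<and> (\<forall>g\<in>carrier G. \<exists>w\<in>lists \<Sigma>. word_value G id w = g)"

definition weighted_generating_set ::
    "('a, 'b) monoid_scheme \<Rightarrow> 'a set \<Rightarrow> ('a \<Rightarrow> nat) \<Rightarrow> bool" where
  "weighted_generating_set G \<Sigma> \<omega> \<longleftrightarrow> finite_generating_set G \<Sigma> \<and> (\<forall>\<sigma>\<in>\<Sigma>. \<omega> \<sigma> > 0)"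

definition word_weight :: "('a \<Rightarrow> nat) \<Rightarrow> 'a list \<Rightarrow> nat" where
  "word_weight \<omega> w = sum_list (map \<omega> w)"

definition weight :: "('a, 'b) monoid_scheme \<Rightarrow> 'a set \<Rightarrow> ('a \<Rightarrow> nat) \<Rightarrow> 'a \<Rightarrow> nat" where
  "weight G \<Sigma> \<omega> g =
     (LEAST n. \<exists>w\<in>lists \<Sigma>. word_value G id w = g \<and> word_weight \<omega> w = n)"

definition geodesic :: "('a, 'b) monoid_scheme \<Rightarrow> 'a set \<Rightarrow> ('a \<Rightarrow> nat) \<Rightarrow> 'a list \<Rightarrow> bool" where
  "geodesic G \<Sigma> \<omega> w \<longleftrightarrow>
     w \<in> lists \<Sigma> \<and> word_weight \<omega> w = weight G \<Sigma> \<omega> (word_value G id w)"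

definition geodesic_normal_form ::
    "('a, 'b) monoid_scheme \<Rightarrow> 'a set \<Rightarrow> ('a \<Rightarrow> nat) \<Rightarrow> ('a \<Rightarrow> 'a list) \<Rightarrow> bool" where
  "geodesic_normal_form G \<Sigma> \<omega> \<mu> \<longleftrightarrow>
     normal_form G \<Sigma> id \<mu> \<and> (\<forall>g\<in>carrier G. geodesic G \<Sigma> \<omega> (\<mu> g))"


section \<open>The subgroup-transversal normal form\<close>

definition free_abelian_basis ::
    "('a, 'b) monoid_scheme \<Rightarrow> 'a set \<Rightarrow> 'a list \<Rightarrow> bool" where
  "free_abelian_basis G A bs \<longleftrightarrow>
     comm_group (G\<lparr>carrier := A\<rparr>) \<and> distinct bs \<and> set bs \<subseteq> A \<and>
     (\<forall>a\<in>A. \<exists>!ks :: int list. length ks = length bs \<and>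
        foldr (\<lambda>(b, k) x. (b [^]\<^bsub>G\<^esub> k) \<otimes>\<^bsub>G\<^esub> x) (zip bs ks) \<one>\<^bsub>G\<^esub> = a)"

definition transversal :: "('a, 'b) monoid_scheme \<Rightarrow> 'a set \<Rightarrow> 'a set \<Rightarrow> bool" where
  "transversal G A T \<longleftrightarrow> T \<subseteq> carrier G \<and> (\<forall>K\<in>rcosets\<^bsub>G\<^esub> A. \<exists>!t. t \<in> T \<and> t \<in> K)"

text \<open>The order of the basis is the order of the list \<open>bs\<close>.\<close>

definition subgroup_transversal_data ::
    "('a, 'b) monoid_scheme \<Rightarrow> 'a set \<Rightarrow> 'a list \<Rightarrow> 'a set \<Rightarrow> bool" where
  "subgroup_transversal_data G A bs T \<longleftrightarrow>
     A \<lhd> G \<and> finite (rcosets\<^bsub>G\<^esub> A) \<and> free_abelian_basis G A bs \<and>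
     finite T \<and> transversal G A T"

text \<open>The alphabet is the disjoint union of \<open>B\<^sup>\<plusminus>\<close> and \<open>T\<close>: an element of the group may be
  both a basis element (or its inverse) and a transversal element, so symbols are tagged.\<close>

datatype 'a st_letter = BasisGen 'a | BasisInv 'a | Rep 'a

definition st_alphabet :: "'a list \<Rightarrow> 'a set \<Rightarrow> 'a st_letter set" where
  "st_alphabet bs T = BasisGen ` set bs \<union> BasisInv ` set bs \<union> Rep ` T"

fun st_value :: "('a, 'b) monoid_scheme \<Rightarrow> 'a st_letter \<Rightarrow> 'a" where
  "st_value G (BasisGen b) = b"
| "st_value G (BasisInv b) = inv\<^bsub>G\<^esub> b"
| "st_value G (Rep t) = t"

fun basis_power :: "'a \<Rightarrow> int \<Rightarrow> 'a st_letter list" where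
  "basis_power b k =
     (if k \<ge> 0 then replicate (nat k) (BasisGen b) else replicate (nat (- k)) (BasisInv b))"

definition st_word :: "'a list \<Rightarrow> int list \<Rightarrow> 'a \<Rightarrow> 'a st_letter list" where
  "st_word bs ks t = concat (map2 basis_power bs ks) @ [Rep t]"

definition st_normal_form ::
    "('a, 'b) monoid_scheme \<Rightarrow> 'a list \<Rightarrow> 'a set \<Rightarrow> 'a \<Rightarrow> 'a st_letter list" where
  "st_normal_form G bs T g =
     (THE w. (\<exists>ks t. length ks = length bs \<and> t \<in> T \<and> w = st_word bs ks t) \<and>
             word_value G (st_value G) w = g)"

text \<open>Admissible total orders on the alphabet: they extend
  \<open>b\<^sub>1 < b\<^sub>1\<^sup>-\<^sup>1 < \<dots> < b\<^sub>n < b\<^sub>n\<^sup>-\<^sup>1\<close> and the given order \<open>r\<^sub>T\<close> on \<open>T\<close>; how basis letters and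
  transversal letters compare is unrestricted. Orders are reflexive relations.\<close>

definition st_letter_order ::
    "'a list \<Rightarrow> 'a set \<Rightarrow> ('a \<times> 'a) set \<Rightarrow> ('a st_letter \<times> 'a st_letter) set \<Rightarrow> bool" where
  "st_letter_order bs T rT r \<longleftrightarrow>
     linear_order_on T rT \<and> linear_order_on (st_alphabet bs T) r \<and>
     sorted_wrt (\<lambda>x y. (x, y) \<in> r) (concat (map (\<lambda>b. [BasisGen b, BasisInv b]) bs)) \<and>
     (\<forall>(s, t)\<in>rT. (Rep s, Rep t) \<in> r)"

definition lex_le :: "('x \<times> 'x) set \<Rightarrow> 'x list \<Rightarrow> 'x list \<Rightarrow> bool" where
  "lex_le r u v \<longleftrightarrow> u = v \<or> (u, v) \<in> lexord (r - Id)"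


section \<open>Regular, context-free and EDT0L languages\<close>

inductive nfa_run :: "(nat \<times> 'x \<times> nat) set \<Rightarrow> nat \<Rightarrow> 'x list \<Rightarrow> nat \<Rightarrow> bool" for D where
  "nfa_run D p [] p"
| "(p, x, q) \<in> D \<Longrightarrow> nfa_run D q w s \<Longrightarrow> nfa_run D p (x # w) s"

definition regular_language :: "'x set \<Rightarrow> 'x list set \<Rightarrow> bool" where
  "regular_language X L \<longleftrightarrow>
     (\<exists>Q D I F. finite X \<and> finite Q \<and> D \<subseteq> Q \<times> X \<times> Q \<and> I \<subseteq> Q \<and> F \<subseteq> Q \<and>
        L = {w. \<exists>p\<in>I. \<exists>q\<in>F. nfa_run D p w q})"

text \<open>Sentential forms of a grammar: nonterminals are \<open>Inl A\<close>, terminals \<open>Inr x\<close>. Naturals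
  suffice as nonterminals since a grammar has only finitely many of them.\<close>

inductive cfg_step ::
    "(nat \<times> (nat + 'x) list) set \<Rightarrow> (nat + 'x) list \<Rightarrow> (nat + 'x) list \<Rightarrow> bool" for P where
  "(A, \<gamma>) \<in> P \<Longrightarrow> cfg_step P (\<alpha> @ [Inl A] @ \<beta>) (\<alpha> @ \<gamma> @ \<beta>)"

definition context_free_language :: "'x set \<Rightarrow> 'x list set \<Rightarrow> bool" where
  "context_free_language X L \<longleftrightarrow>
     (\<exists>P s. finite X \<and> finite P \<and> (\<forall>(A, \<gamma>)\<in>P. \<gamma> \<in> lists (range Inl \<union> Inr ` X)) \<and>
        L = {w \<in> lists X. (cfg_step P)\<^sup>*\<^sup>* [Inl s] (map Inr w)})"

definition free_monoid_endomorphism :: "'x set \<Rightarrow> ('x list \<Rightarrow> 'x list) \<Rightarrow> bool" where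
  "free_monoid_endomorphism C \<phi> \<longleftrightarrow>
     \<phi> ` lists C \<subseteq> lists C \<and> \<phi> [] = [] \<and>
     (\<forall>u\<in>lists C. \<forall>v\<in>lists C. \<phi> (u @ v) = \<phi> u @ \<phi> v)"

definition rational_endomorphism_set :: "'x set \<Rightarrow> ('x list \<Rightarrow> 'x list) set \<Rightarrow> bool" where
  "rational_endomorphism_set C R \<longleftrightarrow>
     (\<exists>\<Phi> L. finite \<Phi> \<and> (\<forall>\<phi>\<in>\<Phi>. free_monoid_endomorphism C \<phi>) \<and> regular_language \<Phi> L \<and>
        R = (\<lambda>\<phi>s. foldr (\<circ>) \<phi>s id) ` L)"

text \<open>The extended alphabet \<open>C \<supseteq> \<Omega>\<close> lives in \<open>'x + nat\<close>, with \<open>\<Omega>\<close> embedded by \<open>Inl\<close>, so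
  that any finite number of auxiliary letters is available whatever the type \<open>'x\<close> is.\<close>

definition EDT0L :: "'x set \<Rightarrow> 'x list set \<Rightarrow> bool" where
  "EDT0L \<Omega> L \<longleftrightarrow>
     (\<exists>(C :: ('x + nat) set) w R. finite \<Omega> \<and> finite C \<and> Inl ` \<Omega> \<subseteq> C \<and> w \<in> lists C \<and>
        rational_endomorphism_set C R \<and>
        map Inl ` L = {\<phi> w | \<phi>. \<phi> \<in> R} \<inter> lists (Inl ` \<Omega>))"

datatype 'x hashed = Letter 'x | Hash

fun hash_join :: "'x list list \<Rightarrow> 'x hashed list" where
  "hash_join [] = []"
| "hash_join [w] = map Letter w"
| "hash_join (w # v # ws) = map Letter w @ [Hash] @ hash_join (v # ws)"

definition expressed_as_EDT0L ::
    "'x set \<Rightarrow> ('a \<Rightarrow> 'x list) \<Rightarrow> 'a list set \<Rightarrow> bool" where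
  "expressed_as_EDT0L \<Sigma> \<mu> S \<longleftrightarrow>
     EDT0L (Letter ` \<Sigma> \<union> {Hash}) ((\<lambda>gs. hash_join (map \<mu> gs)) ` S)"


section \<open>Equations\<close>

text \<open>The free product \<open>G * F(X\<^sub>0, \<dots>, X\<^sub>m\<^sub>-\<^sub>1)\<close>, as words in constants, variables and
  formal inverses of variables, modulo the congruence generated by the multiplication table
  of \<open>G\<close> and free cancellation.\<close>

datatype 'a fp_letter = Const 'a | Var nat | VarInv nat

definition fp_words :: "('a, 'b) monoid_scheme \<Rightarrow> nat \<Rightarrow> 'a fp_letter list set" where
  "fp_words G m = lists (Const ` carrier G \<union> Var ` {..<m} \<union> VarInv ` {..<m})"

inductive fp_equiv ::
    "('a, 'b) monoid_scheme \<Rightarrow> nat \<Rightarrow> 'a fp_letter list \<Rightarrow> 'a fp_letter list \<Rightarrow> bool"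
  for G m where
  fp_const_one: "fp_equiv G m [Const \<one>\<^bsub>G\<^esub>] []"
| fp_const_mult: "g \<in> carrier G \<Longrightarrow> h \<in> carrier G \<Longrightarrow>
    fp_equiv G m [Const g, Const h] [Const (g \<otimes>\<^bsub>G\<^esub> h)]"
| fp_var_inv: "i < m \<Longrightarrow> fp_equiv G m [Var i, VarInv i] []"
| fp_inv_var: "i < m \<Longrightarrow> fp_equiv G m [VarInv i, Var i] []"
| fp_refl: "u \<in> fp_words G m \<Longrightarrow> fp_equiv G m u u"
| fp_sym: "fp_equiv G m u v \<Longrightarrow> fp_equiv G m v u"
| fp_trans: "fp_equiv G m u v \<Longrightarrow> fp_equiv G m v w \<Longrightarrow> fp_equiv G m u w"
| fp_append: "fp_equiv G m u u' \<Longrightarrow> fp_equiv G m v v' \<Longrightarrow> fp_equiv G m (u @ v) (u' @ v')"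

definition fp_class ::
    "('a, 'b) monoid_scheme \<Rightarrow> nat \<Rightarrow> 'a fp_letter list \<Rightarrow> 'a fp_letter list set" where
  "fp_class G m u = {v. fp_equiv G m u v}"

definition free_product_vars ::
    "('a, 'b) monoid_scheme \<Rightarrow> nat \<Rightarrow> 'a fp_letter list set monoid" where
  "free_product_vars G m =
     \<lparr>carrier = fp_class G m ` fp_words G m,
      monoid.mult = (\<lambda>U V. \<Union>u\<in>U. \<Union>v\<in>V. fp_class G m (u @ v)),
      one = fp_class G m []\<rparr>"

text \<open>Solutions in \<open>G\<^sup>m\<close>; tuples are lists of length \<open>m\<close>.\<close>

definition equation_solutions ::
    "('a, 'b) monoid_scheme \<Rightarrow> nat \<Rightarrow> 'a fp_letter list set set \<Rightarrow> 'a list set" where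
  "equation_solutions G m E =
     {map (\<lambda>i. \<phi> (fp_class G m [Var i])) [0..<m] | \<phi>.
        \<phi> \<in> hom (free_product_vars G m) G \<and>
        (\<forall>g\<in>carrier G. \<phi> (fp_class G m [Const g]) = g) \<and>
        (\<forall>w\<in>E. \<phi> w = \<one>\<^bsub>G\<^esub>)}"

definition finite_equation_system ::
    "('a, 'b) monoid_scheme \<Rightarrow> nat \<Rightarrow> 'a fp_letter list set set \<Rightarrow> bool" where
  "finite_equation_system G m E \<longleftrightarrow> finite E \<and> E \<subseteq> carrier (free_product_vars G m)"


section \<open>Constraints\<close>

text \<open>A constraint is identified with the set of tuples in \<open>G\<^sup>m\<close> satisfying it.\<close>

definition tuples :: "('a, 'b) monoid_scheme \<Rightarrow> nat \<Rightarrow> 'a list set" where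
  "tuples G m = {gs. length gs = m \<and> set gs \<subseteq> carrier G}"

datatype linear_condition = LinEq "nat \<Rightarrow> int" int | LinLe "nat \<Rightarrow> int" int

fun satisfies_linear :: "nat \<Rightarrow> (nat \<Rightarrow> int) \<Rightarrow> linear_condition \<Rightarrow> bool" where
  "satisfies_linear m x (LinEq \<alpha> \<beta>) \<longleftrightarrow> (\<Sum>i<m. \<alpha> i * x i) = \<beta>"
| "satisfies_linear m x (LinLe \<alpha> \<beta>) \<longleftrightarrow> (\<Sum>i<m. \<alpha> i * x i) \<le> \<beta>"

definition linear_length_constraint ::
    "('a, 'b) monoid_scheme \<Rightarrow> nat \<Rightarrow> 'a list set \<Rightarrow> bool" where
  "linear_length_constraint G m K \<longleftrightarrow>
     (\<exists>\<Sigma> \<omega> conds. weighted_generating_set G \<Sigma> \<omega> \<and> finite conds \<and>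
        K = {gs \<in> tuples G m.
               \<forall>c\<in>conds. satisfies_linear m (\<lambda>i. int (weight G \<Sigma> \<omega> (gs ! i))) c})"

definition abelianisation :: "('a, 'b) monoid_scheme \<Rightarrow> 'a set monoid" where
  "abelianisation G = G Mod derived G (carrier G)"

definition abelianisation_constraint ::
    "('a, 'b) monoid_scheme \<Rightarrow> nat \<Rightarrow> 'a list set \<Rightarrow> bool" where
  "abelianisation_constraint G m K \<longleftrightarrow>
     (\<exists>E. finite_equation_system (abelianisation G) m E \<and>
        K = {gs \<in> tuples G m.
               map (\<lambda>g. derived G (carrier G) #>\<^bsub>G\<^esub> g) gs
                 \<in> equation_solutions (abelianisation G) m E})"

definition context_free_constraint ::
    "('a, 'b) monoid_scheme \<Rightarrow> nat \<Rightarrow> 'a list set \<Rightarrow> bool" where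
  "context_free_constraint G m K \<longleftrightarrow>
     (\<exists>S L i. finite_generating_set G S \<and> (\<forall>s\<in>S. inv\<^bsub>G\<^esub> s \<in> S) \<and>
        context_free_language S L \<and> i < m \<and>
        K = {gs \<in> tuples G m. gs ! i \<in> word_value G id ` L})"

definition lex_order_constraint ::
    "('a, 'b) monoid_scheme \<Rightarrow> 'a list \<Rightarrow> 'a set \<Rightarrow> ('a st_letter \<times> 'a st_letter) set \<Rightarrow>
      nat \<Rightarrow> 'a list set \<Rightarrow> bool" where
  "lex_order_constraint G bs T r m K \<longleftrightarrow>
     (\<exists>i j. i < m \<and> j < m \<and>
        K = {gs \<in> tuples G m.
               lex_le r (st_normal_form G bs T (gs ! i)) (st_normal_form G bs T (gs ! j))})"

end

theory Submission
  imports Defs "HOL-Decision_Procs.Cooper" "HOL-Library.Multiset"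
begin

text \<open>
  Everything is reduced to Presburger arithmetic in the coordinates of the subgroup
  \<open>A \<cong> \<int>\<^sup>n\<close>. On each coset of \<open>A\<close> group multiplication and inversion act by affine maps, so
  equations are linear; subgroups such as \<open>[G, G]\<close> are semilinear by Dickson's lemma; images of
  context-free languages are semilinear by a Parikh argument; comparing normal forms
  lexicographically is a case distinction on signs of coordinates. For the length constraints,
  every word can be rearranged, without changing its value and weight, into a skeleton of bounded
  length with powers of short loops (words with value in \<open>A\<close>) inserted, so that the weight
  function is a Presburger-definable minimum over finitely many such patterns.

  By quantifier elimination the solution set is then a finite union of linear sets in terms of the
  exponents of the patterns, and a language of patterns whose exponents run through a linear set
  is EDT0L. The geodesic normal form picks the first possible pattern and its
  lexicographically least exponents, which is again a Presburger-definable choice.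
\<close>

hide_const (open) Cooper.C Cooper.T Cooper.F Cooper.E Cooper.A Cooper.Or Cooper.And Cooper.Not
  Cooper.\<alpha> Cooper.\<beta> Cooper.\<zeta> Cooper.\<delta>

section \<open>Presburger predicates\<close>

text \<open>EDT0L languages are not closed under intersection, so the constraints cannot be imposed
  on languages one by one. They are intersected as arithmetic predicates, and a language is produced
  only once, from the final set of exponents.

  The length bound on skeletons answers one obstacle. As \<open>A\<close> is abelian, conjugation by
  \<open>g\<close> on \<open>A\<close> depends only on the coset of \<open>g\<close>; hence a loop
  cut out at one place may be put back wherever the same coset is visited. Cutting must therefore
  never lose a coset. Any \<open>N + 1\<close> consecutive prefixes contain a loop, where
  \<open>N\<close> is the index of \<open>A\<close>, but this loop may pass through a coset that is
  visited nowhere else. Only within \<open>N\<close> windows of length \<open>N\<close> is there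
  surely one without new cosets. So loops have length at most \<open>N\<close> and skeletons length
  at most \<open>N * N\<close>.

  A change of variables is then a composition, and adjoining exponents that are to be quantified
  means forming a pair.\<close>

inductive_set lin :: "('s \<Rightarrow> int) set \<Rightarrow> ('s \<Rightarrow> int) set" for F where
  lin_const: "(\<lambda>s. c) \<in> lin F"
| lin_base: "f \<in> F \<Longrightarrow> f \<in> lin F"
| lin_add: "f \<in> lin F \<Longrightarrow> g \<in> lin F \<Longrightarrow> (\<lambda>s. f s + g s) \<in> lin F"
| lin_mult: "f \<in> lin F \<Longrightarrow> (\<lambda>s. c * f s) \<in> lin F"

lemma lin_uminus: "f \<in> lin F \<Longrightarrow> (\<lambda>s. - f s) \<in> lin F"
  using lin_mult[of f F "-1"] by simp

lemma lin_diff: "f \<in> lin F \<Longrightarrow> g \<in> lin F \<Longrightarrow> (\<lambda>s. f s - g s) \<in> lin F"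
  using lin_add[OF _ lin_uminus] by fastforce

lemma lin_sum: "(\<And>i. i \<in> I \<Longrightarrow> f i \<in> lin F) \<Longrightarrow> (\<lambda>s. \<Sum>i\<in>I. f i s) \<in> lin F"
  by (induction I rule: infinite_finite_induct) (auto intro: lin_const lin_add)

lemma lin_mult_right: "f \<in> lin F \<Longrightarrow> (\<lambda>s. f s * c) \<in> lin F"
  using lin_mult[of f F c] by (simp add: mult.commute)

lemmas lin_intros = lin_const lin_add lin_mult lin_mult_right lin_uminus lin_diff lin_sum

lemma lin_subst:
  assumes "f \<in> lin F" "\<And>f. f \<in> F \<Longrightarrow> (\<lambda>s. f (h s)) \<in> lin F'"
  shows "(\<lambda>s. f (h s)) \<in> lin F'"
  using assms by (induction rule: lin.induct) (auto intro: lin_intros)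

lemma lin_cong:
  assumes "f \<in> lin F" "\<And>f. f \<in> F \<Longrightarrow> f s = f s'"
  shows "f s = f s'"
  using assms by (induction rule: lin.induct) auto

text \<open>The divisor \<open>d\<close> may be any integer; for 0 divisibility means vanishing.
  Quantifiers are not constructors: that they may be used is the content of quantifier elimination
  below.\<close>

inductive presb :: "('s \<Rightarrow> int) set \<Rightarrow> ('s \<Rightarrow> bool) \<Rightarrow> bool" for F where
  presb_ge: "f \<in> lin F \<Longrightarrow> presb F (\<lambda>s. 0 \<le> f s)"
| presb_dvd: "f \<in> lin F \<Longrightarrow> presb F (\<lambda>s. d dvd f s)"
| presb_not: "presb F P \<Longrightarrow> presb F (\<lambda>s. \<not> P s)"
| presb_conj: "presb F P \<Longrightarrow> presb F Q \<Longrightarrow> presb F (\<lambda>s. P s \<and> Q s)"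

lemma presb_le: "f \<in> lin F \<Longrightarrow> g \<in> lin F \<Longrightarrow> presb F (\<lambda>s. f s \<le> g s)"
  using presb_ge[OF lin_diff, of g F f] by simp

lemma presb_less: "f \<in> lin F \<Longrightarrow> g \<in> lin F \<Longrightarrow> presb F (\<lambda>s. f s < g s)"
  using presb_not[OF presb_le, of g F f] by (simp add: not_le)

lemma presb_eq: "f \<in> lin F \<Longrightarrow> g \<in> lin F \<Longrightarrow> presb F (\<lambda>s. f s = g s)"
proof -
  assume "f \<in> lin F" "g \<in> lin F"
  then have "presb F (\<lambda>s. f s \<le> g s \<and> g s \<le> f s)" by (intro presb_conj presb_le)
  moreover have "(\<lambda>s. f s \<le> g s \<and> g s \<le> f s) = (\<lambda>s. f s = g s)" by auto
  ultimately show "presb F (\<lambda>s. f s = g s)" by simp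
qed

lemma presb_const: "presb F (\<lambda>s. b)"
  using presb_ge[OF lin_const[of "if b then 0 else -1"], of F] by (cases b) auto

lemma presb_disj: "presb F P \<Longrightarrow> presb F Q \<Longrightarrow> presb F (\<lambda>s. P s \<or> Q s)"
  using presb_not[OF presb_conj[OF presb_not presb_not], of F P Q] by simp

lemma presb_imp: "presb F P \<Longrightarrow> presb F Q \<Longrightarrow> presb F (\<lambda>s. P s \<longrightarrow> Q s)"
  using presb_disj[OF presb_not, of F P Q] by simp

lemma presb_ball: "finite I \<Longrightarrow> (\<And>i. i \<in> I \<Longrightarrow> presb F (P i)) \<Longrightarrow> presb F (\<lambda>s. \<forall>i\<in>I. P i s)"
  by (induction I rule: finite_induct) (auto intro: presb_const presb_conj)

lemma presb_bex: "finite I \<Longrightarrow> (\<And>i. i \<in> I \<Longrightarrow> presb F (P i)) \<Longrightarrow> presb F (\<lambda>s. \<exists>i\<in>I. P i s)"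
  by (induction I rule: finite_induct) (auto intro: presb_const presb_disj)

lemmas presb_intros = presb_const presb_le presb_less presb_eq presb_not presb_conj presb_disj
  presb_imp presb_ball presb_bex

lemma presb_subst:
  assumes "presb F P" "\<And>f. f \<in> F \<Longrightarrow> (\<lambda>s. f (h s)) \<in> lin F'"
  shows "presb F' (\<lambda>s. P (h s))"
  using assms
proof (induction rule: presb.induct)
  case (presb_ge f)
  then show ?case using lin_subst[of f F h F'] by (intro presb.presb_ge) auto
next
  case (presb_dvd f d)
  then show ?case using lin_subst[of f F h F'] by (intro presb.presb_dvd) auto
qed (auto intro: presb.intros)

lemma presb_cong:
  assumes "presb F P" "\<And>f. f \<in> F \<Longrightarrow> f s = f s'"
  shows "P s = P s'"
proof -
  have lin: "f s = f s'" if "f \<in> lin F" for f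
    by (rule lin_cong[OF that assms(2)])
  show ?thesis using assms(1)
  proof (induction rule: presb.induct)
    case (presb_ge f)
    show ?case by (simp only: lin[OF presb_ge])
  next
    case (presb_dvd f d)
    show ?case by (simp only: lin[OF presb_dvd])
  qed auto
qed

text \<open>The opposite of \<open>presb_subst\<close>: a predicate is factored through
  \<open>e\<close>, which may be neither injective nor surjective. The same formula read over
  \<open>F'\<close> serves as \<open>P'\<close>. This is how conditions on natural vectors become
  conditions on integer vectors.\<close>

lemma presb_lift:
  assumes "presb F P" "\<And>f. f \<in> F \<Longrightarrow> \<exists>f'\<in>lin F'. \<forall>s. f s = f' (e s)"
  shows "\<exists>P'. presb F' P' \<and> (\<forall>s. P s = P' (e s))"
proof -
  have lift: "\<exists>f'\<in>lin F'. \<forall>s. f s = f' (e s)" if "f \<in> lin F" for f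
    using that
  proof (induction rule: lin.induct)
    case (lin_const c)
    show ?case by (rule bexI[of _ "\<lambda>s. c"]) (auto intro: lin.intros)
  next
    case (lin_base f)
    then show ?case using assms(2) by blast
  next
    case (lin_add f g)
    then obtain f' g' where "f' \<in> lin F'" "g' \<in> lin F'" "\<forall>s. f s = f' (e s)" "\<forall>s. g s = g' (e s)"
      by blast
    then show ?case by (intro bexI[of _ "\<lambda>s. f' s + g' s"]) (auto intro: lin.intros)
  next
    case (lin_mult f c)
    then obtain f' where "f' \<in> lin F'" "\<forall>s. f s = f' (e s)" by blast
    then show ?case by (intro bexI[of _ "\<lambda>s. c * f' s"]) (auto intro: lin.intros)
  qed
  show ?thesis using assms(1)
  proof (induction rule: presb.induct)
    case (presb_ge f)
    then show ?case using lift[of f] by (metis presb.presb_ge)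
  next
    case (presb_dvd f d)
    then show ?case using lift[of f] by (metis presb.presb_dvd)
  next
    case (presb_not P)
    then show ?case by (metis presb.presb_not)
  next
    case (presb_conj P Q)
    then obtain P' Q' where "presb F' P'" "presb F' Q'" "\<forall>s. P s = P' (e s)" "\<forall>s. Q s = Q' (e s)"
      by blast
    then show ?case by (intro exI[of _ "\<lambda>s. P' s \<and> Q' s"]) (auto intro: presb.intros)
  qed
qed

section \<open>Quantifier elimination\<close>

lemma presb_to_fm:
  assumes "presb F P" "F = set fs"
  shows "\<exists>p. \<forall>s. P s \<longleftrightarrow> Ifm [] (map (\<lambda>f. f s) fs) p"
proof -
  have num: "\<exists>t. \<forall>s. f s = Inum (map (\<lambda>f. f s) fs) t" if "f \<in> lin F" for f
    using that
  proof (induction rule: lin.induct)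
    case (lin_const c)
    show ?case by (rule exI[of _ "Cooper.C c"]) auto
  next
    case (lin_base f)
    then obtain i where "i < length fs" "fs ! i = f"
      using assms(2) by (metis in_set_conv_nth)
    then show ?case by (intro exI[of _ "Cooper.Bound i"]) auto
  next
    case (lin_add f g)
    then show ?case by (metis Inum.simps(5))
  next
    case (lin_mult f c)
    then show ?case by (metis Inum.simps(7))
  qed
  show ?thesis using assms(1)
  proof (induction rule: presb.induct)
    case (presb_ge f)
    then show ?case using num[of f] by (metis Ifm.simps(6))
  next
    case (presb_dvd f d)
    then show ?case using num[of f] by (metis Ifm.simps(9))
  next
    case (presb_not P)
    then show ?case by (metis Ifm.simps(11))
  next
    case (presb_conj P Q)
    then show ?case by (metis Ifm.simps(12))
  qed
qed

lemma qfree_presb: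
  assumes "qfree p"
  shows "presb (set fs) (\<lambda>s. Ifm [] (map (\<lambda>f. f s) fs) p)"
proof -
  have nth: "(\<lambda>s. map (\<lambda>f. f s) fs ! i) \<in> lin (set fs)" for i
  proof (cases "i < length fs")
    case True
    then show ?thesis using lin_base[of "fs ! i" "set fs"] by simp
  next
    case False
    \<comment> \<open>An index beyond the environment evaluates to an element of the empty list,
      which is unspecified but does not depend on \<open>s\<close>, hence a constant
      functional.\<close>
    then have "map (\<lambda>f. f s) fs ! i = [] ! (i - length fs)" for s
      using nth_append[of "map (\<lambda>f. f s) fs" "[]" i] by simp
    then show ?thesis by (simp add: lin_const)
  qed
  have num: "(\<lambda>s. Inum (map (\<lambda>f. f s) fs) t) \<in> lin (set fs)" for t
    by (induction t) (auto intro!: lin_intros nth)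
  show ?thesis using assms
    by (induction p) (auto intro!: presb_intros presb_dvd num lin_const simp: iff_conv_conj_imp)
qed

text \<open>Quantifier elimination is Cooper's algorithm: the values of the functionals in \<open>F\<close> form
  the environment, so the quantified variable \<open>snd\<close> can take de Bruijn index 0.\<close>

lemma presb_ex:
  assumes "finite F" "presb (insert snd ((\<lambda>f s. f (fst s)) ` F)) P"
  shows "presb F (\<lambda>s. \<exists>x. P (s, x))"
proof -
  obtain fs where fs: "set fs = F" using assms(1) finite_list by blast
  define fs' where "fs' = snd # map (\<lambda>f s. f (fst s)) fs"
  obtain p where p: "\<And>s. P s \<longleftrightarrow> Ifm [] (map (\<lambda>f. f s) fs') p"
    using presb_to_fm[OF assms(2), of fs'] fs fs'_def by auto
  have "P (s, x) \<longleftrightarrow> Ifm [] (x # map (\<lambda>f. f s) fs) p" for s x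
    unfolding p fs'_def by (simp add: comp_def)
  then have "(\<exists>x. P (s, x)) \<longleftrightarrow> Ifm [] (map (\<lambda>f. f s) fs) (pa (Cooper.E p))" for s
    by (simp add: mirqe)
  then show ?thesis using qfree_presb[of "pa (Cooper.E p)" fs] fs mirqe by simp
qed

text \<open>\<open>P\<close> reads \<open>x\<close> only at the finitely many points of
  \<open>V\<close>, so quantifying over the function is a finite block of integer quantifiers. One
  of them is split off by writing the function as \<open>x(v := y)\<close>.\<close>

lemma presb_ex_fun:
  assumes "finite V" "finite F"
    and "presb ((\<lambda>f s. f (fst s)) ` F \<union> (\<lambda>v s. snd s v) ` V) P"
  shows "presb F (\<lambda>s. \<exists>x :: 'v \<Rightarrow> int. P (s, x))"
  using assms(1,3)
proof (induction V arbitrary: P rule: finite_induct)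
  case empty
  have "P (s, x) = P (s, \<lambda>_. 0)" for s x
    by (rule presb_cong[OF empty]) auto
  then have "(\<lambda>s. \<exists>x. P (s, x)) = (\<lambda>s. P (s, \<lambda>_. 0))" by auto
  moreover have "presb F (\<lambda>s. P (s, \<lambda>_. 0))"
    by (rule presb_subst[OF empty, where h = "\<lambda>s. (s, \<lambda>_. 0)"]) (auto intro: lin_base)
  ultimately show ?case by simp
next
  case (insert v V)
  let ?F = "(\<lambda>f s. f (fst s)) ` F \<union> (\<lambda>v s. snd s v) ` V"
  let ?P = "\<lambda>sy. P (fst (fst sy), (snd (fst sy))(v := snd sy))"
  have P: "presb (insert snd ((\<lambda>f s. f (fst s)) ` ?F)) ?P"
  proof (rule presb_subst[OF insert.prems, where h = "\<lambda>sy. (fst (fst sy), (snd (fst sy))(v := snd sy))"])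
    fix f :: "'a \<times> ('v \<Rightarrow> int) \<Rightarrow> int"
    assume "f \<in> (\<lambda>f s. f (fst s)) ` F \<union> (\<lambda>v s. snd s v) ` insert v V"
    then consider g where "g \<in> F" "f = (\<lambda>s. g (fst s))" | "f = (\<lambda>s. snd s v)"
      | w where "w \<in> V" "f = (\<lambda>s. snd s w)" by auto
    then show "(\<lambda>s. f (fst (fst s), (snd (fst s))(v := snd s)))
        \<in> lin (insert snd ((\<lambda>f s. f (fst s)) ` ?F))"
    proof cases
      case 1
      then show ?thesis by (intro lin_base insertI2 image_eqI[of _ _ "\<lambda>s. g (fst s)"]) auto
    next
      case 2
      then show ?thesis by (intro lin_base) auto
    next
      case 3
      then have "w \<noteq> v" using insert.hyps by auto
      with 3 show ?thesis by (intro lin_base insertI2 image_eqI[of _ _ "\<lambda>s. snd s w"]) auto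
    qed
  qed
  \<comment> \<open>The value at \<open>v\<close> is eliminated first, with the rest of the function
    still among the parameters.\<close>
  have "presb ?F (\<lambda>s. \<exists>y. ?P (s, y))"
    by (rule presb_ex[OF _ P]) (use insert.hyps assms(2) in simp)
  then have "presb F (\<lambda>s. \<exists>x. \<exists>y. ?P ((s, x), y))"
    by (rule insert.IH)
  moreover have "(\<exists>x. \<exists>y. ?P ((s, x), y)) \<longleftrightarrow> (\<exists>x. P (s, x))" for s
    by simp (metis fun_upd_triv)
  ultimately show ?case by simp
qed

definition natvars :: "'v set \<Rightarrow> (('v \<Rightarrow> nat) \<Rightarrow> int) set" where
  "natvars V = (\<lambda>v x. int (x v)) ` V"

text \<open>The first component of a state carries the parameters, the second one the exponents
  about to be quantified.\<close>

definition pairvars :: "('s \<Rightarrow> int) set \<Rightarrow> 'v set \<Rightarrow> ('s \<times> ('v \<Rightarrow> nat) \<Rightarrow> int) set" where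
  "pairvars F V = (\<lambda>f s. f (fst s)) ` F \<union> (\<lambda>v s. int (snd s v)) ` V"

lemma lin_pairvars_fst: "f \<in> lin F \<Longrightarrow> (\<lambda>y. f (fst y)) \<in> lin (pairvars F V)"
  by (rule lin_subst[where f = f and h = fst]) (auto simp: pairvars_def intro: lin_base)

lemma lin_pairvars_snd: "v \<in> V \<Longrightarrow> (\<lambda>y. int (snd y v)) \<in> lin (pairvars F V)"
  by (auto simp: pairvars_def intro: lin_base)

lemma lin_natvars: "v \<in> V \<Longrightarrow> (\<lambda>x. int (x v)) \<in> lin (natvars V)"
  by (auto simp: natvars_def intro: lin_base)

lemma finite_pairvars: "finite F \<Longrightarrow> finite V \<Longrightarrow> finite (pairvars F V)"
  by (simp add: pairvars_def)

lemma finite_natvars: "finite V \<Longrightarrow> finite (natvars V)"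
  by (simp add: natvars_def)

text \<open>Naturals are simulated by integers constrained to be nonnegative on \<open>V\<close>,
  after \<open>presb_lift\<close> has rewritten \<open>P\<close> over integer vectors.\<close>

lemma presb_ex_nat:
  assumes "finite V" "finite F" "presb (pairvars F V) P"
  shows "presb F (\<lambda>s. \<exists>x :: 'v \<Rightarrow> nat. P (s, x))"
proof -
  let ?F = "(\<lambda>f s. f (fst s)) ` F \<union> (\<lambda>v s. snd s v) ` V"
  let ?e = "\<lambda>s. (fst s, \<lambda>v. int (snd s v))"
  have "\<exists>P'. presb ?F P' \<and> (\<forall>s. P s = P' (?e s))"
  proof (rule presb_lift[OF assms(3)])
    fix f :: "'a \<times> ('v \<Rightarrow> nat) \<Rightarrow> int"
    assume "f \<in> pairvars F V"
    then consider g where "g \<in> F" "f = (\<lambda>s. g (fst s))" | v where "v \<in> V" "f = (\<lambda>s. int (snd s v))"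
      by (auto simp: pairvars_def)
    then show "\<exists>f'\<in>lin ?F. \<forall>s. f s = f' (?e s)"
    proof cases
      case 1
      then show ?thesis by (intro bexI[of _ "\<lambda>s. g (fst s)"]) (auto intro: lin_base)
    next
      case 2
      then show ?thesis by (intro bexI[of _ "\<lambda>s. snd s v"]) (auto intro: lin_base)
    qed
  qed
  then obtain P' where P': "presb ?F P'" "\<And>s. P s = P' (?e s)" by blast
  have "presb ?F (\<lambda>s. (\<forall>v\<in>V. 0 \<le> snd s v) \<and> P' s)"
    using assms(1) by (intro presb_conj presb_ball presb_le P') (auto intro: lin_const lin_base)
  from presb_ex_fun[OF assms(1,2) this]
  have 1: "presb F (\<lambda>s. \<exists>x. (\<forall>v\<in>V. 0 \<le> x v) \<and> P' (s, x))" by simp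
  have "(\<exists>x. (\<forall>v\<in>V. 0 \<le> x v) \<and> P' (s, x)) \<longleftrightarrow> (\<exists>x. P (s, x))" for s
  proof
    assume "\<exists>x. (\<forall>v\<in>V. 0 \<le> x v) \<and> P' (s, x)"
    then obtain x where x: "\<forall>v\<in>V. 0 \<le> x v" "P' (s, x)" by blast
    \<comment> \<open>Truncation by \<open>nat\<close> changes \<open>x\<close> only where it is
      negative, which can happen only outside \<open>V\<close>, where \<open>P'\<close> does not
      look.\<close>
    have "P' (s, x) = P' (?e (s, \<lambda>v. nat (x v)))"
      by (rule presb_cong[OF P'(1)]) (use x in auto)
    then show "\<exists>x. P (s, x)" using x P' by blast
  next
    assume "\<exists>x. P (s, x)"
    then obtain x where "P (s, x)" by blast
    then show "\<exists>x. (\<forall>v\<in>V. 0 \<le> x v) \<and> P' (s, x)"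
      by (intro exI[of _ "\<lambda>v. int (x v)"]) (auto simp: P')
  qed
  with 1 show ?thesis by simp
qed

section \<open>Semilinear sets\<close>

lemma incseq_subseq_nat:
  fixes f :: "nat \<Rightarrow> nat"
  shows "\<exists>r. strict_mono r \<and> incseq (\<lambda>n. f (r n))"
proof -
  obtain r where r: "strict_mono r" "monoseq (\<lambda>n. f (r n))"
    using seq_monosub[of f] by blast
  show ?thesis
  proof (cases "incseq (\<lambda>n. f (r n))")
    case True
    then show ?thesis using r by blast
  next
    case False
    then have dec: "decseq (\<lambda>n. f (r n))" using r(2) monoseq_iff by blast
    \<comment> \<open>A decreasing sequence of naturals is constant from the point where it attains
      its minimum, so a tail of it is also increasing.\<close>
    define m where "m = (LEAST k. \<exists>n. f (r n) = k)"
    have "\<exists>n. f (r n) = m" unfolding m_def by (rule LeastI) blast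
    then obtain N where N: "f (r N) = m" by blast
    have "f (r (n + N)) = m" for n
    proof (rule antisym)
      show "f (r (n + N)) \<le> m" using dec N by (metis decseq_def le_add2)
      show "m \<le> f (r (n + N))" unfolding m_def by (rule Least_le) blast
    qed
    moreover have "strict_mono (\<lambda>n. r (n + N))"
      using r(1) by (simp add: strict_mono_def)
    ultimately show ?thesis by (intro exI[of _ "\<lambda>n. r (n + N)"]) (simp add: incseq_def)
  qed
qed

lemma incseq_subseq_fun:
  fixes f :: "nat \<Rightarrow> 'v \<Rightarrow> nat"
  assumes "finite V"
  shows "\<exists>r. strict_mono r \<and> (\<forall>v\<in>V. incseq (\<lambda>n. f (r n) v))"
  using assms
proof (induction V rule: finite_induct)
  case empty
  show ?case by (rule exI[of _ "\<lambda>n. n"]) (simp add: strict_mono_def)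
next
  case (insert v V)
  then obtain r where r: "strict_mono r" "\<forall>v\<in>V. incseq (\<lambda>n. f (r n) v)" by blast
  obtain q where q: "strict_mono q" "incseq (\<lambda>n. f (r (q n)) v)"
    using incseq_subseq_nat[of "\<lambda>n. f (r n) v"] by blast
  have "incseq (\<lambda>n. f (r (q n)) w)" if "w \<in> V" for w
    using r(2) that q(1) by (auto simp: incseq_def strict_mono_less_eq)
  moreover have "strict_mono (\<lambda>n. r (q n))"
    using r(1) q(1) by (simp add: strict_mono_def)
  ultimately show ?case using q(2) by (intro exI[of _ "\<lambda>n. r (q n)"]) auto
qed

text \<open>If no finite subset of \<open>X\<close> lay below all of \<open>X\<close>, one could
  forever pick elements that lie above no earlier pick. A subsequence that increases in every
  coordinate contradicts this.\<close>

lemma dickson: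
  fixes X :: "('v \<Rightarrow> nat) set"
  assumes "finite V"
  shows "\<exists>B\<subseteq>X. finite B \<and> (\<forall>x\<in>X. \<exists>b\<in>B. \<forall>v\<in>V. b v \<le> x v)"
proof (rule ccontr)
  assume neg: "\<not> ?thesis"
  let ?good = "\<lambda>B x. x \<in> X \<and> (\<forall>b\<in>B. \<not> (\<forall>v\<in>V. b v \<le> x v))"
  have choice: "?good B (SOME x. ?good B x)" if "B \<subseteq> X" "finite B" for B
  proof -
    have "\<exists>x\<in>X. \<not> (\<exists>b\<in>B. \<forall>v\<in>V. b v \<le> x v)" using neg that by meson
    then have "\<exists>x. ?good B x" by meson
    then show ?thesis by (rule someI_ex)
  qed
  \<comment> \<open>\<open>G n\<close> is the set of the first \<open>n\<close> picks,
    \<open>f n\<close> the next pick.\<close>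
  define G where "G = rec_nat {} (\<lambda>_ B. insert (SOME x. ?good B x) B)"
  define f where "f n = (SOME x. ?good (G n) x)" for n
  have GS: "G (Suc n) = insert (f n) (G n)" for n
    by (simp add: G_def f_def)
  have G: "G n \<subseteq> X \<and> finite (G n)" for n
  proof (induction n)
    case 0
    show ?case by (simp add: G_def)
  next
    case (Suc n)
    then have "f n \<in> X" unfolding f_def using choice[of "G n"] by blast
    then show ?case using Suc GS by simp
  qed
  have f: "?good (G n) (f n)" for n
    unfolding f_def by (rule choice) (use G in auto)
  have mem: "m < n \<Longrightarrow> f m \<in> G n" for m n
    by (induction n) (auto simp: GS less_Suc_eq)
  obtain r where r: "strict_mono r" "\<forall>v\<in>V. incseq (\<lambda>n. f (r n) v)"
    using incseq_subseq_fun[OF assms] by blast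
  have "f (r 0) \<in> G (r 1)" using r(1) by (intro mem) (simp add: strict_mono_def)
  moreover have "\<forall>v\<in>V. f (r 0) v \<le> f (r 1) v" using r(2) by (auto simp: incseq_def)
  ultimately show False using f by blast
qed

text \<open>Subtracting from \<open>x\<close> a basis element below it stays in \<open>M\<close> and
  lowers the coordinate sum. Only the inclusion of \<open>M\<close> in the monoid generated by
  \<open>P\<close> is obtained; that sums of basis elements satisfy the defining condition is
  checked at each use.\<close>

lemma subtractive_finite_basis:
  fixes M :: "('v \<Rightarrow> nat) set"
  assumes "finite V" and supp: "\<And>x v. x \<in> M \<Longrightarrow> v \<notin> V \<Longrightarrow> x v = 0"
    and diff: "\<And>x y. x \<in> M \<Longrightarrow> y \<in> M \<Longrightarrow> \<forall>v. y v \<le> x v \<Longrightarrow> (\<lambda>v. x v - y v) \<in> M"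
  shows "\<exists>P\<subseteq>M. finite P \<and> (\<forall>x\<in>M. \<exists>ps\<in>lists P. \<forall>v. x v = (\<Sum>p\<leftarrow>ps. p v))"
proof -
  \<comment> \<open>The zero vector lies below everything and would make the recursion
    stall.\<close>
  obtain P where P: "P \<subseteq> M - {\<lambda>_. 0}" "finite P"
    "\<forall>x\<in>M - {\<lambda>_. 0}. \<exists>b\<in>P. \<forall>v\<in>V. b v \<le> x v"
    using dickson[OF assms(1), of "M - {\<lambda>_. 0}"] by blast
  have "\<exists>ps\<in>lists P. \<forall>v. x v = (\<Sum>p\<leftarrow>ps. p v)" if "x \<in> M" for x
    using that
  proof (induction "\<Sum>v\<in>V. x v" arbitrary: x rule: less_induct)
    case less
    show ?case
    proof (cases "x = (\<lambda>_. 0)")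
      case True
      then show ?thesis by (intro bexI[of _ "[]"]) auto
    next
      case False
      then obtain b where b: "b \<in> P" "\<forall>v\<in>V. b v \<le> x v" using P(3) less.prems by blast
      have bM: "b \<in> M" "b \<noteq> (\<lambda>_. 0)" using b P by auto
      have le: "\<forall>v. b v \<le> x v" using b(2) supp[OF bM(1)] by (metis le0)
      have "(\<Sum>v\<in>V. x v - b v) < (\<Sum>v\<in>V. x v)"
      proof -
        obtain v where "b v \<noteq> 0" using bM(2) by blast
        then have "v \<in> V" using supp[OF bM(1)] by metis
        then show ?thesis using \<open>b v \<noteq> 0\<close> le
          by (intro sum_strict_mono_ex1[OF assms(1)] bexI[of _ v] diff_less)
            (auto intro: less_le_trans)
      qed
      then obtain ps where ps: "ps \<in> lists P" "\<forall>v. x v - b v = (\<Sum>p\<leftarrow>ps. p v)"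
        using less.hyps diff[OF less.prems bM(1) le] by blast
      then have "\<forall>v. x v = (\<Sum>p\<leftarrow>b # ps. p v)" using le
        by (metis add.commute le_add_diff_inverse2 list.simps(9) sum_list.Cons)
      then show ?thesis using ps(1) b(1) by (intro bexI[of _ "b # ps"]) auto
    qed
  qed
  then show ?thesis using P by blast
qed

text \<open>An atom \<open>(f, d, d')\<close> stands for \<open>f = d * y - d' * y'\<close> with existentially quantified
  naturals \<open>y, y'\<close>; this covers inequalities (\<open>d = 1, d' = 0\<close>) and divisibility (\<open>d = d'\<close>).\<close>

fun atom_sem :: "('s \<Rightarrow> int) \<times> int \<times> int \<Rightarrow> 's \<Rightarrow> bool" where
  "atom_sem (f, d, d') s \<longleftrightarrow> (\<exists>y y'. f s = d * int y - d' * int y')"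

lemma atom_sem_ge: "atom_sem (f, 1, 0) s \<longleftrightarrow> 0 \<le> f s"
  using zero_le_imp_eq_int by auto

lemma atom_sem_dvd: "atom_sem (f, d, d) s \<longleftrightarrow> d dvd f s"
proof
  assume "d dvd f s"
  then obtain k where "f s = d * k" by blast
  moreover have "k = int (nat k) - int (nat (- k))" by simp
  ultimately have "f s = d * int (nat k) - d * int (nat (- k))" by (metis right_diff_distrib)
  then show "atom_sem (f, d, d) s" unfolding atom_sem.simps by blast
qed (auto simp: right_diff_distrib[symmetric])

declare atom_sem.simps [simp del]

section \<open>Disjunctive normal forms\<close>

definition dnf :: "('s \<Rightarrow> int) set \<Rightarrow> ('s \<Rightarrow> bool) \<Rightarrow> bool" where
  "dnf F P \<longleftrightarrow> (\<exists>\<A>. finite \<A> \<and> \<A> \<subseteq> lists (lin F \<times> UNIV) \<and> (\<forall>s. P s \<longleftrightarrow> (\<exists>as\<in>\<A>. \<forall>a\<in>set as. atom_sem a s)))"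

lemma dnf_atom: "f \<in> lin F \<Longrightarrow> dnf F (atom_sem (f, d))"
  unfolding dnf_def by (rule exI[of _ "{[(f, d)]}"]) auto

lemma dnf_disj:
  assumes "dnf F P" "dnf F Q"
  shows "dnf F (\<lambda>s. P s \<or> Q s)"
proof -
  obtain \<A> \<B> where "finite \<A>" "\<A> \<subseteq> lists (lin F \<times> UNIV)" "\<forall>s. P s \<longleftrightarrow> (\<exists>as\<in>\<A>. \<forall>a\<in>set as. atom_sem a s)"
    "finite \<B>" "\<B> \<subseteq> lists (lin F \<times> UNIV)" "\<forall>s. Q s \<longleftrightarrow> (\<exists>as\<in>\<B>. \<forall>a\<in>set as. atom_sem a s)"
    using assms unfolding dnf_def by blast
  then show ?thesis unfolding dnf_def by (intro exI[of _ "\<A> \<union> \<B>"]) blast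
qed

lemma dnf_conj:
  assumes "dnf F P" "dnf F Q"
  shows "dnf F (\<lambda>s. P s \<and> Q s)"
proof -
  obtain \<A> \<B> where 1: "finite \<A>" "\<A> \<subseteq> lists (lin F \<times> UNIV)" "\<forall>s. P s \<longleftrightarrow> (\<exists>as\<in>\<A>. \<forall>a\<in>set as. atom_sem a s)"
    and 2: "finite \<B>" "\<B> \<subseteq> lists (lin F \<times> UNIV)" "\<forall>s. Q s \<longleftrightarrow> (\<exists>as\<in>\<B>. \<forall>a\<in>set as. atom_sem a s)"
    using assms unfolding dnf_def by blast
  let ?C = "(\<lambda>(as, bs). as @ bs) ` (\<A> \<times> \<B>)"
  have "(P s \<and> Q s) \<longleftrightarrow> (\<exists>cs\<in>?C. \<forall>a\<in>set cs. atom_sem a s)" for s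
  proof
    assume "P s \<and> Q s"
    then obtain as bs where "as \<in> \<A>" "bs \<in> \<B>" "\<forall>a\<in>set as. atom_sem a s" "\<forall>a\<in>set bs. atom_sem a s"
      using 1(3) 2(3) by blast
    then show "\<exists>cs\<in>?C. \<forall>a\<in>set cs. atom_sem a s"
      by (intro bexI[of _ "as @ bs"]) auto
  next
    assume "\<exists>cs\<in>?C. \<forall>a\<in>set cs. atom_sem a s"
    then obtain cs where cs: "cs \<in> ?C" "\<forall>a\<in>set cs. atom_sem a s" by blast
    from cs(1) obtain as bs where ab: "cs = as @ bs" "as \<in> \<A>" "bs \<in> \<B>"
      by (elim imageE SigmaE) simp
    have as: "\<forall>a\<in>set as. atom_sem a s" and bs: "\<forall>a\<in>set bs. atom_sem a s"
      using cs(2) unfolding ab(1) by simp_all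
    have "\<exists>as\<in>\<A>. \<forall>a\<in>set as. atom_sem a s" "\<exists>bs\<in>\<B>. \<forall>a\<in>set bs. atom_sem a s"
      by (intro bexI[of _ as] as ab(2), intro bexI[of _ bs] bs ab(3))
    then show "P s \<and> Q s" using 1(3) 2(3) by blast
  qed
  moreover have "?C \<subseteq> lists (lin F \<times> UNIV)"
  proof
    fix cs assume "cs \<in> ?C"
    then obtain as bs where "cs = as @ bs" "as \<in> \<A>" "bs \<in> \<B>"
      by (elim imageE SigmaE) simp
    then show "cs \<in> lists (lin F \<times> UNIV)"
      using subsetD[OF 1(2), of as] subsetD[OF 2(2), of bs] by simp
  qed
  ultimately show ?thesis unfolding dnf_def using 1(1) 2(1) by (intro exI[of _ ?C]) blast
qed

lemma dnf_bex:
  assumes "finite I" "\<And>i. i \<in> I \<Longrightarrow> dnf F (P i)"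
  shows "dnf F (\<lambda>s. \<exists>i\<in>I. P i s)"
  using assms
proof (induction I rule: finite_induct)
  case empty
  show ?case unfolding dnf_def by (rule exI[of _ "{}"]) auto
next
  case (insert i I)
  then show ?case using dnf_disj[of F "P i" "\<lambda>s. \<exists>i\<in>I. P i s"] by auto
qed

text \<open>Atoms hide existential quantifiers and cannot be negated. Carrying \<open>P\<close> and
  its negation through the induction together pushes negations down to inequalities and
  divisibilities, where they can be expressed positively.\<close>

lemma presb_dnf:
  assumes "presb F P"
  shows "dnf F P \<and> dnf F (\<lambda>s. \<not> P s)"
proof -
  have ge: "dnf F (\<lambda>s. 0 \<le> f s)" if "f \<in> lin F" for f
    using dnf_atom[OF that, of "(1, 0)"] by (simp only: atom_sem_ge[abs_def])
  have dvd: "dnf F (\<lambda>s. d dvd f s)" if "f \<in> lin F" for f d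
    using dnf_atom[OF that, of "(d, d)"] by (simp only: atom_sem_dvd[abs_def])
  show ?thesis using assms
  proof (induction rule: presb.induct)
    case (presb_ge f)
    have "dnf F (\<lambda>s. 0 \<le> - f s - 1)" by (intro ge lin_intros presb_ge)
    moreover have "(\<lambda>s. 0 \<le> - f s - 1) = (\<lambda>s. \<not> 0 \<le> f s)" by auto
    ultimately show ?case using ge[OF presb_ge] by (simp only: simp_thms)
  next
    case (presb_dvd f d)
    have "dnf F (\<lambda>s. \<not> d dvd f s)"
    \<comment> \<open>For \<open>d = 0\<close> the negation says that \<open>f s\<close> is nonzero,
      a disjunction of two inequalities. Otherwise it says that the remainder modulo
      \<open>d\<close> is one of finitely many nonzero values.\<close>
    proof (cases "d = 0")
      case True
      have "dnf F (\<lambda>s. 0 \<le> - f s - 1 \<or> 0 \<le> f s - 1)" by (intro dnf_disj ge lin_intros presb_dvd)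
      moreover have "(\<lambda>s. 0 \<le> - f s - 1 \<or> 0 \<le> f s - 1) = (\<lambda>s. \<not> d dvd f s)" using True by auto
      ultimately show ?thesis by simp
    next
      case False
      have "dnf F (\<lambda>s. \<exists>i\<in>{1..<\<bar>d\<bar>}. d dvd f s - i)"
        by (intro dnf_bex dvd lin_intros presb_dvd) auto
      moreover have "(\<exists>i\<in>{1..<\<bar>d\<bar>}. d dvd f s - i) \<longleftrightarrow> \<not> d dvd f s" for s
      proof
        assume "\<exists>i\<in>{1..<\<bar>d\<bar>}. d dvd f s - i"
        then obtain i where i: "1 \<le> i" "i < \<bar>d\<bar>" "d dvd f s - i" by auto
        show "\<not> d dvd f s"
        proof
          assume "d dvd f s"
          then have "d dvd i" using i(3) by (metis dvd_diff diff_diff_eq2 add_diff_cancel_left')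
          then show False using i by (meson zdvd_not_zless abs_dvd_iff zero_less_one less_le_trans)
        qed
      next
        assume n: "\<not> d dvd f s"
        let ?i = "f s mod \<bar>d\<bar>"
        have "?i \<noteq> 0" using n by (auto simp: dvd_eq_mod_eq_0[symmetric])
        moreover have "0 \<le> ?i" "?i < \<bar>d\<bar>" using False by auto
        moreover have "d dvd f s - ?i" by (metis abs_dvd_iff dvd_minus_mod)
        ultimately show "\<exists>i\<in>{1..<\<bar>d\<bar>}. d dvd f s - i" by (intro bexI[of _ ?i]) auto
      qed
      ultimately show ?thesis by simp
    qed
    then show ?case using dvd[OF presb_dvd] by simp
  next
    case (presb_not P)
    then show ?case by simp
  next
    case (presb_conj P Q)
    then show ?case using dnf_conj[of F P Q] dnf_disj[of F "\<lambda>s. \<not> P s" "\<lambda>s. \<not> Q s"] by simp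
  qed
qed

text \<open>Members of \<open>lin\<close> are affine; \<open>f (\<lambda>_. 0)\<close> is the
  constant term, which the sum on the right would otherwise count twice.\<close>

lemma lin_natvars_add:
  assumes "f \<in> lin (natvars V)"
  shows "f (\<lambda>v. x v + y v) = f x + f y - f (\<lambda>_. 0)"
  using assms
proof (induction rule: lin.induct)
  case (lin_mult f c)
  show ?case unfolding lin_mult.IH by (simp add: algebra_simps)
qed (auto simp: natvars_def)

lemma lin_natvars_diff:
  assumes "f \<in> lin (natvars V)" "\<forall>v. y v \<le> x v"
  shows "f (\<lambda>v. x v - y v) = f x - f y + f (\<lambda>_. 0)"
  using lin_natvars_add[OF assms(1), of "\<lambda>v. x v - y v" y] assms(2) by simp

lemma lin_natvars_sum_list:
  assumes "f \<in> lin (natvars V)" "\<forall>p\<in>set ps. f p - f (\<lambda>_. 0) = g p"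
  shows "f (\<lambda>v. b v + (\<Sum>p\<leftarrow>ps. p v)) = f b + (\<Sum>p\<leftarrow>ps. g p)"
  using assms(2)
proof (induction ps)
  case (Cons p ps)
  have "f (\<lambda>v. b v + (\<Sum>p\<leftarrow>p # ps. p v)) = f (\<lambda>v. p v + (b v + (\<Sum>p\<leftarrow>ps. p v)))"
    by (simp add: algebra_simps)
  also have "\<dots> = f p + (f b + (\<Sum>p\<leftarrow>ps. g p)) - f (\<lambda>_. 0)"
    using Cons lin_natvars_add[OF assms(1), of p "\<lambda>v. b v + (\<Sum>p\<leftarrow>ps. p v)"] by simp
  finally show ?case using Cons.prems by simp
qed simp

text \<open>A finite union of linear sets. Period combinations are written as lists of periods
  instead of coefficients, because such a list will be read as the path of an automaton.\<close>

definition semilinear_on :: "'v set \<Rightarrow> (('v \<Rightarrow> nat) \<Rightarrow> bool) \<Rightarrow> bool" where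
  "semilinear_on V P \<longleftrightarrow> (\<exists>\<B>. finite \<B> \<and> (\<forall>(b, Ps)\<in>\<B>. finite Ps) \<and>
     (\<forall>x. P x \<longleftrightarrow> (\<exists>(b, Ps)\<in>\<B>. \<exists>ps\<in>lists Ps. \<forall>v\<in>V. x v = b v + (\<Sum>p\<leftarrow>ps. p v))))"

text \<open>With the hidden naturals of each atom adjoined as new variables, the atoms become a
  system of affine equations over the naturals. Its solutions \<open>U\<close> are the sums of a
  minimal solution and a solution of the homogeneous system \<open>H\<close>; Dickson's lemma gives
  finitely many of the former and a finite basis of the latter. Projecting to \<open>V\<close> keeps
  this form.\<close>

lemma atoms_semilinear:
  assumes "finite V" "as \<in> lists (lin (natvars V) \<times> UNIV)"
  shows "semilinear_on V (\<lambda>x. \<forall>a\<in>set as. atom_sem a x)"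
proof -
  define L where "L = length as"
  \<comment> \<open>\<open>Inr (i, True)\<close> and \<open>Inr (i, False)\<close> are the two
    hidden naturals of the atom with number \<open>i\<close>.\<close>
  define W :: "('a + nat \<times> bool) set" where "W = Inl ` V \<union> Inr ` ({..<L} \<times> UNIV)"
  define f where "f i = fst (as ! i)" for i
  define g where "g i z = fst (snd (as ! i)) * int (z (Inr (i, True))) - snd (snd (as ! i)) * int (z (Inr (i, False)))"
    for i and z :: "'a + nat \<times> bool \<Rightarrow> nat"
  have finW: "finite W" using assms(1) by (simp add: W_def)
  have lin: "f i \<in> lin (natvars V)" if "i < L" for i
  proof -
    have "as ! i \<in> set as" using that by (simp add: L_def)
    then show ?thesis using assms(2) by (auto simp: f_def)
  qed
  \<comment> \<open>Vanishing outside \<open>W\<close> turns a comparison on \<open>W\<close>, as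
    Dickson's lemma delivers it, into a comparison of whole functions.\<close>
  define U where "U = {z. (\<forall>w. w \<notin> W \<longrightarrow> z w = 0) \<and> (\<forall>i<L. g i z = f i (\<lambda>v. z (Inl v)))}"
  define H where "H = {z. (\<forall>w. w \<notin> W \<longrightarrow> z w = 0) \<and> (\<forall>i<L. g i z = f i (\<lambda>v. z (Inl v)) - f i (\<lambda>_. 0))}"
  have g_diff: "g i (\<lambda>w. x w - y w) = g i x - g i y" if "\<forall>w. y w \<le> x w" for i x y
    using that by (simp add: g_def of_nat_diff algebra_simps)
  have "\<exists>P\<subseteq>H. finite P \<and> (\<forall>x\<in>H. \<exists>ps\<in>lists P. \<forall>v. x v = (\<Sum>p\<leftarrow>ps. p v))"
    by (rule subtractive_finite_basis[OF finW])
      (auto simp: H_def g_diff lin_natvars_diff[OF lin])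
  then obtain P where P: "P \<subseteq> H" "finite P" "\<forall>x\<in>H. \<exists>ps\<in>lists P. \<forall>v. x v = (\<Sum>p\<leftarrow>ps. p v)"
    by blast
  obtain B where B: "B \<subseteq> U" "finite B" "\<forall>x\<in>U. \<exists>b\<in>B. \<forall>w\<in>W. b w \<le> x w"
    using dickson[OF finW, of U] by blast
  have U: "z \<in> U \<longleftrightarrow> (\<exists>b\<in>B. \<exists>ps\<in>lists P. \<forall>w. z w = b w + (\<Sum>p\<leftarrow>ps. p w))" for z
  proof
    assume z: "z \<in> U"
    then obtain b where b: "b \<in> B" "\<forall>w\<in>W. b w \<le> z w" using B by blast
    have bU: "b \<in> U" using b B by blast
    have le: "\<forall>w. b w \<le> z w" using b(2) bU by (auto simp: U_def)
    have "(\<lambda>w. z w - b w) \<in> H"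
      using z bU g_diff[OF le] lin_natvars_diff[OF lin, of _ "\<lambda>v. b (Inl v)" "\<lambda>v. z (Inl v)"] le
      by (simp add: U_def H_def)
    from bspec[OF P(3) this] obtain ps where ps: "ps \<in> lists P" "\<forall>w. z w - b w = (\<Sum>p\<leftarrow>ps. p w)"
      by (rule bexE)
    have "z w = b w + (\<Sum>p\<leftarrow>ps. p w)" for w
      using le[rule_format, of w] ps(2)[rule_format, of w] by simp
    then show "\<exists>b\<in>B. \<exists>ps\<in>lists P. \<forall>w. z w = b w + (\<Sum>p\<leftarrow>ps. p w)"
      using b(1) ps(1) by (intro bexI[of _ b] bexI[of _ ps] allI)
  next
    assume "\<exists>b\<in>B. \<exists>ps\<in>lists P. \<forall>w. z w = b w + (\<Sum>p\<leftarrow>ps. p w)"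
    then obtain b ps where b: "b \<in> B" and ps: "ps \<in> lists P"
      and z: "z = (\<lambda>w. b w + (\<Sum>p\<leftarrow>ps. p w))" by blast
    have bU: "b \<in> U" and psH: "set ps \<subseteq> H" using b B ps P by auto
    have "z w = 0" if "w \<notin> W" for w
      using that bU psH by (auto simp: z U_def H_def)
    moreover have "f i (\<lambda>v. z (Inl v)) = g i z" if "i < L" for i
    proof -
      have "f i (\<lambda>v. b (Inl v) + (\<Sum>q\<leftarrow>map (\<lambda>p v. p (Inl v)) ps. q v))
          = f i (\<lambda>v. b (Inl v)) + (\<Sum>q\<leftarrow>map (\<lambda>p v. p (Inl v)) ps. f i q - f i (\<lambda>_. 0))"
        by (rule lin_natvars_sum_list[OF lin[OF that]]) simp
      also have "(\<Sum>q\<leftarrow>map (\<lambda>p v. p (Inl v)) ps. f i q - f i (\<lambda>_. 0)) = (\<Sum>p\<leftarrow>ps. g i p)"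
        unfolding map_map comp_def using psH that
        by (intro arg_cong[where f = sum_list] map_cong) (auto simp: H_def)
      also have "g i z = g i b + (\<Sum>p\<leftarrow>ps. g i p)"
        unfolding z by (induction ps) (auto simp: g_def algebra_simps)
      ultimately show ?thesis using bU that by (simp add: U_def z comp_def)
    qed
    ultimately show "z \<in> U" by (simp add: U_def)
  qed
  have "(\<forall>a\<in>set as. atom_sem a x) \<longleftrightarrow> (\<exists>z\<in>U. \<forall>v\<in>V. x v = z (Inl v))" for x
  proof
    assume "\<forall>a\<in>set as. atom_sem a x"
    then have "\<forall>i<L. atom_sem (as ! i) x" by (simp add: L_def)
    then have "\<forall>i<L. \<exists>y y'. f i x = fst (snd (as ! i)) * int y - snd (snd (as ! i)) * int y'"
      using atom_sem.simps by (metis f_def prod.collapse)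
    then obtain y y' where y: "\<And>i. i < L \<Longrightarrow> f i x = fst (snd (as ! i)) * int (y i) - snd (snd (as ! i)) * int (y' i)"
      by metis
    define z where "z w = (if w \<in> W then (case w of Inl v \<Rightarrow> x v | Inr (i, b) \<Rightarrow> if b then y i else y' i) else 0)" for w
    have "f i (\<lambda>v. z (Inl v)) = f i x" if "i < L" for i
      by (rule lin_cong[OF lin[OF that]]) (auto simp: natvars_def z_def W_def)
    moreover have "g i z = f i x" if "i < L" for i
      using y[OF that] that by (simp add: g_def z_def W_def image_iff)
    ultimately have "z \<in> U" by (simp add: U_def z_def)
    moreover have "\<forall>v\<in>V. x v = z (Inl v)" by (simp add: z_def W_def)
    ultimately show "\<exists>z\<in>U. \<forall>v\<in>V. x v = z (Inl v)" by blast
  next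
    assume "\<exists>z\<in>U. \<forall>v\<in>V. x v = z (Inl v)"
    then obtain z where z: "z \<in> U" "\<forall>v\<in>V. x v = z (Inl v)" by blast
    show "\<forall>a\<in>set as. atom_sem a x"
    proof
      fix a assume "a \<in> set as"
      then obtain i where i: "i < L" "a = as ! i" by (metis in_set_conv_nth L_def)
      have "f i x = f i (\<lambda>v. z (Inl v))"
        by (rule lin_cong[OF lin[OF i(1)]]) (auto simp: natvars_def z(2))
      then have "f i x = g i z" using z(1) i(1) by (simp add: U_def)
      then have "\<exists>y y'. fst (as ! i) x = fst (snd (as ! i)) * int y - snd (snd (as ! i)) * int y'"
        unfolding f_def g_def by (intro exI)
      then show "atom_sem a x" unfolding i(2)
        by (cases "as ! i") (simp add: atom_sem.simps)
    qed
  qed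
  moreover have "(\<exists>z\<in>U. \<forall>v\<in>V. x v = z (Inl v)) \<longleftrightarrow>
      (\<exists>(b, Ps)\<in>(\<lambda>b. (\<lambda>v. b (Inl v), (\<lambda>p v. p (Inl v)) ` P)) ` B.
        \<exists>ps\<in>lists Ps. \<forall>v\<in>V. x v = b v + (\<Sum>p\<leftarrow>ps. p v))" for x
  proof
    assume "\<exists>z\<in>U. \<forall>v\<in>V. x v = z (Inl v)"
    then obtain b ps where "b \<in> B" "ps \<in> lists P" "\<forall>v\<in>V. x v = b (Inl v) + (\<Sum>p\<leftarrow>ps. p (Inl v))"
      by (metis U)
    then show "\<exists>(b, Ps)\<in>(\<lambda>b. (\<lambda>v. b (Inl v), (\<lambda>p v. p (Inl v)) ` P)) ` B.
        \<exists>ps\<in>lists Ps. \<forall>v\<in>V. x v = b v + (\<Sum>p\<leftarrow>ps. p v)"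
      by (auto intro!: bexI[of _ b] bexI[of _ "map (\<lambda>p v. p (Inl v)) ps"] simp: comp_def)
  next
    assume "\<exists>(b, Ps)\<in>(\<lambda>b. (\<lambda>v. b (Inl v), (\<lambda>p v. p (Inl v)) ` P)) ` B.
        \<exists>ps\<in>lists Ps. \<forall>v\<in>V. x v = b v + (\<Sum>p\<leftarrow>ps. p v)"
    then obtain b qs where b: "b \<in> B" and qs: "qs \<in> lists ((\<lambda>p v. p (Inl v)) ` P)"
      "\<forall>v\<in>V. x v = b (Inl v) + (\<Sum>p\<leftarrow>qs. p v)" by auto
    obtain ps where ps: "ps \<in> lists P" "qs = map (\<lambda>p v. p (Inl v)) ps"
      using qs(1) unfolding lists_image by auto
    show "\<exists>z\<in>U. \<forall>v\<in>V. x v = z (Inl v)"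
      using b ps qs(2) by (intro bexI[of _ "\<lambda>w. b w + (\<Sum>p\<leftarrow>ps. p w)"]) (auto simp: U comp_def)
  qed
  ultimately show ?thesis unfolding semilinear_on_def using B(2) P(2)
    by (intro exI[of _ "(\<lambda>b. (\<lambda>v. b (Inl v), (\<lambda>p v. p (Inl v)) ` P)) ` B"]) auto
qed

lemma semilinear_bex:
  assumes "finite I" "\<And>i. i \<in> I \<Longrightarrow> semilinear_on V (P i)"
  shows "semilinear_on V (\<lambda>x. \<exists>i\<in>I. P i x)"
proof -
  let ?rep = "\<lambda>P \<B>. finite \<B> \<and> (\<forall>(b, Ps)\<in>\<B>. finite Ps) \<and>
     (\<forall>x. P x \<longleftrightarrow> (\<exists>(b, Ps)\<in>\<B>. \<exists>ps\<in>lists Ps. \<forall>v\<in>V. x v = b v + (\<Sum>p\<leftarrow>ps. p v)))"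
  have "\<forall>i\<in>I. \<exists>\<B>. ?rep (P i) \<B>"
    using assms(2) unfolding semilinear_on_def by (rule ballI)
  from bchoice[OF this] obtain \<B> where rep: "\<forall>i\<in>I. ?rep (P i) (\<B> i)" by (rule exE)
  have \<B>: "finite (\<B> i)" "\<forall>(b, Ps)\<in>\<B> i. finite Ps"
     "P i x \<longleftrightarrow> (\<exists>(b, Ps)\<in>\<B> i. \<exists>ps\<in>lists Ps. \<forall>v\<in>V. x v = b v + (\<Sum>p\<leftarrow>ps. p v))"
    if "i \<in> I" for i x
  proof -
    note r = bspec[OF rep that]
    show "finite (\<B> i)" by (rule conjunct1[OF r])
    show "\<forall>(b, Ps)\<in>\<B> i. finite Ps" by (rule conjunct1[OF conjunct2[OF r]])
    show "P i x \<longleftrightarrow> (\<exists>(b, Ps)\<in>\<B> i. \<exists>ps\<in>lists Ps. \<forall>v\<in>V. x v = b v + (\<Sum>p\<leftarrow>ps. p v))"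
      by (rule spec[OF conjunct2[OF conjunct2[OF r]]])
  qed
  show ?thesis unfolding semilinear_on_def
  proof (intro exI[of _ "\<Union>i\<in>I. \<B> i"] conjI allI)
    show "finite (\<Union>i\<in>I. \<B> i)" using assms(1) \<B>(1) by blast
    show "\<forall>(b, Ps)\<in>\<Union>i\<in>I. \<B> i. finite Ps" using \<B>(2) by blast
    show "(\<exists>i\<in>I. P i x) \<longleftrightarrow>
      (\<exists>(b, Ps)\<in>\<Union>i\<in>I. \<B> i. \<exists>ps\<in>lists Ps. \<forall>v\<in>V. x v = b v + (\<Sum>p\<leftarrow>ps. p v))" for x
    proof -
      have "(\<exists>i\<in>I. P i x) \<longleftrightarrow> (\<exists>i\<in>I. \<exists>(b, Ps)\<in>\<B> i. \<exists>ps\<in>lists Ps. \<forall>v\<in>V. x v = b v + (\<Sum>p\<leftarrow>ps. p v))"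
        by (intro bex_cong \<B>(3)) auto
      then show ?thesis by simp
    qed
  qed
qed

theorem presb_semilinear:
  assumes "finite V" "presb (natvars V) P"
  shows "semilinear_on V P"
proof -
  obtain \<A> where \<A>: "finite \<A>" "\<A> \<subseteq> lists (lin (natvars V) \<times> UNIV)"
    "\<forall>s. P s \<longleftrightarrow> (\<exists>as\<in>\<A>. \<forall>a\<in>set as. atom_sem a s)"
    using presb_dnf[OF assms(2)] unfolding dnf_def by blast
  have "semilinear_on V (\<lambda>s. \<exists>as\<in>\<A>. \<forall>a\<in>set as. atom_sem a s)"
    using \<A>(1,2) assms(1) by (intro semilinear_bex atoms_semilinear) auto
  then show ?thesis using \<A>(3) by presburger
qed

section \<open>Templates and EDT0L languages\<close>

definition word_power :: "nat \<Rightarrow> 'x list \<Rightarrow> 'x list" where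
  "word_power n w = concat (replicate n w)"

lemma word_power_0 [simp]: "word_power 0 w = []"
  and word_power_Suc [simp]: "word_power (Suc n) w = w @ word_power n w"
  by (simp_all add: word_power_def)

lemma word_power_add: "word_power (m + n) w = word_power m w @ word_power n w"
  by (induction m) simp_all

lemma set_word_power: "set (word_power n w) \<subseteq> set w"
  by (induction n) auto

text \<open>All occurrences of a variable share one exponent, so powers that are to vary
  independently need distinct variables even if the loop is the same word.\<close>

definition expand :: "('v \<Rightarrow> 'x list) \<Rightarrow> ('v \<Rightarrow> nat) \<Rightarrow> ('x + 'v) list \<Rightarrow> 'x list" where
  "expand c x tpl = concat (map (case_sum (\<lambda>a. [a]) (\<lambda>v. word_power (x v) (c v))) tpl)"

lemma expand_Nil [simp]: "expand c x [] = []"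
  and expand_Inl [simp]: "expand c x (Inl a # tpl) = a # expand c x tpl"
  and expand_Inr [simp]: "expand c x (Inr v # tpl) = word_power (x v) (c v) @ expand c x tpl"
  and expand_append [simp]: "expand c x (tpl @ tpl') = expand c x tpl @ expand c x tpl'"
  by (simp_all add: expand_def)

lemma expand_cong:
  "(\<And>v. Inr v \<in> set tpl \<Longrightarrow> x v = y v) \<Longrightarrow> expand c x tpl = expand c y tpl"
  unfolding expand_def by (intro arg_cong[where f = concat] map_cong) (auto split: sum.splits)

definition hom_ext :: "('c \<Rightarrow> 'c list) \<Rightarrow> 'c list \<Rightarrow> 'c list" where
  "hom_ext h w = concat (map h w)"

lemma hom_ext_append [simp]: "hom_ext h (u @ v) = hom_ext h u @ hom_ext h v"
  and hom_ext_Nil [simp]: "hom_ext h [] = []"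
  and hom_ext_Cons [simp]: "hom_ext h (a # w) = h a @ hom_ext h w"
  by (simp_all add: hom_ext_def)

lemma free_monoid_endomorphism_hom_ext:
  assumes "\<And>a. a \<in> C \<Longrightarrow> h a \<in> lists C"
  shows "free_monoid_endomorphism C (hom_ext h)"
proof -
  have "hom_ext h w \<in> lists C" if "w \<in> lists C" for w
    using that assms by (induction w) auto
  then show ?thesis unfolding free_monoid_endomorphism_def by auto
qed

lemma hom_ext_id: "(\<And>a. a \<in> set w \<Longrightarrow> h a = [a]) \<Longrightarrow> hom_ext h w = w"
  by (induction w) auto

lemma nfa_run_Cons_iff: "nfa_run D p (x # w) s \<longleftrightarrow> (\<exists>q. (p, x, q) \<in> D \<and> nfa_run D q w s)"
  by (auto intro: nfa_run.intros elim: nfa_run.cases)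

lemma nfa_run_Nil_iff: "nfa_run D p [] s \<longleftrightarrow> s = p"
  by (auto intro: nfa_run.intros elim: nfa_run.cases)

text \<open>The rewriting starts from a single auxiliary letter \<open>Inr 0\<close>. An initial endomorphism turns it
  into one of the templates (variables encoded as auxiliary letters), each period \<open>p\<close>
  multiplies every variable \<open>v\<close> on the left by \<open>c v ^ p v\<close>, and the last endomorphism substitutes
  \<open>c v ^ b v\<close>. Compositions are applied from the right, so a run reads the last
  endomorphism first.\<close>

lemma EDT0L_semilinear_templates:
  fixes I :: "(('x + 'v) list \<times> ('v \<Rightarrow> nat) \<times> ('v \<Rightarrow> nat) set) set"
  assumes fin: "finite \<Omega>" "finite V" "finite I"
    and I: "\<And>tpl b Ps. (tpl, b, Ps) \<in> I \<Longrightarrow> finite Ps \<and> tpl \<in> lists (Inl ` \<Omega> \<union> Inr ` V)"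
    and c: "\<And>v. v \<in> V \<Longrightarrow> c v \<in> lists \<Omega>"
  shows "EDT0L \<Omega> {expand c (\<lambda>v. b v + (\<Sum>p\<leftarrow>ps. p v)) tpl | tpl b Ps ps. (tpl, b, Ps) \<in> I \<and> ps \<in> lists Ps}"
    (is "EDT0L \<Omega> ?L")
proof -
  obtain e :: "'v \<Rightarrow> nat" where e: "inj_on e V"
    using finite_imp_inj_to_nat_seg[OF fin(2)] by blast
  \<comment> \<open>The successor keeps the auxiliary letter \<open>Inr 0\<close> free for the
    start.\<close>
  define var :: "'v \<Rightarrow> 'x + nat" where "var v = Inr (Suc (e v))" for v
  define C :: "('x + nat) set" where "C = Inl ` \<Omega> \<union> insert (Inr 0) (var ` V)"
  define dec where "dec k = inv_into V e k" for k
  have dec: "dec (e v) = v" if "v \<in> V" for v using that e by (simp add: dec_def)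
  define tr where "tr tpl = map (case_sum Inl var) tpl" for tpl :: "('x + 'v) list"
  define st where "st tpl = hom_ext (\<lambda>a. if a = Inr 0 then tr tpl else [a])" for tpl
  \<comment> \<open>The flag \<open>t\<close> decides whether the variable survives, as it must
    while periods are still to be added, or is erased by the final substitution.\<close>
  define sub where "sub t x = hom_ext (\<lambda>a. case a of Inl a \<Rightarrow> [Inl a] | Inr 0 \<Rightarrow> [] | Inr (Suc k) \<Rightarrow>
     map Inl (word_power (x (dec k)) (c (dec k))) @ (if t then [Inr (Suc k)] else []))"
    for t :: bool and x :: "'v \<Rightarrow> nat"
  obtain il where il: "set il = I" using fin(3) finite_list by blast
  define tp where "tp i = fst (il ! i)" for i
  define bs where "bs i = fst (snd (il ! i))" for i
  define Ps where "Ps i = snd (snd (il ! i))" for i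
  define N where "N = length il"
  have Ii: "(tp i, bs i, Ps i) \<in> I" if "i < N" for i
    using that il by (auto simp: tp_def bs_def Ps_def N_def)
  have tp: "tp i \<in> lists (Inl ` \<Omega> \<union> Inr ` V)" and finPs: "finite (Ps i)" if "i < N" for i
    using I[OF Ii[OF that]] by auto
  define \<Phi> where "\<Phi> = (\<Union>i<N. {st (tp i), sub False (bs i)} \<union> sub True ` Ps i)"
  \<comment> \<open>State 0 is initial, 1 is final, and \<open>i + 2\<close> is the state in which
    periods for the entry \<open>i\<close> of the list \<open>il\<close> are collected.\<close>
  define D where "D = (\<Union>i<N. {(0, sub False (bs i), i + 2), (i + 2, st (tp i), 1)}
      \<union> (\<lambda>p. (i + 2, sub True p, i + 2)) ` Ps i)"
  define L where "L = {w. \<exists>p\<in>{0}. \<exists>q\<in>{1}. nfa_run D p w q}"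
  have out1: "nfa_run D 1 w q \<longleftrightarrow> w = [] \<and> q = 1" for w q
    by (cases w) (auto simp: nfa_run_Cons_iff nfa_run_Nil_iff D_def)
  have loop: "nfa_run D (i + 2) w 1 \<longleftrightarrow> (\<exists>ps\<in>lists (Ps i). w = map (sub True) ps @ [st (tp i)])"
    if "i < N" for i w
  proof
    show "nfa_run D (i + 2) w 1 \<Longrightarrow> \<exists>ps\<in>lists (Ps i). w = map (sub True) ps @ [st (tp i)]"
    proof (induction w)
      case Nil
      then show ?case by (simp add: nfa_run_Nil_iff)
    next
      case (Cons f w)
      then obtain q where q: "(i + 2, f, q) \<in> D" "nfa_run D q w 1" by (auto simp: nfa_run_Cons_iff)
      from q(1) consider "f = st (tp i)" "q = 1" | p where "p \<in> Ps i" "f = sub True p" "q = i + 2"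
        by (auto simp: D_def)
      then show ?case
      proof cases
        case 1
        then show ?thesis using q(2) by (auto simp: out1[simplified] intro!: bexI[of _ "[]"])
      next
        case 2
        then obtain ps where "ps \<in> lists (Ps i)" "w = map (sub True) ps @ [st (tp i)]"
          using Cons.IH q(2) by auto
        then show ?thesis using 2 by (intro bexI[of _ "p # ps"]) auto
      qed
    qed
  next
    assume "\<exists>ps\<in>lists (Ps i). w = map (sub True) ps @ [st (tp i)]"
    then obtain ps where ps: "ps \<in> lists (Ps i)" "w = map (sub True) ps @ [st (tp i)]" by blast
    have "(i + 2, st (tp i), 1) \<in> D" using that unfolding D_def by blast
    moreover have "(i + 2, sub True p, i + 2) \<in> D" if "p \<in> Ps i" for p
      using that \<open>i < N\<close> unfolding D_def by blast
    ultimately show "nfa_run D (i + 2) w 1" using ps(1) unfolding ps(2)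
      by (induction ps) (auto simp: nfa_run_Cons_iff nfa_run_Nil_iff)
  qed
  have L: "L = {sub False (bs i) # map (sub True) ps @ [st (tp i)] | i ps. i < N \<and> ps \<in> lists (Ps i)}"
    (is "_ = ?R")
  proof (rule Set.set_eqI)
    fix w
    show "w \<in> L \<longleftrightarrow> w \<in> ?R"
    proof (cases w)
      case Nil
      then show ?thesis by (auto simp: L_def nfa_run_Nil_iff)
    next
      case (Cons f u)
      have "w \<in> L \<longleftrightarrow> (\<exists>i<N. f = sub False (bs i) \<and> nfa_run D (i + 2) u 1)"
        unfolding L_def Cons by (auto simp: nfa_run_Cons_iff) (auto simp: D_def)
      also have "\<dots> \<longleftrightarrow> (\<exists>i ps. i < N \<and> ps \<in> lists (Ps i) \<and> f = sub False (bs i) \<and>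
          u = map (sub True) ps @ [st (tp i)])"
        using loop by blast
      also have "\<dots> \<longleftrightarrow> w \<in> ?R" unfolding Cons by blast
      finally show ?thesis .
    qed
  qed
  have "regular_language \<Phi> L"
    unfolding regular_language_def
  proof (intro exI conjI)
    show "finite \<Phi>" unfolding \<Phi>_def using finPs by auto
    show "finite {..<N + 2}" by simp
    show "D \<subseteq> {..<N + 2} \<times> \<Phi> \<times> {..<N + 2}" unfolding D_def \<Phi>_def by auto
    show "L = {w. \<exists>p\<in>{0}. \<exists>q\<in>{1}. nfa_run D p w q}" by (rule L_def)
  qed auto
  moreover have "finite \<Phi>" unfolding \<Phi>_def using finPs by auto
  moreover have "free_monoid_endomorphism C f" if "f \<in> \<Phi>" for f
  proof -
    have 1: "free_monoid_endomorphism C (st (tp i))" if "i < N" for i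
      unfolding st_def
    proof (rule free_monoid_endomorphism_hom_ext)
      have "tr t \<in> lists C" if "t \<in> lists (Inl ` \<Omega> \<union> Inr ` V)" for t
        using that by (induction t) (auto simp: tr_def C_def)
      then show "(if a = Inr 0 then tr (tp i) else [a]) \<in> lists C" if "a \<in> C" for a
        using that tp[OF \<open>i < N\<close>] by auto
    qed
    have 2: "free_monoid_endomorphism C (sub t x)" for t x
      unfolding sub_def
    proof (rule free_monoid_endomorphism_hom_ext)
      fix a assume "a \<in> C"
      then consider w where "w \<in> \<Omega>" "a = Inl w" | "a = Inr 0" | v where "v \<in> V" "a = var v"
        unfolding C_def by blast
      then show "(case a of Inl a \<Rightarrow> [Inl a] | Inr 0 \<Rightarrow> [] | Inr (Suc k) \<Rightarrow>
         map Inl (word_power (x (dec k)) (c (dec k))) @ (if t then [Inr (Suc k)] else [])) \<in> lists C"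
      proof cases
        case 3
        have "\<forall>y\<in>set (word_power (x v) (c v)). y \<in> \<Omega>" using c[OF 3(1)] set_word_power by fastforce
        then show ?thesis using 3 by (auto simp: var_def dec C_def)
      qed (auto simp: C_def)
    qed
    show ?thesis using that 1 2 unfolding \<Phi>_def by auto
  qed
  ultimately have rat: "rational_endomorphism_set C ((\<lambda>\<phi>s. foldr (\<circ>) \<phi>s id) ` L)"
    unfolding rational_endomorphism_set_def by blast
  \<comment> \<open>Composition adds exponents; this is why a sequence of periods realises their
    sum.\<close>
  have comp: "sub t x (sub True p w) = sub t (\<lambda>v. p v + x v) w" for t x p w
  proof (induction w)
    case (Cons a w)
    have "sub t x (map Inl u) = map Inl u" for u
      unfolding sub_def by (rule hom_ext_id) auto
    then have "sub t x (sub True p [a]) = sub t (\<lambda>v. p v + x v) [a]"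
      by (auto simp: sub_def word_power_add split: sum.split nat.split)
    with Cons show ?case by (simp add: sub_def)
  qed (simp add: sub_def)
  have pump: "sub False b (foldr (\<circ>) (map (sub True) ps) id w) = sub False (\<lambda>v. b v + (\<Sum>p\<leftarrow>ps. p v)) w"
    for b ps w
    by (induction ps arbitrary: b) (simp_all add: comp ac_simps)
  have sub_tr: "sub False x (tr t) = map Inl (expand c x t)" if "t \<in> lists (Inl ` \<Omega> \<union> Inr ` V)" for x t
    using that by (induction t) (auto simp: sub_def tr_def var_def dec)
  have val: "foldr (\<circ>) (sub False (bs i) # map (sub True) ps @ [st (tp i)]) id [Inr 0]
      = map Inl (expand c (\<lambda>v. bs i v + (\<Sum>p\<leftarrow>ps. p v)) (tp i))" if "i < N" for i ps
  proof -
    have snoc: "foldr (\<circ>) (fs @ [f]) id x = foldr (\<circ>) fs id (f x)"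
      for fs and f :: "('x + nat) list \<Rightarrow> ('x + nat) list" and x
      by (induction fs) auto
    have "foldr (\<circ>) (sub False (bs i) # map (sub True) ps @ [st (tp i)]) id [Inr 0]
       = sub False (bs i) (foldr (\<circ>) (map (sub True) ps @ [st (tp i)]) id [Inr 0])"
      by (simp only: foldr.simps comp_apply)
    also have "st (tp i) [Inr 0] = tr (tp i)" by (simp add: st_def)
    then have "foldr (\<circ>) (map (sub True) ps @ [st (tp i)]) id [Inr 0] = foldr (\<circ>) (map (sub True) ps) id (tr (tp i))"
      by (simp only: snoc)
    finally show ?thesis by (simp only: pump sub_tr[OF tp[OF that]])
  qed
  have "{\<phi> [Inr 0] | \<phi>. \<phi> \<in> (\<lambda>\<phi>s. foldr (\<circ>) \<phi>s id) ` L}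
      = {map Inl (expand c (\<lambda>v. bs i v + (\<Sum>p\<leftarrow>ps. p v)) (tp i)) | i ps. i < N \<and> ps \<in> lists (Ps i)}"
    (is "?A = ?B")
  proof (intro equalityI subsetI)
    fix w assume "w \<in> ?A"
    then obtain \<phi>s where \<phi>s: "\<phi>s \<in> L" "w = foldr (\<circ>) \<phi>s id [Inr 0]" by blast
    from \<phi>s(1) obtain i ps where i: "i < N" "ps \<in> lists (Ps i)"
      "\<phi>s = sub False (bs i) # map (sub True) ps @ [st (tp i)]"
      unfolding L by blast
    have "w = map Inl (expand c (\<lambda>v. bs i v + (\<Sum>p\<leftarrow>ps. p v)) (tp i))"
      unfolding \<phi>s(2) i(3) by (rule val[OF i(1)])
    then show "w \<in> ?B" using i(1,2) by blast
  next
    fix w assume "w \<in> ?B"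
    then obtain i ps where i: "i < N" "ps \<in> lists (Ps i)"
      "w = map Inl (expand c (\<lambda>v. bs i v + (\<Sum>p\<leftarrow>ps. p v)) (tp i))" by blast
    then have "sub False (bs i) # map (sub True) ps @ [st (tp i)] \<in> L"
      unfolding L by blast
    moreover have "w = foldr (\<circ>) (sub False (bs i) # map (sub True) ps @ [st (tp i)]) id [Inr 0]"
      unfolding i(3) by (rule val[OF i(1), symmetric])
    ultimately show "w \<in> ?A" by blast
  qed
  also have "\<dots> = map Inl ` ?L"
  proof (intro equalityI subsetI)
    fix w assume "w \<in> {map Inl (expand c (\<lambda>v. bs i v + (\<Sum>p\<leftarrow>ps. p v)) (tp i)) :: ('x + nat) list | i ps.
      i < N \<and> ps \<in> lists (Ps i)}"
    then obtain i ps where "i < N" "ps \<in> lists (Ps i)"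
      "w = map Inl (expand c (\<lambda>v. bs i v + (\<Sum>p\<leftarrow>ps. p v)) (tp i))" by blast
    then show "w \<in> map Inl ` ?L" using Ii[of i] by blast
  next
    fix w :: "('x + nat) list" assume "w \<in> map Inl ` ?L"
    then obtain tpl b Qs ps where 1: "(tpl, b, Qs) \<in> I" "ps \<in> lists Qs"
      "w = map Inl (expand c (\<lambda>v. b v + (\<Sum>p\<leftarrow>ps. p v)) tpl)" by blast
    then obtain i where "i < N" "il ! i = (tpl, b, Qs)" using il by (metis N_def in_set_conv_nth)
    then have "i < N" "tp i = tpl" "bs i = b" "Ps i = Qs" by (auto simp: tp_def bs_def Ps_def)
    then show "w \<in> {map Inl (expand c (\<lambda>v. bs i v + (\<Sum>p\<leftarrow>ps. p v)) (tp i)) | i ps.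
      i < N \<and> ps \<in> lists (Ps i)}" using 1 by blast
  qed
  finally have img: "map Inl ` ?L = {\<phi> [Inr 0] | \<phi>. \<phi> \<in> (\<lambda>\<phi>s. foldr (\<circ>) \<phi>s id) ` L}" by simp
  have "?L \<subseteq> lists \<Omega>"
  proof -
    have "expand c x t \<in> lists \<Omega>" if "t \<in> lists (Inl ` \<Omega> \<union> Inr ` V)" for x t
      using that
    proof (induction t)
      case (Cons a t)
      have "\<forall>y\<in>set (word_power (x v) (c v)). y \<in> \<Omega>" if "v \<in> V" for v
        using c[OF that] set_word_power by fastforce
      with Cons show ?case by auto
    qed simp
    then show ?thesis using I by blast
  qed
  then have "map Inl ` ?L \<subseteq> (map Inl ` lists \<Omega> :: ('x + nat) list set)" by (rule image_mono)
  then have "map Inl ` ?L \<subseteq> (lists (Inl ` \<Omega>) :: ('x + nat) list set)" unfolding lists_image .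
  then have "map Inl ` ?L = {\<phi> [Inr 0] | \<phi>. \<phi> \<in> (\<lambda>\<phi>s. foldr (\<circ>) \<phi>s id) ` L} \<inter> lists (Inl ` \<Omega>)"
    unfolding img[symmetric] by (rule Int_absorb2[symmetric])
  moreover have "finite C" "Inl ` \<Omega> \<subseteq> C" "[Inr 0] \<in> lists C"
    using fin by (auto simp: C_def)
  ultimately show ?thesis unfolding EDT0L_def using fin(1) rat by (intro exI conjI)
qed

text \<open>Each condition is split into its linear sets and the template is repeated for each of
  them. A linear set describes \<open>x\<close> only on \<open>V\<close>, which suffices since all
  variables of the template lie in \<open>V\<close>.\<close>

lemma EDT0L_presb_templates:
  fixes I :: "(('x + 'v) list \<times> (('v \<Rightarrow> nat) \<Rightarrow> bool)) set"
  assumes fin: "finite \<Omega>" "finite V" "finite I"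
    and I: "\<And>tpl P. (tpl, P) \<in> I \<Longrightarrow> tpl \<in> lists (Inl ` \<Omega> \<union> Inr ` V) \<and> presb (natvars V) P"
    and c: "\<And>v. v \<in> V \<Longrightarrow> c v \<in> lists \<Omega>"
  shows "EDT0L \<Omega> {expand c x tpl | tpl P x. (tpl, P) \<in> I \<and> P x}"
proof -
  let ?rep = "\<lambda>P \<B>. finite \<B> \<and> (\<forall>(b, Ps)\<in>\<B>. finite Ps) \<and>
     (\<forall>x. P x \<longleftrightarrow> (\<exists>(b, Ps)\<in>\<B>. \<exists>ps\<in>lists Ps. \<forall>v\<in>V. x v = b v + (\<Sum>p\<leftarrow>ps. p v)))"
  have "\<forall>i\<in>I. \<exists>\<B>. ?rep (snd i) \<B>"
  proof
    fix i assume "i \<in> I"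
    then have "presb (natvars V) (snd i)" using I[of "fst i" "snd i"] by simp
    from presb_semilinear[OF fin(2) this] show "\<exists>\<B>. ?rep (snd i) \<B>"
      unfolding semilinear_on_def .
  qed
  from bchoice[OF this] obtain \<B> where rep: "\<forall>i\<in>I. ?rep (snd i) (\<B> i)" by (rule exE)
  let ?J = "\<Union>i\<in>I. Pair (fst i) ` \<B> i"
  have "EDT0L \<Omega> {expand c (\<lambda>v. b v + (\<Sum>p\<leftarrow>ps. p v)) tpl | tpl b Ps ps. (tpl, b, Ps) \<in> ?J \<and> ps \<in> lists Ps}"
    using fin rep I c by (intro EDT0L_semilinear_templates[where V = V]) fastforce+
  moreover have "{expand c (\<lambda>v. b v + (\<Sum>p\<leftarrow>ps. p v)) tpl | tpl b Ps ps. (tpl, b, Ps) \<in> ?J \<and> ps \<in> lists Ps}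
     = {expand c x tpl | tpl P x. (tpl, P) \<in> I \<and> P x}" (is "?L = ?R")
  proof (intro equalityI subsetI)
    fix w assume "w \<in> ?L"
    then obtain tpl b Ps ps where w: "(tpl, b, Ps) \<in> ?J" "ps \<in> lists Ps"
      "w = expand c (\<lambda>v. b v + (\<Sum>p\<leftarrow>ps. p v)) tpl" by blast
    then obtain P where P: "(tpl, P) \<in> I" "(b, Ps) \<in> \<B> (tpl, P)" by auto
    then have "P (\<lambda>v. b v + (\<Sum>p\<leftarrow>ps. p v))" using bspec[OF rep P(1)] w(2) by auto
    then show "w \<in> ?R" using P(1) w(3) by blast
  next
    fix w assume "w \<in> ?R"
    then obtain tpl P x where x: "(tpl, P) \<in> I" "P x" "w = expand c x tpl" by blast
    have "\<exists>(b, Ps)\<in>\<B> (tpl, P). \<exists>ps\<in>lists Ps. \<forall>v\<in>V. x v = b v + (\<Sum>p\<leftarrow>ps. p v)"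
      using bspec[OF rep x(1)] x(2) by simp
    then obtain b Ps ps where b: "(b, Ps) \<in> \<B> (tpl, P)" "ps \<in> lists Ps" "\<forall>v\<in>V. x v = b v + (\<Sum>p\<leftarrow>ps. p v)"
      by blast
    have "Inr v \<in> set tpl \<Longrightarrow> v \<in> V" for v using I[OF x(1)] by auto
    then have "w = expand c (\<lambda>v. b v + (\<Sum>p\<leftarrow>ps. p v)) tpl"
      unfolding x(3) using b(3) by (intro expand_cong) auto
    moreover have "(tpl, b, Ps) \<in> ?J" using x(1) b(1) by (auto intro!: bexI[of _ "(tpl, P)"])
    ultimately show "w \<in> ?L" using b(2) by blast
  qed
  ultimately show ?thesis by simp
qed

section \<open>Commutative grammars\<close>

text \<open>A rule of a commutative grammar, with terminals already discarded. The label does not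
  influence rewriting; it will hold the contribution of the discarded terminals and keeps rules
  apart that differ only in it.\<close>

type_synonym ('n, 'c) mrule = "'n \<times> 'n multiset \<times> 'c"

abbreviation lhs :: "('n, 'c) mrule \<Rightarrow> 'n" where "lhs r \<equiv> fst r"
abbreviation rhs :: "('n, 'c) mrule \<Rightarrow> 'n multiset" where "rhs r \<equiv> fst (snd r)"

text \<open>Only complete runs, ending with no nonterminal left. The order of the rules is recorded
  because a run will be replayed as a derivation on words.\<close>

inductive mrun :: "('n, 'c) mrule set \<Rightarrow> 'n multiset \<Rightarrow> ('n, 'c) mrule list \<Rightarrow> bool" for R where
  mrun_Nil: "mrun R {#} []"
| mrun_Cons: "r \<in> R \<Longrightarrow> lhs r \<in># \<alpha> \<Longrightarrow> mrun R (\<alpha> - {#lhs r#} + rhs r) rs \<Longrightarrow> mrun R \<alpha> (r # rs)"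

text \<open>With \<open>U\<close> the set of rules that are used, reachability excludes cycles of
  rules that are balanced in themselves but detached from the initial form.\<close>

inductive_set reach :: "('n, 'c) mrule set \<Rightarrow> 'n multiset \<Rightarrow> 'n set" for U \<alpha> where
  reach_init: "X \<in># \<alpha> \<Longrightarrow> X \<in> reach U \<alpha>"
| reach_step: "r \<in> U \<Longrightarrow> lhs r \<in> reach U \<alpha> \<Longrightarrow> X \<in># rhs r \<Longrightarrow> X \<in> reach U \<alpha>"

text \<open>Kirchhoff's law at \<open>Y\<close>: what is present initially or created by rules
  equals what is consumed. Balance at all nonterminals and connectivity characterise the rule counts
  of complete runs, as Euler's theorem does for trails in graphs.\<close>

definition flow :: "('n, 'c) mrule set \<Rightarrow> 'n multiset \<Rightarrow> (('n, 'c) mrule \<Rightarrow> nat) \<Rightarrow> 'n \<Rightarrow> bool" where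
  "flow R \<alpha> k Y \<longleftrightarrow> count \<alpha> Y + (\<Sum>r\<in>R. k r * count (rhs r) Y) = (\<Sum>r\<in>R. if lhs r = Y then k r else 0)"

lemma reach_subset:
  assumes "X \<in> reach U \<alpha>" "\<And>X. X \<in># \<alpha> \<Longrightarrow> X \<in> W"
    and "\<And>r X. r \<in> U \<Longrightarrow> lhs r \<in> W \<Longrightarrow> X \<in># rhs r \<Longrightarrow> X \<in> W"
  shows "X \<in> W"
  using assms(1) by induction (use assms(2,3) in auto)

lemma reach_mono:
  assumes "X \<in> reach U \<alpha>" "U \<subseteq> U'" "\<And>X. X \<in># \<alpha> \<Longrightarrow> X \<in> reach U' \<alpha>'"
  shows "X \<in> reach U' \<alpha>'"
  using assms(1) by (rule reach_subset) (use assms(2,3) in \<open>auto intro: reach_step\<close>)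

lemma flow_cong:
  assumes "\<forall>r\<in>R. k r = k' r"
  shows "flow R \<alpha> k Y \<longleftrightarrow> flow R \<alpha> k' Y"
proof -
  have "(\<Sum>r\<in>R. k r * count (rhs r) Y) = (\<Sum>r\<in>R. k' r * count (rhs r) Y)"
    "(\<Sum>r\<in>R. if lhs r = Y then k r else 0) = (\<Sum>r\<in>R. if lhs r = Y then k' r else 0)"
    by (rule sum.cong; use assms in simp)+
  then show ?thesis unfolding flow_def by simp
qed

lemma flow_step:
  assumes "finite R" "r \<in> R" "lhs r \<in># \<alpha>" "\<And>q. q \<in> R \<Longrightarrow> k q = k' q + (if q = r then 1 else 0)"
  shows "flow R (\<alpha> - {#lhs r#} + rhs r) k' Y \<longleftrightarrow> flow R \<alpha> k Y"
proof -
  have "(\<Sum>q\<in>R. k q * count (rhs q) Y) = (\<Sum>q\<in>R. k' q * count (rhs q) Y + (if q = r then count (rhs r) Y else 0))"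
    by (rule sum.cong) (auto simp: assms(4))
  then have 1: "(\<Sum>q\<in>R. k q * count (rhs q) Y) = (\<Sum>q\<in>R. k' q * count (rhs q) Y) + count (rhs r) Y"
    using assms(1,2) by (simp add: sum.distrib)
  have "(\<Sum>q\<in>R. if lhs q = Y then k q else 0) =
      (\<Sum>q\<in>R. (if lhs q = Y then k' q else 0) + (if q = r then (if lhs r = Y then 1 else 0) else 0))"
    by (rule sum.cong) (auto simp: assms(4))
  then have 2: "(\<Sum>q\<in>R. if lhs q = Y then k q else 0) =
      (\<Sum>q\<in>R. if lhs q = Y then k' q else 0) + (if lhs r = Y then 1 else 0)"
    using assms(1,2) by (simp add: sum.distrib)
  show ?thesis
  proof (cases "lhs r = Y")
    case True
    then have "count \<alpha> Y > 0" using assms(3) by simp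
    then show ?thesis unfolding flow_def 1 2 using True by (auto simp: gr0_conv_Suc)
  next
    case False
    then show ?thesis unfolding flow_def 1 2 by auto
  qed
qed

text \<open>Necessity of balance and connectivity: undoing the first rule preserves both.\<close>

lemma mrun_flow:
  assumes "mrun R \<alpha> rs" "finite R"
  shows "set rs \<subseteq> R \<and> (\<forall>Y. flow R \<alpha> (count_list rs) Y) \<and> (\<forall>r\<in>set rs. lhs r \<in> reach (set rs) \<alpha>)"
  using assms(1)
proof induction
  case mrun_Nil
  show ?case by (simp add: flow_def)
next
  case (mrun_Cons r \<alpha> rs)
  have fl: "flow R \<alpha> (count_list (r # rs)) Y" for Y
    using flow_step[OF assms(2) mrun_Cons(1,2), of "count_list (r # rs)" "count_list rs" Y] mrun_Cons.IH
    by auto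
  have re: "lhs q \<in> reach (set (r # rs)) \<alpha>" if "q \<in> set (r # rs)" for q
  proof (cases "q = r")
    case True
    then show ?thesis using mrun_Cons(2) by (auto intro: reach_init)
  next
    case False
    then have "lhs q \<in> reach (set rs) (\<alpha> - {#lhs r#} + rhs r)" using that mrun_Cons.IH by auto
    then show ?thesis
    proof (rule reach_mono)
      fix X assume "X \<in># \<alpha> - {#lhs r#} + rhs r"
      then have "X \<in># \<alpha> \<or> X \<in># rhs r" by (auto dest: in_diffD)
      then show "X \<in> reach (set (r # rs)) \<alpha>"
        using mrun_Cons(2) by (auto intro: reach_init reach_step[of r])
    qed auto
  qed
  show ?case
    using mrun_Cons.IH mrun_Cons(1) by (intro conjI allI ballI fl re) auto
qed

text \<open>The rule for \<open>Y\<close> is chosen so that \<open>Y\<close> stays reachable as long as further rules for \<open>Y\<close>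
  have to be applied; this keeps the remaining rules connected to the sentential form.\<close>

lemma choose_rule:
  assumes fin: "finite R" and Y: "Y \<in># \<alpha>" and flow: "\<And>Y. flow R \<alpha> k Y"
    and U: "U = {r \<in> R. k r > 0}" and conn: "\<forall>r\<in>U. lhs r \<in> reach U \<alpha>"
  shows "\<exists>r\<in>U. lhs r = Y \<and> ((\<forall>q\<in>R. lhs q = Y \<longrightarrow> k q = (if q = r then 1 else 0)) \<or>
           Y \<in> reach {q \<in> U. lhs q \<noteq> Y} (\<alpha> - {#Y#} + rhs r))"
\<comment> \<open>If exactly one application at \<open>Y\<close> remains, the rule is forced and
  none is left for \<open>Y\<close> afterwards.\<close>
proof (cases "(\<Sum>r\<in>R. if lhs r = Y then k r else 0) = 1")
  case True
  then have "\<exists>r\<in>R. (if lhs r = Y then k r else 0) = 1 \<and>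
      (\<forall>q\<in>R. r \<noteq> q \<longrightarrow> (if lhs q = Y then k q else 0) = 0)"
    unfolding sum_eq_1_iff[OF fin] .
  then obtain r where r: "r \<in> R" "(if lhs r = Y then k r else 0) = 1"
      "\<forall>q\<in>R. r \<noteq> q \<longrightarrow> (if lhs q = Y then k q else 0) = 0"
    by (elim bexE conjE)
  then have Y: "lhs r = Y" and "k r = 1" by (simp_all split: if_split_asm)
  have "k q = (if q = r then 1 else 0)" if "q \<in> R" "lhs q = Y" for q
    using r(3)[rule_format, OF that(1)] that(2) \<open>k r = 1\<close> by simp
  moreover have "r \<in> U" using r(1) U \<open>k r = 1\<close> by simp
  ultimately show ?thesis using Y by blast
next
  case False
  have ge1: "count \<alpha> Y \<ge> 1" using Y by auto
  then have "(\<Sum>r\<in>R. if lhs r = Y then k r else 0) \<noteq> 0" using flow[of Y] unfolding flow_def by linarith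
  then obtain r0 where "r0 \<in> R" "(if lhs r0 = Y then k r0 else 0) \<noteq> 0" by (rule sum.not_neutral_contains_not_neutral)
  then have r0: "r0 \<in> U" "lhs r0 = Y" using U by (auto split: if_splits)
  let ?U = "{q \<in> U. lhs q \<noteq> Y}"
  show ?thesis
  \<comment> \<open>If the rest of the form leads back to \<open>Y\<close> without using rules for
    \<open>Y\<close>, any remaining rule for \<open>Y\<close> is safe.\<close>
  proof (cases "Y \<in> reach ?U (\<alpha> - {#Y#})")
    case True
    then have "Y \<in> reach ?U (\<alpha> - {#Y#} + rhs r0)" by (rule reach_mono) (auto intro: reach_init)
    then show ?thesis using r0 by blast
  next
    case notY: False
    have "Y \<notin># \<alpha> - {#Y#}" using notY reach_init[of Y "\<alpha> - {#Y#}" ?U] by blast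
    then have "count \<alpha> Y - 1 = 0" unfolding not_in_iff by simp
    then have c1: "count \<alpha> Y = 1" using ge1 by linarith
    \<comment> \<open>\<open>Y\<close> is present once but consumed more than once, so by balance
      some used rule \<open>q\<close> produces it.\<close>
    have "(\<Sum>r\<in>R. k r * count (rhs r) Y) \<noteq> 0"
      using flow[of Y] False c1 unfolding flow_def by linarith
    then obtain q where "q \<in> R" "k q * count (rhs q) Y \<noteq> 0" by (rule sum.not_neutral_contains_not_neutral)
    then have q: "q \<in> U" "Y \<in># rhs q" using U by (auto simp: not_in_iff intro: ccontr)
    show ?thesis
    proof (rule ccontr)
      assume neg: "\<not> ?thesis"
      have nr: "Y \<notin> reach ?U (rhs r)" if "r \<in> U" "lhs r = Y" for r
      proof
        assume "Y \<in> reach ?U (rhs r)"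
        then have "Y \<in> reach ?U (\<alpha> - {#Y#} + rhs r)" by (rule reach_mono) (auto intro: reach_init)
        then show False using neg that by blast
      qed
      \<comment> \<open>\<open>?W\<close> is closed under the used rules and contains the initial
        form, hence contains the left side of \<open>q\<close>. Wherever in \<open>?W\<close> that
        symbol comes from, \<open>q\<close> leads from there to \<open>Y\<close> and contradicts one
        of the assumptions.\<close>
      let ?W = "insert Y (reach ?U (\<alpha> - {#Y#}) \<union> (\<Union>r\<in>{r \<in> U. lhs r = Y}. reach ?U (rhs r)))"
      have "lhs q \<in> reach U \<alpha>" using conn q by blast
      then have "lhs q \<in> ?W"
      proof (rule reach_subset)
        fix X assume "X \<in># \<alpha>"
        then have "X = Y \<or> X \<in># \<alpha> - {#Y#}" by (cases "X = Y") (simp_all flip: count_greater_zero_iff)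
        then show "X \<in> ?W" by (auto intro: reach_init)
      next
        fix r X assume r: "r \<in> U" "lhs r \<in> ?W" "X \<in># rhs r"
        show "X \<in> ?W"
        proof (cases "lhs r = Y")
          case True
          have "X \<in> reach ?U (rhs r)" using r(3) by (rule reach_init)
          then show ?thesis using r(1) True by blast
        next
          case False
          then have "r \<in> ?U" using r by auto
          then show ?thesis using r False by (auto intro: reach_step[of r])
        qed
      qed
      moreover have "lhs q \<noteq> Y" using nr[OF q(1)] reach_init[OF q(2)] by blast
      ultimately consider "lhs q \<in> reach ?U (\<alpha> - {#Y#})" | r where "r \<in> U" "lhs r = Y" "lhs q \<in> reach ?U (rhs r)"
        by blast
      then show False
      proof cases
        case 1
        then have "Y \<in> reach ?U (\<alpha> - {#Y#})"
          using reach_step[of q ?U "\<alpha> - {#Y#}" Y] q \<open>lhs q \<noteq> Y\<close> by simp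
        then show False using notY by blast
      next
        case 2
        then have "Y \<in> reach ?U (rhs r)"
          using reach_step[of q ?U "rhs r" Y] q \<open>lhs q \<noteq> Y\<close> by simp
        then show False using nr 2 by blast
      qed
    qed
  qed
qed

text \<open>Sufficiency, by induction on the number of rule applications left. Balance survives any
  step; only connectivity depends on which rule is applied, and \<open>choose_rule\<close> takes
  care of it.\<close>

lemma flow_mrun:
  assumes fin: "finite R"
  shows "\<forall>Y. flow R \<alpha> k Y \<Longrightarrow> \<forall>r\<in>R. k r > 0 \<longrightarrow> lhs r \<in> reach {r \<in> R. k r > 0} \<alpha> \<Longrightarrow>
    \<exists>rs. mrun R \<alpha> rs \<and> (\<forall>r\<in>R. count_list rs r = k r)"
proof (induction "\<Sum>r\<in>R. k r" arbitrary: \<alpha> k)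
  case 0
  then have k0: "\<forall>r\<in>R. k r = 0" using fin by simp
  then have "count \<alpha> Y = 0" for Y using 0 unfolding flow_def by (simp add: sum.neutral)
  then have "\<alpha> = {#}" by (simp add: multiset_eq_iff)
  then show ?case using k0 by (intro exI[of _ "[]"]) (auto intro: mrun_Nil)
next
  case (Suc n)
  define U where "U = {r \<in> R. k r > 0}"
  have "\<exists>r\<in>R. k r > 0" using Suc.hyps(2) by (metis gr0I nat.simps(3) sum.neutral)
  then obtain r1 where r1: "r1 \<in> R" "k r1 > 0" by (rule bexE)
  have "lhs r1 \<in> reach U \<alpha>" using Suc.prems(2) r1 unfolding U_def by blast
  then have "\<alpha> \<noteq> {#}" by induction auto
  then obtain Y where Y: "Y \<in># \<alpha>" by blast
  have flow: "flow R \<alpha> k Y" for Y using Suc.prems(1) by blast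
  have conn: "\<forall>r\<in>U. lhs r \<in> reach U \<alpha>" using Suc.prems(2) unfolding U_def by blast
  obtain r where r: "r \<in> U" "lhs r = Y" and alt: "(\<forall>q\<in>R. lhs q = Y \<longrightarrow> k q = (if q = r then 1 else 0)) \<or>
           Y \<in> reach {q \<in> U. lhs q \<noteq> Y} (\<alpha> - {#Y#} + rhs r)"
    using choose_rule[OF fin Y flow U_def conn] by blast
  define k' where "k' = k(r := k r - 1)"
  define \<alpha>' where "\<alpha>' = \<alpha> - {#lhs r#} + rhs r"
  define U' where "U' = {r \<in> R. k' r > 0}"
  have k: "k q = k' q + (if q = r then 1 else 0)" for q
    using r(1) by (auto simp: k'_def U_def)
  have rR: "r \<in> R" using r(1) by (simp add: U_def)
  have "(\<Sum>q\<in>R. k q) = (\<Sum>q\<in>R. k' q) + 1"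
    unfolding k sum.distrib using fin rR by simp
  then have n: "n = (\<Sum>q\<in>R. k' q)" using Suc.hyps(2) by simp
  have flow': "\<forall>Y. flow R \<alpha>' k' Y"
    unfolding \<alpha>'_def using flow_step[OF fin rR _ k] Y r(2) flow by blast
  have UU: "q \<in> U' \<or> q = r" if "q \<in> U" for q
    using that by (auto simp: U_def U'_def k'_def)
  \<comment> \<open>Both outcomes of \<open>choose_rule\<close> serve: either no rule for
    \<open>Y\<close> is left in \<open>U'\<close>, or \<open>Y\<close> is reached by rules whose
    left side is not \<open>Y\<close>, and these are all still in \<open>U'\<close> because
    \<open>r\<close> is a rule for \<open>Y\<close>.\<close>
  have YU': "Y \<in> reach U' \<alpha>'" if q: "q \<in> U'" "lhs q = Y" for q
    using alt
  proof
    assume "\<forall>q\<in>R. lhs q = Y \<longrightarrow> k q = (if q = r then 1 else 0)"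
    then have "k q = (if q = r then 1 else 0)" using q by (simp add: U'_def)
    then have "k' q = 0" by (simp add: k'_def split: if_splits)
    then show ?thesis using q by (simp add: U'_def)
  next
    assume "Y \<in> reach {q \<in> U. lhs q \<noteq> Y} (\<alpha> - {#Y#} + rhs r)"
    then show ?thesis
    proof (rule reach_mono)
      show "{q \<in> U. lhs q \<noteq> Y} \<subseteq> U'" using UU r(2) by auto
    qed (simp add: \<alpha>'_def r(2) reach_init)
  qed
  have conn': "lhs q \<in> reach U' \<alpha>'" if "q \<in> U'" for q
  proof -
    have "q \<in> U" using that k by (auto simp: U_def U'_def)
    then have "lhs q \<in> reach U \<alpha>" using conn by blast
    then have "lhs q \<in> insert Y (reach U' \<alpha>')"
    proof (rule reach_subset)
      fix X assume "X \<in># \<alpha>"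
      then have "X = Y \<or> X \<in># \<alpha> - {#Y#}" by (cases "X = Y") (simp_all flip: count_greater_zero_iff)
      then show "X \<in> insert Y (reach U' \<alpha>')" by (auto intro: reach_init simp: \<alpha>'_def r(2))
    next
      fix p X assume p: "p \<in> U" "lhs p \<in> insert Y (reach U' \<alpha>')" "X \<in># rhs p"
      show "X \<in> insert Y (reach U' \<alpha>')"
      proof (cases "p \<in> U'")
        case True
        then have "lhs p \<in> reach U' \<alpha>'" using p(2) YU' by blast
        then show ?thesis using reach_step[OF True] p(3) by blast
      next
        case False
        then have "p = r" using UU p(1) by blast
        then show ?thesis using p(3) by (auto simp: \<alpha>'_def intro: reach_init)
      qed
    qed
    then show ?thesis using YU' that by blast
  qed
  then have "\<forall>q\<in>R. k' q > 0 \<longrightarrow> lhs q \<in> reach {r \<in> R. k' r > 0} \<alpha>'" by (simp add: U'_def)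
  from Suc.hyps(1)[OF n flow' this]
  obtain rs where rs: "mrun R \<alpha>' rs" "\<forall>r\<in>R. count_list rs r = k' r" by blast
  have "mrun R \<alpha> (r # rs)" using mrun_Cons[of r R \<alpha> rs] rR Y r(2) rs(1) by (simp add: \<alpha>'_def)
  moreover have "\<forall>q\<in>R. count_list (r # rs) q = k q" using rs(2) k by auto
  ultimately show ?case by blast
qed

text \<open>Parikh's theorem on the level of rule counts. Balance is linear in \<open>k\<close>, and
  connectivity depends only on the support of \<open>k\<close>, so it is a finite disjunction over
  the connected sets \<open>U\<close> of rules.\<close>

lemma mrun_presb:
  fixes R :: "('n, 'c) mrule set"
  assumes fin: "finite R"
  shows "presb (natvars R) (\<lambda>k. \<exists>rs. mrun R \<alpha> rs \<and> (\<forall>r\<in>R. count_list rs r = k r))"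
proof -
  \<comment> \<open>Symbols that do not occur anywhere are balanced trivially, so finitely many
    equations suffice.\<close>
  define N where "N = set_mset \<alpha> \<union> lhs ` R \<union> (\<Union>r\<in>R. set_mset (rhs r))"
  have finN: "finite N" using fin by (simp add: N_def)
  define \<U> where "\<U> = {U. U \<subseteq> R \<and> (\<forall>r\<in>U. lhs r \<in> reach U \<alpha>)}"
  have fU: "finite \<U>" using fin by (auto simp: \<U>_def)
  have flowN: "(\<forall>Y. flow R \<alpha> k Y) \<longleftrightarrow> (\<forall>Y\<in>N. flow R \<alpha> k Y)" for k
  proof -
    have "flow R \<alpha> k Y" if "Y \<notin> N" for Y
    proof -
      have "count \<alpha> Y = 0" "\<forall>r\<in>R. count (rhs r) Y = 0" "\<forall>r\<in>R. lhs r \<noteq> Y"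
        using that by (auto simp: N_def not_in_iff)
      then show ?thesis by (simp add: flow_def)
    qed
    then show ?thesis by blast
  qed
  have "(\<exists>rs. mrun R \<alpha> rs \<and> (\<forall>r\<in>R. count_list rs r = k r)) \<longleftrightarrow>
      (\<forall>Y\<in>N. flow R \<alpha> k Y) \<and> (\<exists>U\<in>\<U>. \<forall>r\<in>R. (0 < int (k r)) = (r \<in> U))" (is "?A k \<longleftrightarrow> ?B k") for k
  proof
    assume "?A k"
    then obtain rs where rs: "mrun R \<alpha> rs" "\<forall>r\<in>R. count_list rs r = k r" by blast
    note f = mrun_flow[OF rs(1) fin]
    have "\<forall>Y\<in>N. flow R \<alpha> k Y" using f flow_cong[OF rs(2)] by blast
    moreover have "set rs \<in> \<U>" using f by (auto simp: \<U>_def)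
    moreover have "\<forall>r\<in>R. (0 < int (k r)) = (r \<in> set rs)"
      using rs(2) count_list_0_iff by (metis neq0_conv of_nat_0_less_iff)
    ultimately show "?B k" by blast
  next
    assume B: "?B k"
    then obtain U where U: "U \<in> \<U>" "\<forall>r\<in>R. (0 < int (k r)) = (r \<in> U)" by blast
    have "{r \<in> R. k r > 0} = U" using U by (auto simp: \<U>_def)
    then have "\<forall>r\<in>R. k r > 0 \<longrightarrow> lhs r \<in> reach {r \<in> R. k r > 0} \<alpha>" using U(1) by (auto simp: \<U>_def)
    then show "?A k" using flow_mrun[OF fin] B flowN by blast
  qed
  moreover have "presb (natvars R) (\<lambda>k. flow R \<alpha> k Y)" for Y
  proof -
    have "presb (natvars R) (\<lambda>k. int (count \<alpha> Y) + (\<Sum>r\<in>R. int (k r) * int (count (rhs r) Y))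
        = (\<Sum>r\<in>R. (if lhs r = Y then 1 else 0) * int (k r)))"
      by (intro presb_eq lin_intros lin_natvars)
    moreover have "flow R \<alpha> k Y \<longleftrightarrow> int (count \<alpha> Y) + (\<Sum>r\<in>R. int (k r) * int (count (rhs r) Y))
        = (\<Sum>r\<in>R. (if lhs r = Y then 1 else 0) * int (k r))" for k
    proof -
      have "(\<Sum>r\<in>R. (if lhs r = Y then 1 else 0) * int (k r)) = int (\<Sum>r\<in>R. if lhs r = Y then k r else 0)"
        unfolding of_nat_sum by (intro sum.cong) auto
      then show ?thesis unfolding flow_def
        by (simp only: of_nat_eq_iff[symmetric, where 'a = int] of_nat_add of_nat_sum of_nat_mult)
    qed
    ultimately show ?thesis by simp
  qed
  moreover have "presb (natvars R) (\<lambda>k. (0 < int (k r)) = (r \<in> U))" if "r \<in> R" for r U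
  proof -
    have "presb (natvars R) (\<lambda>k. 0 < int (k r))"
      using that by (intro presb_less lin_const lin_natvars)
    then show ?thesis by (cases "r \<in> U") (auto dest: presb_not)
  qed
  ultimately show ?thesis using fin finN fU by (simp only: ) (intro presb_conj presb_ball presb_bex)
qed

lemma sum_list_count_list:
  fixes f :: "'r \<Rightarrow> int"
  assumes "finite R" "set rs \<subseteq> R"
  shows "(\<Sum>r\<leftarrow>rs. f r) = (\<Sum>r\<in>R. int (count_list rs r) * f r)"
  using assms(2)
proof (induction rs)
  case (Cons r rs)
  have "(\<Sum>q\<in>R. int (count_list (r # rs) q) * f q)
      = (\<Sum>q\<in>R. int (count_list rs q) * f q + (if q = r then f r else 0))"
    by (rule sum.cong) (auto simp: distrib_right)
  then show ?case using Cons assms(1) by (simp add: sum.distrib)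
qed simp

section \<open>Coordinates on a virtually abelian group\<close>

lemma additive_int_fun_scale:
  fixes \<phi> :: "(nat \<Rightarrow> int) \<Rightarrow> int"
  assumes "\<And>f g. \<phi> (\<lambda>i. f i + g i) = \<phi> f + \<phi> g"
  shows "\<phi> (\<lambda>i. k * f i) = k * \<phi> f"
proof -
  have 0: "\<phi> (\<lambda>i. 0) = 0" using assms[of "\<lambda>i. 0" "\<lambda>i. 0"] by simp
  have neg: "\<phi> (\<lambda>i. - f i) = - \<phi> f" for f
    using assms[of f "\<lambda>i. - f i"] 0 by simp
  have nat: "\<phi> (\<lambda>i. int m * f i) = int m * \<phi> f" for m f
  proof (induction m)
    case (Suc m)
    have "\<phi> (\<lambda>i. int (Suc m) * f i) = \<phi> (\<lambda>i. f i + int m * f i)"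
      by (simp add: algebra_simps)
    also have "\<dots> = \<phi> f + int m * \<phi> f" unfolding assms Suc ..
    finally show ?case by (simp add: algebra_simps)
  qed (simp add: 0)
  show ?thesis
  proof (cases "k \<ge> 0")
    case True
    then show ?thesis using nat[of "nat k" f] by simp
  next
    case False
    then show ?thesis using nat[of "nat (- k)" "\<lambda>i. - f i"] neg by simp
  qed
qed

text \<open>Since \<open>\<phi>\<close> ignores values at \<open>n\<close> and beyond,
  \<open>f\<close> may be replaced by a combination of the first \<open>n\<close> unit
  vectors.\<close>

lemma additive_int_fun_linear:
  fixes \<phi> :: "(nat \<Rightarrow> int) \<Rightarrow> int"
  assumes add: "\<And>f g. \<phi> (\<lambda>i. f i + g i) = \<phi> f + \<phi> g"
    and cong: "\<And>f g. (\<And>i. i < n \<Longrightarrow> f i = g i) \<Longrightarrow> \<phi> f = \<phi> g"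
  shows "\<phi> f = (\<Sum>j<n. f j * \<phi> (\<lambda>i. if i = j then 1 else 0))"
proof -
  let ?e = "\<lambda>j i. if i = j then 1 else 0 :: int"
  have "\<phi> (\<lambda>i. \<Sum>j<k. f j * ?e j i) = (\<Sum>j<k. f j * \<phi> (?e j))" for k
  proof (induction k)
    case 0
    show ?case using add[of "\<lambda>i. 0" "\<lambda>i. 0"] by simp
  next
    case (Suc k)
    have "\<phi> (\<lambda>i. \<Sum>j<Suc k. f j * ?e j i) = \<phi> (\<lambda>i. \<Sum>j<k. f j * ?e j i) + \<phi> (\<lambda>i. f k * ?e k i)"
      unfolding add[symmetric] by simp
    then show ?case using Suc additive_int_fun_scale[of \<phi>, OF add, of "f k" "?e k"] by simp
  qed
  moreover have "\<phi> f = \<phi> (\<lambda>i. \<Sum>j<n. f j * ?e j i)"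
    by (rule cong) (simp add: sum.delta' if_distrib[where f = "(*) _"] cong: if_cong)
  ultimately show ?thesis by simp
qed

locale va_group =
  fixes G :: "('a, 'b) monoid_scheme" (structure) and A :: "'a set" and bs :: "'a list" and T :: "'a set"
  assumes is_group: "group G" and data: "subgroup_transversal_data G A bs T"
begin

sublocale group G by (rule is_group)

sublocale normal A G
  using data by (simp add: subgroup_transversal_data_def)

abbreviation n where "n \<equiv> length bs"

lemma A_carrier: "a \<in> A \<Longrightarrow> a \<in> carrier G"
  using subset by blast

lemma finite_T: "finite T" and T_carrier: "t \<in> T \<Longrightarrow> t \<in> carrier G"
  and finite_rcosets: "finite (rcosets A)"
  using data by (auto simp: subgroup_transversal_data_def transversal_def)

lemma basis: "free_abelian_basis G A bs"
  using data by (simp add: subgroup_transversal_data_def)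

lemma bs_A: "set bs \<subseteq> A" and distinct_bs: "distinct bs"
  using basis by (simp_all add: free_abelian_basis_def)

lemma A_comm: "a \<in> A \<Longrightarrow> b \<in> A \<Longrightarrow> a \<otimes> b = b \<otimes> a"
proof -
  assume ab: "a \<in> A" "b \<in> A"
  have "comm_group (G\<lparr>carrier := A\<rparr>)" using basis by (simp add: free_abelian_basis_def)
  then interpret H: comm_group "G\<lparr>carrier := A\<rparr>" .
  show "a \<otimes> b = b \<otimes> a" using H.m_comm[of a b] ab by simp
qed

lemma A_left_comm: "a \<in> A \<Longrightarrow> b \<in> A \<Longrightarrow> c \<in> carrier G \<Longrightarrow> a \<otimes> (b \<otimes> c) = b \<otimes> (a \<otimes> c)"
  by (metis A_carrier A_comm m_assoc)

lemma conj_A: "g \<in> carrier G \<Longrightarrow> a \<in> A \<Longrightarrow> g \<otimes> a \<otimes> inv g \<in> A"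
  using inv_op_closed2 by blast

section \<open>The isomorphism between integer vectors and the subgroup\<close>

definition basis_prod :: "'a list \<Rightarrow> int list \<Rightarrow> 'a" where
  "basis_prod cs ks = foldr (\<lambda>(b, k) x. (b [^] k) \<otimes> x) (zip cs ks) \<one>"

text \<open>Coordinates are total functions on \<open>nat\<close> of which only the values below
  \<open>n\<close> count; this avoids a type of vectors of fixed length. The inverse is
  \<open>coord\<close>.\<close>

definition vec :: "(nat \<Rightarrow> int) \<Rightarrow> 'a" where
  "vec f = basis_prod bs (map f [0..<n])"

lemma basis_prod_Nil [simp]: "basis_prod [] ks = \<one>"
  and basis_prod_Cons [simp]: "basis_prod (b # cs) (k # ks) = (b [^] k) \<otimes> basis_prod cs ks"
  by (simp_all add: basis_prod_def)

lemma basis_prod_A: "set cs \<subseteq> A \<Longrightarrow> length ks = length cs \<Longrightarrow> basis_prod cs ks \<in> A"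
proof (induction cs arbitrary: ks)
  case (Cons b cs)
  then obtain k ks' where "ks = k # ks'" by (cases ks) auto
  then show ?case using Cons subgroup_int_pow_closed[OF subgroup_axioms, of b k] by simp
qed simp

lemma basis_prod_add:
  "set cs \<subseteq> A \<Longrightarrow> length ks = length cs \<Longrightarrow> length ls = length cs \<Longrightarrow>
    basis_prod cs (map2 (+) ks ls) = basis_prod cs ks \<otimes> basis_prod cs ls"
proof (induction cs arbitrary: ks ls)
  case (Cons b cs)
  then obtain k ks' l ls' where k: "ks = k # ks'" "ls = l # ls'" by (cases ks; cases ls) auto
  have A: "b [^] k \<in> A" "b [^] l \<in> A" "basis_prod cs ks' \<in> A" "basis_prod cs ls' \<in> A"
    using Cons.prems k subgroup_int_pow_closed[OF subgroup_axioms, of b] basis_prod_A by auto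
  have "b [^] (k + l) = (b [^] k) \<otimes> (b [^] l)" using Cons.prems(1) A_carrier by (intro int_pow_mult) auto
  moreover have "basis_prod cs (map2 (+) ks' ls') = basis_prod cs ks' \<otimes> basis_prod cs ls'"
    using Cons k by simp
  ultimately show ?case using A A_carrier k by (simp add: m_assoc A_left_comm)
qed simp

lemma vec_A [simp]: "vec f \<in> A"
  unfolding vec_def using bs_A by (intro basis_prod_A) auto

lemma vec_carrier [simp]: "vec f \<in> carrier G"
  using A_carrier by simp

lemma vec_add: "vec (\<lambda>i. f i + g i) = vec f \<otimes> vec g"
proof -
  have "map (\<lambda>i. f i + g i) [0..<n] = map2 (+) (map f [0..<n]) (map g [0..<n])"
    by (simp add: zip_map_map zip_same_conv_map)
  then show ?thesis unfolding vec_def using basis_prod_add bs_A by simp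
qed

lemma vec_cong: "(\<And>i. i < n \<Longrightarrow> f i = g i) \<Longrightarrow> vec f = vec g"
  unfolding vec_def by (intro arg_cong2[where f = basis_prod] map_cong) auto

lemma vec_zero [simp]: "vec (\<lambda>i. 0) = \<one>"
proof -
  have "vec (\<lambda>i. 0) \<otimes> vec (\<lambda>i. 0) = vec (\<lambda>i. 0)" using vec_add[of "\<lambda>i. 0" "\<lambda>i. 0"] by simp
  then show ?thesis by (metis l_cancel_one vec_carrier)
qed

lemma vec_uminus: "vec (\<lambda>i. - f i) = inv (vec f)"
  using vec_add[of "\<lambda>i. - f i" f] by (intro inv_equality[symmetric]) simp_all

lemma ex1_coords: "a \<in> A \<Longrightarrow> \<exists>!ks. length ks = n \<and> basis_prod bs ks = a"
  using basis unfolding free_abelian_basis_def basis_prod_def by blast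

definition coord :: "'a \<Rightarrow> nat \<Rightarrow> int" where
  "coord a i = (THE ks. length ks = n \<and> basis_prod bs ks = a) ! i"

lemma vec_coord: "a \<in> A \<Longrightarrow> vec (coord a) = a"
proof -
  assume "a \<in> A"
  from theI'[OF ex1_coords[OF this]] show ?thesis
    unfolding vec_def coord_def by (metis map_nth)
qed

lemma coord_vec: "i < n \<Longrightarrow> coord (vec f) i = f i"
proof -
  assume i: "i < n"
  have "(THE ks. length ks = n \<and> basis_prod bs ks = vec f) = map f [0..<n]"
    by (rule the1_equality[OF ex1_coords]) (simp_all add: vec_def[symmetric])
  then show ?thesis using i by (simp add: coord_def)
qed

lemma vec_eq_iff: "vec f = vec g \<longleftrightarrow> (\<forall>i<n. f i = g i)"
  by (metis coord_vec vec_cong)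

lemma coord_mult: "a \<in> A \<Longrightarrow> b \<in> A \<Longrightarrow> i < n \<Longrightarrow> coord (a \<otimes> b) i = coord a i + coord b i"
  using coord_vec[of i "\<lambda>i. coord a i + coord b i"] by (simp add: vec_add vec_coord)

lemma ex_transversal:
  assumes "g \<in> carrier G"
  shows "\<exists>a\<in>A. \<exists>t\<in>T. g = a \<otimes> t"
proof -
  have "A #> g \<in> rcosets A" using assms subset rcosetsI by blast
  then have "\<exists>!t. t \<in> T \<and> t \<in> A #> g"
    using data by (simp add: subgroup_transversal_data_def transversal_def)
  then obtain t where t: "t \<in> T" "t \<in> A #> g" by blast
  then obtain a where a: "a \<in> A" "t = a \<otimes> g" by (auto simp: r_coset_def)
  then have "g = inv a \<otimes> t" using A_carrier assms by (simp add: m_assoc[symmetric])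
  then show ?thesis using a t by blast
qed

lemma transversal_unique:
  assumes "a \<in> A" "t \<in> T" "a' \<in> A" "t' \<in> T" "a \<otimes> t = a' \<otimes> t'"
  shows "t = t'" "a = a'"
proof -
  have c: "a \<in> carrier G" "a' \<in> carrier G" "t \<in> carrier G" "t' \<in> carrier G"
    using assms A_carrier T_carrier by auto
  have "inv a' \<otimes> (a' \<otimes> t') = inv a' \<otimes> (a \<otimes> t)" using assms(5) by simp
  then have "t' = inv a' \<otimes> a \<otimes> t" using c by (simp add: m_assoc[symmetric])
  then have "t' \<in> A #> t" using assms(1,3) by (auto simp: r_coset_def)
  moreover have "t \<in> A #> t" using c rcos_self is_group subgroup_axioms by blast
  moreover have "A #> t \<in> rcosets A" using c subset rcosetsI by blast
  then have "\<exists>!u. u \<in> T \<and> u \<in> A #> t"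
    using data by (simp add: subgroup_transversal_data_def transversal_def)
  ultimately show "t = t'" using assms(2,4) by blast
  then show "a = a'" using assms(5) c by simp
qed

lemma ex_vec_transversal:
  assumes "g \<in> carrier G"
  shows "\<exists>f. \<exists>t\<in>T. g = vec f \<otimes> t"
  using ex_transversal[OF assms] vec_coord by metis

lemma vec_transversal_eq_iff:
  assumes "t \<in> T" "t' \<in> T"
  shows "vec f \<otimes> t = vec f' \<otimes> t' \<longleftrightarrow> t = t' \<and> (\<forall>i<n. f i = f' i)"
  using transversal_unique[of "vec f" t "vec f'" t'] assms vec_eq_iff[of f f'] by auto

text \<open>Conjugation by \<open>g\<close> is additive on \<open>A\<close>, hence given by an
  integer matrix. This is what lets coordinates be collected to the left of coset
  representatives.\<close>

lemma conj_vec: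
  assumes g: "g \<in> carrier G"
  shows "\<exists>M. \<forall>f. g \<otimes> vec f = vec (\<lambda>i. \<Sum>j<n. f j * M i j) \<otimes> g"
proof -
  define h where "h f = g \<otimes> vec f \<otimes> inv g" for f
  have hA: "h f \<in> A" for f unfolding h_def using conj_A[OF g vec_A] .
  have h_add: "h (\<lambda>i. f i + f' i) = h f \<otimes> h f'" for f f'
    unfolding h_def vec_add using g by (simp add: m_assoc inv_solve_left' flip: m_assoc[of "inv g" g])
  define M where "M i j = coord (h (\<lambda>i. if i = j then 1 else 0)) i" for i j
  have "coord (h f) i = (\<Sum>j<n. f j * M i j)" if "i < n" for f i
    unfolding M_def
  proof (rule additive_int_fun_linear[where \<phi> = "\<lambda>f. coord (h f) i"])
    show "coord (h (\<lambda>i. f i + f' i)) i = coord (h f) i + coord (h f') i" for f f'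
      unfolding h_add using coord_mult[OF hA hA that] .
    show "coord (h f) i = coord (h f') i" if "\<And>i. i < n \<Longrightarrow> f i = f' i" for f f'
      unfolding h_def using vec_cong[of f f', OF that] by simp
  qed
  then have "h f = vec (\<lambda>i. \<Sum>j<n. f j * M i j)" for f
    using vec_coord[OF hA, of f] vec_cong[of "coord (h f)" "\<lambda>i. \<Sum>j<n. f j * M i j"] by simp
  moreover have "g \<otimes> vec f = h f \<otimes> g" for f unfolding h_def using g by (simp add: m_assoc)
  ultimately show ?thesis by (intro exI[of _ M]) simp
qed

text \<open>Affine maps into one coset: the representative \<open>t\<close> does not depend on
  \<open>s\<close>. Case distinctions on cosets are thereby avoided in the arithmetic; they are made
  beforehand by the choice of a template.\<close>

definition agmap :: "('s \<Rightarrow> int) set \<Rightarrow> ('s \<Rightarrow> 'a) \<Rightarrow> bool" where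
  "agmap F \<Phi> \<longleftrightarrow> (\<exists>c. \<exists>t\<in>T. (\<forall>i<n. c i \<in> lin F) \<and> (\<forall>s. \<Phi> s = vec (\<lambda>i. c i s) \<otimes> t))"

lemma agmapI:
  assumes "g \<in> carrier G" "\<And>i. i < n \<Longrightarrow> c i \<in> lin F" "\<And>s. \<Phi> s = vec (\<lambda>i. c i s) \<otimes> g"
  shows "agmap F \<Phi>"
proof -
  obtain f t where t: "t \<in> T" "g = vec f \<otimes> t" using ex_vec_transversal[OF assms(1)] by blast
  have "\<Phi> s = vec (\<lambda>i. c i s + f i) \<otimes> t" for s
    unfolding assms(3) t(2) vec_add using t(1) T_carrier by (simp add: m_assoc)
  moreover have "(\<lambda>s. c i s + f i) \<in> lin F" if "i < n" for i
    using assms(2)[OF that] by (intro lin_intros)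
  ultimately show ?thesis unfolding agmap_def using t(1)
    by (intro exI[of _ "\<lambda>i s. c i s + f i"] bexI[of _ t]) auto
qed

lemma agmapE:
  assumes "agmap F \<Phi>"
  obtains t c where "t \<in> T" "\<forall>i<n. c i \<in> lin F" "\<forall>s. \<Phi> s = vec (\<lambda>i. c i s) \<otimes> t"
  using assms unfolding agmap_def by blast

lemma agmap_carrier: "agmap F \<Phi> \<Longrightarrow> \<Phi> s \<in> carrier G"
  by (elim agmapE) (simp add: T_carrier)

lemma agmap_const: "g \<in> carrier G \<Longrightarrow> agmap F (\<lambda>s. g)"
  by (rule agmapI[where c = "\<lambda>i s. 0"]) (auto intro: lin_const)

lemma agmap_vec: "(\<And>i. i < n \<Longrightarrow> c i \<in> lin F) \<Longrightarrow> agmap F (\<lambda>s. vec (\<lambda>i. c i s))"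
  by (rule agmapI[where g = \<one>]) auto

lemma agmap_mult:
  assumes "agmap F \<Phi>" "agmap F \<Psi>"
  shows "agmap F (\<lambda>s. \<Phi> s \<otimes> \<Psi> s)"
proof -
  obtain c t where t: "t \<in> T" "\<forall>i<n. c i \<in> lin F" "\<forall>s. \<Phi> s = vec (\<lambda>i. c i s) \<otimes> t"
    using assms(1) by (rule agmapE)
  obtain d u where u: "u \<in> T" "\<forall>i<n. d i \<in> lin F" "\<forall>s. \<Psi> s = vec (\<lambda>i. d i s) \<otimes> u"
    using assms(2) by (rule agmapE)
  have tc: "t \<in> carrier G" "u \<in> carrier G" using t u T_carrier by auto
  obtain M where M: "\<And>f. t \<otimes> vec f = vec (\<lambda>i. \<Sum>j<n. f j * M i j) \<otimes> t"
    using conj_vec[OF tc(1)] by blast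
  show ?thesis
  proof (rule agmapI[where g = "t \<otimes> u" and c = "\<lambda>i s. c i s + (\<Sum>j<n. d j s * M i j)"])
    show "(\<lambda>s. c i s + (\<Sum>j<n. d j s * M i j)) \<in> lin F" if "i < n" for i
      using that t u by (intro lin_intros) auto
    fix s
    have "\<Phi> s \<otimes> \<Psi> s = vec (\<lambda>i. c i s) \<otimes> (t \<otimes> vec (\<lambda>i. d i s)) \<otimes> u"
      unfolding t(3)[rule_format] u(3)[rule_format] using tc by (simp add: m_assoc)
    also have "\<dots> = vec (\<lambda>i. c i s + (\<Sum>j<n. d j s * M i j)) \<otimes> (t \<otimes> u)"
      unfolding M vec_add using tc by (simp add: m_assoc)
    finally show "\<Phi> s \<otimes> \<Psi> s = vec (\<lambda>i. c i s + (\<Sum>j<n. d j s * M i j)) \<otimes> (t \<otimes> u)" .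
  qed (use tc in auto)
qed

lemma agmap_inv:
  assumes "agmap F \<Phi>"
  shows "agmap F (\<lambda>s. inv (\<Phi> s))"
proof -
  obtain c t where t: "t \<in> T" "\<forall>i<n. c i \<in> lin F" "\<forall>s. \<Phi> s = vec (\<lambda>i. c i s) \<otimes> t"
    using assms by (rule agmapE)
  have "inv (\<Phi> s) = inv t \<otimes> vec (\<lambda>i. - c i s)" for s
    unfolding t(3)[rule_format] vec_uminus using t(1) T_carrier by (simp add: inv_mult_group)
  moreover have "agmap F (\<lambda>s. inv t \<otimes> vec (\<lambda>i. - c i s))"
    using t T_carrier by (intro agmap_mult agmap_const agmap_vec lin_intros) auto
  ultimately show ?thesis by simp
qed

lemma agmap_subst:
  assumes "agmap F \<Phi>" "\<And>f. f \<in> F \<Longrightarrow> (\<lambda>s. f (h s)) \<in> lin F'"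
  shows "agmap F' (\<lambda>s. \<Phi> (h s))"
proof -
  obtain c t where t: "t \<in> T" "\<forall>i<n. c i \<in> lin F" "\<forall>s. \<Phi> s = vec (\<lambda>i. c i s) \<otimes> t"
    using assms(1) by (rule agmapE)
  show ?thesis
    by (rule agmapI[where g = t and c = "\<lambda>i s. c i (h s)"])
      (use t T_carrier lin_subst[OF t(2)[rule_format] assms(2)] in auto)
qed

lemma presb_agmap_eq:
  assumes "agmap F \<Phi>" "agmap F \<Psi>"
  shows "presb F (\<lambda>s. \<Phi> s = \<Psi> s)"
proof -
  obtain c t where t: "t \<in> T" "\<forall>i<n. c i \<in> lin F" "\<forall>s. \<Phi> s = vec (\<lambda>i. c i s) \<otimes> t"
    using assms(1) by (rule agmapE)
  obtain d u where u: "u \<in> T" "\<forall>i<n. d i \<in> lin F" "\<forall>s. \<Psi> s = vec (\<lambda>i. d i s) \<otimes> u"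
    using assms(2) by (rule agmapE)
  have "presb F (\<lambda>s. t = u \<and> (\<forall>i\<in>{..<n}. c i s = d i s))"
    using t u by (intro presb_intros) auto
  moreover have "\<Phi> s = \<Psi> s \<longleftrightarrow> t = u \<and> (\<forall>i\<in>{..<n}. c i s = d i s)" for s
    using vec_transversal_eq_iff[OF t(1) u(1)] t(3) u(3) by auto
  ultimately show ?thesis by simp
qed

text \<open>The pairs \<open>(x, y)\<close> of natural vectors with \<open>vec (x - y) \<in> H\<close> are closed under
  subtraction, hence spanned by finitely many of them.\<close>

lemma presb_subgroup:
  fixes F :: "('s \<Rightarrow> int) set"
  assumes H: "subgroup H G" and \<Phi>: "agmap F \<Phi>" and fin: "finite F"
  shows "presb F (\<lambda>s. \<Phi> s \<in> H)"
proof -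
  define V where "V = {..<n} \<times> (UNIV :: bool set)"
  define \<delta> where "\<delta> x i = int (x (i, True)) - int (x (i, False))" for x :: "nat \<times> bool \<Rightarrow> nat" and i
  define M where "M = {x. (\<forall>v. v \<notin> V \<longrightarrow> x v = 0) \<and> vec (\<delta> x) \<in> H}"
  have "\<exists>P\<subseteq>M. finite P \<and> (\<forall>x\<in>M. \<exists>ps\<in>lists P. \<forall>v. x v = (\<Sum>p\<leftarrow>ps. p v))"
  proof (rule subtractive_finite_basis)
    show "finite V" by (simp add: V_def)
    fix x y assume xy: "x \<in> M" "y \<in> M" "\<forall>v. y v \<le> x v"
    have "\<delta> (\<lambda>v. x v - y v) = (\<lambda>i. \<delta> x i + - \<delta> y i)"
      using xy(3) by (auto simp: \<delta>_def of_nat_diff)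
    then have "vec (\<delta> (\<lambda>v. x v - y v)) = vec (\<delta> x) \<otimes> inv (vec (\<delta> y))"
      by (simp only: vec_add vec_uminus)
    then show "(\<lambda>v. x v - y v) \<in> M"
      using xy by (simp add: M_def subgroup.m_closed[OF H] subgroup.m_inv_closed[OF H])
  qed (auto simp: M_def)
  then obtain P where P: "P \<subseteq> M" "finite P" "\<And>x. x \<in> M \<Longrightarrow> \<exists>ps\<in>lists P. \<forall>v. x v = (\<Sum>p\<leftarrow>ps. p v)"
    by (elim exE conjE) simp
  have vecH: "vec f \<in> H \<longleftrightarrow> (\<exists>k. \<forall>i\<in>{..<n}. f i = (\<Sum>p\<in>P. int (k p) * \<delta> p i))" for f
  proof
    assume f: "vec f \<in> H"
    \<comment> \<open>Positive and negative parts of \<open>f\<close>.\<close>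
    define x where "x v = (if v \<in> V then nat (if snd v then f (fst v) else - f (fst v)) else 0)" for v
    have dx: "\<delta> x i = f i" if "i < n" for i using that by (simp add: \<delta>_def x_def V_def)
    then have "vec (\<delta> x) \<in> H" using f vec_cong[of "\<delta> x" f] by simp
    then have "x \<in> M" by (simp add: M_def x_def)
    from P(3)[OF this] obtain ps where ps: "ps \<in> lists P" "\<forall>v. x v = (\<Sum>p\<leftarrow>ps. p v)" by (rule bexE)
    have "f i = (\<Sum>p\<in>P. int (count_list ps p) * \<delta> p i)" if "i < n" for i
    proof -
      have "f i = \<delta> x i" using dx[OF that] by simp
      also have "\<dots> = (\<Sum>p\<leftarrow>ps. \<delta> p i)"
        unfolding \<delta>_def ps(2)[rule_format] by (induction ps) auto
      also have "\<dots> = (\<Sum>p\<in>P. int (count_list ps p) * \<delta> p i)"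
        using ps(1) P(2) by (intro sum_list_count_list) auto
      finally show ?thesis .
    qed
    then show "\<exists>k. \<forall>i\<in>{..<n}. f i = (\<Sum>p\<in>P. int (k p) * \<delta> p i)"
      by (intro exI[of _ "count_list ps"]) auto
  next
    assume "\<exists>k. \<forall>i\<in>{..<n}. f i = (\<Sum>p\<in>P. int (k p) * \<delta> p i)"
    then obtain k where k: "\<forall>i\<in>{..<n}. f i = (\<Sum>p\<in>P. int (k p) * \<delta> p i)" by (rule exE)
    have "vec (\<lambda>i. \<Sum>p\<in>Q. int (k p) * \<delta> p i) \<in> H" if "Q \<subseteq> P" for Q
      using finite_subset[OF that P(2)] that
    proof (induction Q rule: finite_induct)
      case empty
      show ?case using subgroup.one_closed[OF H] by simp
    next
      case (insert p Q)
      have p: "vec (\<delta> p) \<in> H" using insert.prems P(1) by (auto simp: M_def)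
      have "vec (\<lambda>i. int m * \<delta> p i) \<in> H" for m
      proof (induction m)
        case (Suc m)
        have "vec (\<lambda>i. int (Suc m) * \<delta> p i) = vec (\<delta> p) \<otimes> vec (\<lambda>i. int m * \<delta> p i)"
          unfolding vec_add[symmetric] by (simp add: algebra_simps)
        then show ?case using Suc p subgroup.m_closed[OF H] by simp
      qed (simp add: subgroup.one_closed[OF H])
      moreover have "vec (\<lambda>i. \<Sum>p\<in>insert p Q. int (k p) * \<delta> p i)
          = vec (\<lambda>i. int (k p) * \<delta> p i) \<otimes> vec (\<lambda>i. \<Sum>p\<in>Q. int (k p) * \<delta> p i)"
        unfolding vec_add[symmetric] using insert.hyps by simp
      ultimately show ?case using insert subgroup.m_closed[OF H] by simp
    qed
    from this[of P] show "vec f \<in> H" using k vec_cong[of f "\<lambda>i. \<Sum>p\<in>P. int (k p) * \<delta> p i"] by simp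
  qed
  obtain c t where t: "t \<in> T" "\<forall>i<n. c i \<in> lin F" "\<forall>s. \<Phi> s = vec (\<lambda>i. c i s) \<otimes> t"
    using \<Phi> by (rule agmapE)
  have tc: "t \<in> carrier G" using t(1) T_carrier by simp
  show ?thesis
  \<comment> \<open>Either \<open>H\<close> misses the coset of \<open>t\<close>, or translation by
    one of its elements in that coset reduces membership to \<open>A\<close>.\<close>
  proof (cases "\<exists>f. vec f \<otimes> t \<in> H")
    case False
    then have "(\<lambda>s. \<Phi> s \<in> H) = (\<lambda>s. False)" using t(3) by auto
    then show ?thesis by (simp only: presb_const)
  next
    case True
    then obtain f where f: "vec f \<otimes> t \<in> H" by (rule exE)
    have "\<Phi> s \<in> H \<longleftrightarrow> vec (\<lambda>i. c i s - f i) \<in> H" for s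
    proof -
      have 1: "vec (\<lambda>i. c i s + - f i) = \<Phi> s \<otimes> inv (vec f \<otimes> t)"
        unfolding vec_add vec_uminus t(3)[rule_format] using tc
        by (simp add: inv_mult_group m_assoc flip: m_assoc[of t])
      have 2: "\<Phi> s = vec (\<lambda>i. c i s + - f i) \<otimes> (vec f \<otimes> t)"
        unfolding t(3)[rule_format] vec_add vec_uminus using tc
        by (simp add: m_assoc flip: m_assoc[of "inv (vec f)"])
      have "\<Phi> s \<in> H \<longleftrightarrow> vec (\<lambda>i. c i s + - f i) \<in> H"
      proof
        assume "\<Phi> s \<in> H"
        then show "vec (\<lambda>i. c i s + - f i) \<in> H"
          unfolding 1 by (rule subgroup.m_closed[OF H _ subgroup.m_inv_closed[OF H f]])
      next
        assume "vec (\<lambda>i. c i s + - f i) \<in> H"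
        then show "\<Phi> s \<in> H" by (subst 2) (rule subgroup.m_closed[OF H _ f])
      qed
      then show ?thesis by simp
    qed
    then have eq: "(\<lambda>s. \<Phi> s \<in> H) = (\<lambda>s. \<exists>k. \<forall>i\<in>{..<n}. c i s - f i = (\<Sum>p\<in>P. int (k p) * \<delta> p i))"
      by (simp only: vecH)
    have "presb (pairvars F P) (\<lambda>x. \<forall>i\<in>{..<n}. c i (fst x) - f i = (\<Sum>p\<in>P. int (snd x p) * \<delta> p i))"
      using t(2) by (intro presb_intros lin_intros lin_pairvars_fst lin_pairvars_snd) auto
    from presb_ex_nat[OF P(2) fin this] show ?thesis unfolding eq by simp
  qed
qed

end

section \<open>Equations and abelianisation constraints\<close>

lemma word_value_Nil [simp]: "word_value G ev [] = \<one>\<^bsub>G\<^esub>"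
  and word_value_Cons [simp]: "word_value G ev (x # w) = ev x \<otimes>\<^bsub>G\<^esub> word_value G ev w"
  by (simp_all add: word_value_def)

lemma (in group) word_value_closed:
  "(\<And>x. x \<in> set w \<Longrightarrow> ev x \<in> carrier G) \<Longrightarrow> word_value G ev w \<in> carrier G"
  by (induction w) auto

lemma (in group) word_value_append:
  "(\<And>x. x \<in> set u \<union> set v \<Longrightarrow> ev x \<in> carrier G) \<Longrightarrow>
    word_value G ev (u @ v) = word_value G ev u \<otimes> word_value G ev v"
  by (induction u) (auto simp: m_assoc word_value_closed)

lemma (in group_hom) hom_word_value:
  "(\<And>x. x \<in> set w \<Longrightarrow> ev x \<in> carrier G) \<Longrightarrow>
    h (word_value G ev w) = word_value H (\<lambda>x. h (ev x)) w"
  by (induction w) (auto simp: G.word_value_closed)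

lemma word_value_cong:
  "(\<And>x. x \<in> set w \<Longrightarrow> ev x = ev' x) \<Longrightarrow> word_value G ev w = word_value G ev' w"
  by (induction w) auto

lemma word_value_map: "word_value G ev (map f w) = word_value G (\<lambda>x. ev (f x)) w"
  by (induction w) auto

primrec fp_letter_value :: "('a, 'b) monoid_scheme \<Rightarrow> 'a list \<Rightarrow> 'a fp_letter \<Rightarrow> 'a" where
  "fp_letter_value G gs (Const g) = g"
| "fp_letter_value G gs (Var i) = gs ! i"
| "fp_letter_value G gs (VarInv i) = inv\<^bsub>G\<^esub> (gs ! i)"

abbreviation fp_value :: "('a, 'b) monoid_scheme \<Rightarrow> 'a list \<Rightarrow> 'a fp_letter list \<Rightarrow> 'a" where
  "fp_value G gs \<equiv> word_value G (fp_letter_value G gs)"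

lemma fp_words_Nil [simp]: "[] \<in> fp_words G m"
  and fp_words_Cons: "x # u \<in> fp_words G m \<longleftrightarrow>
    x \<in> Const ` carrier G \<union> Var ` {..<m} \<union> VarInv ` {..<m} \<and> u \<in> fp_words G m"
  and fp_words_append: "u @ v \<in> fp_words G m \<longleftrightarrow> u \<in> fp_words G m \<and> v \<in> fp_words G m"
  by (simp_all add: fp_words_def)

context group
begin

lemma fp_letter_value_closed:
  assumes "gs \<in> tuples G m" "u \<in> fp_words G m" "x \<in> set u"
  shows "fp_letter_value G gs x \<in> carrier G"
proof -
  have gs: "i < m \<Longrightarrow> gs ! i \<in> carrier G" for i
    using assms(1) by (auto simp: tuples_def)
  have "x \<in> Const ` carrier G \<union> Var ` {..<m} \<union> VarInv ` {..<m}"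
    using assms(2,3) unfolding fp_words_def in_lists_conv_set by blast
  then show ?thesis using gs by auto
qed

lemma fp_value_closed: "gs \<in> tuples G m \<Longrightarrow> u \<in> fp_words G m \<Longrightarrow> fp_value G gs u \<in> carrier G"
  using fp_letter_value_closed by (intro word_value_closed) blast

lemma fp_value_append:
  "gs \<in> tuples G m \<Longrightarrow> u \<in> fp_words G m \<Longrightarrow> v \<in> fp_words G m \<Longrightarrow>
    fp_value G gs (u @ v) = fp_value G gs u \<otimes> fp_value G gs v"
  using fp_letter_value_closed by (intro word_value_append) blast

lemma fp_equiv_words: "fp_equiv G m u v \<Longrightarrow> u \<in> fp_words G m \<and> v \<in> fp_words G m"
  by (induction rule: fp_equiv.induct) (auto simp: fp_words_Cons fp_words_append)

lemma fp_equiv_value: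
  assumes "fp_equiv G m u v" "gs \<in> tuples G m"
  shows "fp_value G gs u = fp_value G gs v"
  using assms(1)
proof (induction rule: fp_equiv.induct)
  case (fp_var_inv i)
  then have "gs ! i \<in> carrier G" using assms(2) by (auto simp: tuples_def)
  then show ?case by simp
next
  case (fp_inv_var i)
  then have "gs ! i \<in> carrier G" using assms(2) by (auto simp: tuples_def)
  then show ?case by simp
next
  case (fp_append u u' v v')
  then show ?case using fp_equiv_words assms(2) by (simp add: fp_value_append)
qed (auto simp: m_assoc)

lemma fp_class_self: "u \<in> fp_words G m \<Longrightarrow> u \<in> fp_class G m u"
  by (simp add: fp_class_def fp_refl)

lemma fp_class_eq: "fp_equiv G m u v \<Longrightarrow> fp_class G m u = fp_class G m v"
  unfolding fp_class_def
  by (intro Collect_cong iffI; erule fp_equiv.fp_trans[rotated]; (erule fp_equiv.fp_sym | assumption))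

lemma fp_class_mult:
  assumes "u \<in> fp_words G m" "v \<in> fp_words G m"
  shows "fp_class G m u \<otimes>\<^bsub>free_product_vars G m\<^esub> fp_class G m v = fp_class G m (u @ v)"
proof -
  have eq: "fp_class G m (u' @ v') = fp_class G m (u @ v)"
    if "u' \<in> fp_class G m u" "v' \<in> fp_class G m v" for u' v'
  proof -
    have "fp_equiv G m (u @ v) (u' @ v')"
      using that unfolding fp_class_def mem_Collect_eq by (rule fp_equiv.fp_append)
    then show ?thesis by (rule fp_class_eq[symmetric])
  qed
  have "(\<Union>u'\<in>fp_class G m u. \<Union>v'\<in>fp_class G m v. fp_class G m (u' @ v'))
      = (\<Union>u'\<in>fp_class G m u. \<Union>v'\<in>fp_class G m v. fp_class G m (u @ v))"
    by (intro SUP_cong refl eq)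
  also have "\<dots> = fp_class G m (u @ v)"
    using fp_class_self[OF assms(1)] fp_class_self[OF assms(2)] by blast
  finally show ?thesis by (simp add: free_product_vars_def)
qed

lemma fp_class_closed: "u \<in> fp_words G m \<Longrightarrow> fp_class G m u \<in> carrier (free_product_vars G m)"
  by (simp add: free_product_vars_def)

lemma hom_fp_value:
  assumes \<phi>: "\<phi> \<in> hom (free_product_vars G m) G"
    and const: "\<And>g. g \<in> carrier G \<Longrightarrow> \<phi> (fp_class G m [Const g]) = g"
    and gs: "gs = map (\<lambda>i. \<phi> (fp_class G m [Var i])) [0..<m]"
  shows "gs \<in> tuples G m" "u \<in> fp_words G m \<Longrightarrow> \<phi> (fp_class G m u) = fp_value G gs u"
proof -
  have closed: "\<phi> (fp_class G m u) \<in> carrier G" if "u \<in> fp_words G m" for u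
    using hom_in_carrier[OF \<phi> fp_class_closed[OF that]] .
  have mult: "\<phi> (fp_class G m (u @ v)) = \<phi> (fp_class G m u) \<otimes> \<phi> (fp_class G m v)"
    if "u \<in> fp_words G m" "v \<in> fp_words G m" for u v
    using hom_mult[OF \<phi> fp_class_closed[OF that(1)] fp_class_closed[OF that(2)]] fp_class_mult[OF that]
    by simp
  have nil: "\<phi> (fp_class G m []) = \<one>"
    using const[of \<one>] fp_class_eq[OF fp_const_one] by simp
  show "gs \<in> tuples G m"
    unfolding gs tuples_def by (auto intro!: closed simp: fp_words_Cons)
  show "\<phi> (fp_class G m u) = fp_value G gs u" if "u \<in> fp_words G m"
    using that
  proof (induction u)
    case Nil
    show ?case using nil by simp
  next
    case (Cons x u)
    then have xu: "[x] \<in> fp_words G m" "u \<in> fp_words G m" by (simp_all add: fp_words_Cons)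
    have "\<phi> (fp_class G m [x]) = fp_letter_value G gs x"
    proof (cases x)
      case (Const g)
      then show ?thesis using const xu by (auto simp: fp_words_Cons)
    next
      case (Var i)
      then show ?thesis using xu by (auto simp: gs fp_words_Cons)
    next
      case (VarInv i)
      then have i: "i < m" using xu by (auto simp: fp_words_Cons)
      then have w: "[Var i] \<in> fp_words G m" "[VarInv i] \<in> fp_words G m" by (auto simp: fp_words_Cons)
      have "\<phi> (fp_class G m [VarInv i]) \<otimes> \<phi> (fp_class G m [Var i]) = \<one>"
        using mult[OF w(2,1)] nil fp_class_eq[OF fp_inv_var[OF i]] by simp
      then have "inv (\<phi> (fp_class G m [Var i])) = \<phi> (fp_class G m [VarInv i])"
        using closed w by (intro inv_equality) auto
      then show ?thesis using VarInv i by (simp add: gs)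
    qed
    then show ?case using mult[OF xu] Cons.IH[OF xu(2)] by simp
  qed
qed

text \<open>The universal property of the free product: homomorphisms that fix \<open>G\<close> are
  the evaluations at tuples.\<close>

lemma equation_solutions_iff:
  assumes E: "E \<subseteq> carrier (free_product_vars G m)"
  shows "gs \<in> equation_solutions G m E \<longleftrightarrow>
    gs \<in> tuples G m \<and> (\<forall>W\<in>E. \<forall>u\<in>W. fp_value G gs u = \<one>)"
proof
  assume "gs \<in> equation_solutions G m E"
  then obtain \<phi> where \<phi>: "gs = map (\<lambda>i. \<phi> (fp_class G m [Var i])) [0..<m]"
    "\<phi> \<in> hom (free_product_vars G m) G" "\<forall>g\<in>carrier G. \<phi> (fp_class G m [Const g]) = g"
    "\<forall>w\<in>E. \<phi> w = \<one>"
    unfolding equation_solutions_def by blast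
  note val = hom_fp_value[OF \<phi>(2) \<phi>(3)[rule_format] \<phi>(1)]
  have "fp_value G gs u = \<one>" if W: "W \<in> E" "u \<in> W" for W u
  proof -
    obtain u0 where u0: "W = fp_class G m u0"
      using W(1) E by (auto simp: free_product_vars_def)
    then have eq: "fp_equiv G m u0 u" using W(2) by (simp add: fp_class_def)
    have "fp_value G gs u = \<phi> (fp_class G m u)"
      using val(2)[of u] fp_equiv_words[OF eq] by simp
    also have "\<dots> = \<phi> W" unfolding u0 fp_class_eq[OF eq] ..
    finally show ?thesis using \<phi>(4) W(1) by simp
  qed
  then show "gs \<in> tuples G m \<and> (\<forall>W\<in>E. \<forall>u\<in>W. fp_value G gs u = \<one>)" using val(1) by simp
next
  assume gs: "gs \<in> tuples G m \<and> (\<forall>W\<in>E. \<forall>u\<in>W. fp_value G gs u = \<one>)"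
  \<comment> \<open>Evaluation of an arbitrary representative; by \<open>fp_equiv_value\<close> the
    choice does not matter.\<close>
  define \<phi> where "\<phi> W = fp_value G gs (SOME u. u \<in> W)" for W
  have \<phi>: "\<phi> (fp_class G m u) = fp_value G gs u" if "u \<in> fp_words G m" for u
  proof -
    have "(SOME v. v \<in> fp_class G m u) \<in> fp_class G m u"
      by (rule someI) (rule fp_class_self[OF that])
    then have "fp_equiv G m u (SOME v. v \<in> fp_class G m u)" by (simp add: fp_class_def)
    from fp_equiv_value[OF this conjunct1[OF gs]] show ?thesis by (simp add: \<phi>_def)
  qed
  have car: "carrier (free_product_vars G m) = fp_class G m ` fp_words G m"
    by (simp add: free_product_vars_def)
  have "\<phi> \<in> hom (free_product_vars G m) G"
  proof (rule homI)
    fix W assume "W \<in> carrier (free_product_vars G m)"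
    then obtain u where "u \<in> fp_words G m" "W = fp_class G m u" unfolding car by blast
    then show "\<phi> W \<in> carrier G" using \<phi> fp_value_closed[of gs m u] gs by simp
  next
    fix W W' assume "W \<in> carrier (free_product_vars G m)" "W' \<in> carrier (free_product_vars G m)"
    then obtain u v where uv: "u \<in> fp_words G m" "W = fp_class G m u" "v \<in> fp_words G m" "W' = fp_class G m v"
      unfolding car by blast
    then have "u @ v \<in> fp_words G m" by (simp add: fp_words_append)
    then show "\<phi> (W \<otimes>\<^bsub>free_product_vars G m\<^esub> W') = \<phi> W \<otimes> \<phi> W'"
      using uv \<phi> gs by (simp add: fp_class_mult fp_value_append[of gs m u v])
  qed
  moreover have "\<forall>g\<in>carrier G. \<phi> (fp_class G m [Const g]) = g"
    by (simp add: \<phi> fp_words_Cons)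
  moreover have "\<phi> W = \<one>" if W: "W \<in> E" for W
  proof -
    obtain u where u: "u \<in> fp_words G m" "W = fp_class G m u" using W E unfolding car by blast
    then have "u \<in> W" using fp_class_self by simp
    then show ?thesis using \<phi>[OF u(1)] gs W u(2) by simp
  qed
  moreover have "gs = map (\<lambda>i. \<phi> (fp_class G m [Var i])) [0..<m]"
  proof (rule nth_equalityI)
    show "length gs = length (map (\<lambda>i. \<phi> (fp_class G m [Var i])) [0..<m])"
      using gs by (simp add: tuples_def)
    fix i assume "i < length gs"
    then have i: "i < m" using gs by (simp add: tuples_def)
    then have "gs ! i \<in> carrier G" using gs by (auto simp: tuples_def)
    then show "gs ! i = map (\<lambda>i. \<phi> (fp_class G m [Var i])) [0..<m] ! i"
      using i \<phi>[of "[Var i]"] by (simp add: fp_words_Cons)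
  qed
  ultimately show "gs \<in> equation_solutions G m E"
    unfolding equation_solutions_def by blast
qed

end

context va_group
begin

lemma agmap_fp_value:
  assumes "\<And>j. j < m \<Longrightarrow> agmap F (\<Phi> j)" "u \<in> fp_words G m"
  shows "agmap F (\<lambda>s. fp_value G (map (\<lambda>j. \<Phi> j s) [0..<m]) u)"
  using assms(2)
proof (induction u)
  case Nil
  show ?case by (simp add: agmap_const)
next
  case (Cons x u)
  have "agmap F (\<lambda>s. fp_letter_value G (map (\<lambda>j. \<Phi> j s) [0..<m]) x)"
    using Cons.prems assms(1) by (cases x) (auto simp: fp_words_Cons intro: agmap_const agmap_inv)
  then show ?case using Cons by (auto simp: fp_words_Cons intro!: agmap_mult)
qed

lemma agmap_tuples:
  assumes "\<And>j. j < m \<Longrightarrow> agmap F (\<Phi> j)"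
  shows "map (\<lambda>j. \<Phi> j s) [0..<m] \<in> tuples G m"
  using agmap_carrier[OF assms] by (auto simp: tuples_def)

text \<open>All representatives of a relator have the same value, so one of them suffices, and its
  value is an affine map of the parameters.\<close>

lemma presb_equations:
  assumes "finite_equation_system G m E" "\<And>j. j < m \<Longrightarrow> agmap F (\<Phi> j)"
  shows "presb F (\<lambda>s. map (\<lambda>j. \<Phi> j s) [0..<m] \<in> equation_solutions G m E)"
proof -
  have E: "E \<subseteq> carrier (free_product_vars G m)" "finite E"
    using assms(1) by (auto simp: finite_equation_system_def)
  have "\<forall>W\<in>E. \<exists>u. u \<in> fp_words G m \<and> W = fp_class G m u"
    using E(1) by (auto simp: free_product_vars_def)
  from bchoice[OF this] obtain rp where rp: "\<forall>W\<in>E. rp W \<in> fp_words G m \<and> W = fp_class G m (rp W)"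
    by (rule exE)
  have "map (\<lambda>j. \<Phi> j s) [0..<m] \<in> equation_solutions G m E \<longleftrightarrow>
      (\<forall>W\<in>E. fp_value G (map (\<lambda>j. \<Phi> j s) [0..<m]) (rp W) = \<one>)" (is "?gs \<in> _ \<longleftrightarrow> _") for s
  proof -
    have gs: "?gs \<in> tuples G m" using assms(2) by (rule agmap_tuples)
    have "(\<forall>u\<in>W. fp_value G ?gs u = \<one>) \<longleftrightarrow> fp_value G ?gs (rp W) = \<one>" if "W \<in> E" for W
    proof -
      have W: "rp W \<in> fp_words G m" "W = fp_class G m (rp W)" using rp that by auto
      have "fp_value G ?gs u = fp_value G ?gs (rp W)" if "u \<in> W" for u
      proof -
        have "u \<in> fp_class G m (rp W)" using that W(2) by simp
        then have "fp_equiv G m (rp W) u" by (simp add: fp_class_def)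
        from fp_equiv_value[OF this gs] show ?thesis by simp
      qed
      moreover have "rp W \<in> W" using fp_class_self[OF W(1)] W(2) by simp
      ultimately show ?thesis by metis
    qed
    then show ?thesis using equation_solutions_iff[OF E(1)] gs by simp
  qed
  moreover have "presb F (\<lambda>s. \<forall>W\<in>E. fp_value G (map (\<lambda>j. \<Phi> j s) [0..<m]) (rp W) = \<one>)"
    using E(2) rp assms(2) by (intro presb_ball presb_agmap_eq agmap_fp_value agmap_const) auto
  ultimately show ?thesis by simp
qed

text \<open>Constants of the quotient are lifted to \<open>G\<close>. An equation in the quotient
  then says that a word in \<open>G\<close> has its value in the derived subgroup, which
  \<open>presb_subgroup\<close> handles.\<close>

lemma presb_abelianisation:
  assumes K: "abelianisation_constraint G m K" and \<Phi>: "\<And>j. j < m \<Longrightarrow> agmap F (\<Phi> j)" and fin: "finite F"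
  shows "presb F (\<lambda>s. map (\<lambda>j. \<Phi> j s) [0..<m] \<in> K)"
proof -
  define D where "D = derived G (carrier G)"
  define Q where "Q = abelianisation G"
  have Q: "Q = G Mod D" by (simp add: Q_def D_def abelianisation_def)
  interpret D: normal D G unfolding D_def by (rule derived_self_is_normal)
  interpret Q: group Q unfolding Q by (rule D.factorgroup_is_group)
  interpret h: group_hom G Q "\<lambda>g. D #> g"
    by unfold_locales (simp add: Q D.r_coset_hom_Mod)
  have Qcar: "carrier Q = (\<lambda>g. D #> g) ` carrier G"
    unfolding Q FactGroup_def RCOSETS_def by auto
  have Qone: "\<one>\<^bsub>Q\<^esub> = D" by (simp add: Q FactGroup_def)
  obtain E where E: "finite_equation_system Q m E"
    and K: "K = {gs \<in> tuples G m. map (\<lambda>g. D #> g) gs \<in> equation_solutions Q m E}"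
    using K unfolding abelianisation_constraint_def Q_def D_def by blast
  have E': "E \<subseteq> carrier (free_product_vars Q m)" "finite E"
    using E by (auto simp: finite_equation_system_def)
  have "\<forall>W\<in>E. \<exists>u. u \<in> fp_words Q m \<and> W = fp_class Q m u"
    using E'(1) by (auto simp: free_product_vars_def)
  from bchoice[OF this] obtain rp where rp: "\<forall>W\<in>E. rp W \<in> fp_words Q m \<and> W = fp_class Q m (rp W)"
    by (rule exE)
  have "\<forall>C\<in>carrier Q. \<exists>g. g \<in> carrier G \<and> D #> g = C" unfolding Qcar by auto
  from bchoice[OF this] obtain lft where lft: "\<forall>C\<in>carrier Q. lft C \<in> carrier G \<and> D #> lft C = C"
    by (rule exE)
  define lift :: "'a set fp_letter \<Rightarrow> 'a fp_letter" where
    "lift x = (case x of Const C \<Rightarrow> Const (lft C) | Var i \<Rightarrow> Var i | VarInv i \<Rightarrow> VarInv i)" for x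
  have lift_words: "map lift u \<in> fp_words G m" if "u \<in> fp_words Q m" for u
    using that lft by (induction u) (auto simp: fp_words_Cons lift_def)
  have "map (\<lambda>j. \<Phi> j s) [0..<m] \<in> K \<longleftrightarrow>
      (\<forall>W\<in>E. fp_value G (map (\<lambda>j. \<Phi> j s) [0..<m]) (map lift (rp W)) \<in> D)" (is "?gs \<in> _ \<longleftrightarrow> _") for s
  proof -
    have gs: "?gs \<in> tuples G m" using \<Phi> by (rule agmap_tuples)
    let ?hs = "map (\<lambda>g. D #> g) ?gs"
    have hs: "?hs \<in> tuples Q m" using gs by (auto simp: tuples_def Qcar)
    have "(\<forall>u\<in>W. fp_value Q ?hs u = \<one>\<^bsub>Q\<^esub>) \<longleftrightarrow> fp_value G ?gs (map lift (rp W)) \<in> D" if "W \<in> E" for W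
    proof -
      have W: "rp W \<in> fp_words Q m" "W = fp_class Q m (rp W)" using rp that by auto
      have "fp_value Q ?hs u = fp_value Q ?hs (rp W)" if "u \<in> W" for u
      proof -
        have "u \<in> fp_class Q m (rp W)" using that W(2) by simp
        then have "fp_equiv Q m (rp W) u" by (simp add: fp_class_def)
        from Q.fp_equiv_value[OF this hs] show ?thesis by simp
      qed
      moreover have "rp W \<in> W" using Q.fp_class_self[OF W(1)] W(2) by simp
      ultimately have "(\<forall>u\<in>W. fp_value Q ?hs u = \<one>\<^bsub>Q\<^esub>) \<longleftrightarrow> fp_value Q ?hs (rp W) = \<one>\<^bsub>Q\<^esub>"
        by metis
      also have "fp_value Q ?hs (rp W) = D #> fp_value G ?gs (map lift (rp W))"
      proof -
        have "D #> fp_value G ?gs (map lift (rp W))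
            = word_value Q (\<lambda>x. D #> fp_letter_value G ?gs x) (map lift (rp W))"
          using fp_letter_value_closed[OF gs lift_words[OF W(1)]] by (intro h.hom_word_value) auto
        also have "\<dots> = fp_value Q ?hs (rp W)"
          unfolding word_value_map
        proof (rule word_value_cong)
          fix x assume "x \<in> set (rp W)"
          then have x: "x \<in> Const ` carrier Q \<union> Var ` {..<m} \<union> VarInv ` {..<m}"
            using W(1) unfolding fp_words_def in_lists_conv_set by blast
          have "j < m \<Longrightarrow> ?gs ! j \<in> carrier G" for j using gs by (auto simp: tuples_def)
          then show "D #> fp_letter_value G ?gs (lift x) = fp_letter_value Q ?hs x"
            using x lft by (auto simp: lift_def)
        qed
        finally show ?thesis by simp
      qed
      also have "(D #> fp_value G ?gs (map lift (rp W)) = \<one>\<^bsub>Q\<^esub>) \<longleftrightarrow> fp_value G ?gs (map lift (rp W)) \<in> D"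
        using fp_value_closed[OF gs lift_words[OF W(1)]] coset_join1 coset_join2 D.subgroup_axioms Qone
        by metis
      finally show ?thesis .
    qed
    then show ?thesis using Q.equation_solutions_iff[OF E'(1)] gs hs by (simp add: K)
  qed
  moreover have "presb F (\<lambda>s. \<forall>W\<in>E. fp_value G (map (\<lambda>j. \<Phi> j s) [0..<m]) (map lift (rp W)) \<in> D)"
    using E'(2) rp \<Phi> lift_words fin
    by (intro presb_ball presb_subgroup agmap_fp_value D.subgroup_axioms) auto
  ultimately show ?thesis by simp
qed

end

section \<open>Loop templates and word weights\<close>

lemma word_weight_Nil [simp]: "word_weight \<omega> [] = 0"
  and word_weight_Cons [simp]: "word_weight \<omega> (a # w) = \<omega> a + word_weight \<omega> w"
  and word_weight_append [simp]: "word_weight \<omega> (u @ v) = word_weight \<omega> u + word_weight \<omega> v"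
  by (simp_all add: word_weight_def)

lemma word_weight_power: "word_weight \<omega> (word_power k w) = k * word_weight \<omega> w"
  by (induction k) auto

lemma set_expand:
  "set (expand c x tpl) \<subseteq> {a. Inl a \<in> set tpl} \<union> (\<Union>v\<in>{v. Inr v \<in> set tpl}. set (c v))"
proof (induction tpl)
  case (Cons y tpl)
  show ?case
  proof (cases y)
    case (Inl a)
    then show ?thesis using Cons by auto
  next
    case (Inr v)
    then show ?thesis using Cons set_word_power[of "x v" "c v"] by auto
  qed
qed simp

lemma lin_weight_expand:
  assumes "\<And>v. Inr v \<in> set tpl \<Longrightarrow> (\<lambda>s. int (h s v)) \<in> lin F"
  shows "(\<lambda>s. int (word_weight \<omega> (expand c (h s) tpl))) \<in> lin F"
  using assms
proof (induction tpl)
  case (Cons y tpl)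
  have IH: "(\<lambda>s. int (word_weight \<omega> (expand c (h s) tpl))) \<in> lin F" using Cons by simp
  show ?case
  proof (cases y)
    case (Inl a)
    then show ?thesis using IH by (auto intro!: lin_intros)
  next
    case (Inr v)
    have "(\<lambda>s. int (h s v)) \<in> lin F" using Cons.prems Inr by simp
    then show ?thesis using IH Inr by (auto simp: word_weight_power intro!: lin_intros)
  qed
qed (simp add: lin_const)

lemma word_weight_expand_increment:
  fixes tpl :: "('x + 'v) list"
  shows "word_weight \<omega> (expand c (x(v := Suc (x v))) tpl)
    = word_weight \<omega> (expand c x tpl) + count_list tpl (Inr v) * word_weight \<omega> (c v)"
proof (induction tpl)
  case (Cons y tpl)
  then show ?case by (cases y) (auto simp: word_weight_power)
qed simp

text \<open>Among \<open>N\<close> consecutive windows of length \<open>N\<close>, one visits no new state.\<close>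

lemma window_repetition:
  fixes p :: "nat \<Rightarrow> 'q"
  assumes fin: "finite Q" and p: "\<And>i. p i \<in> Q"
  defines "N \<equiv> card Q"
  shows "\<exists>i j. i < j \<and> j \<le> N * N \<and> j - i \<le> N \<and> p i = p j \<and> (\<forall>k. i < k \<and> k \<le> j \<longrightarrow> p k \<in> p ` {..i})"
proof -
  have "\<exists>k<N. p ` {k * N..k * N + N} \<subseteq> p ` {..k * N}"
  proof (rule ccontr)
    assume neg: "\<not> ?thesis"
    \<comment> \<open>If every window met a new state, \<open>N\<close> windows together with the
      starting state would give \<open>N + 1\<close> states.\<close>
    have "k \<le> N \<Longrightarrow> Suc k \<le> card (p ` {..k * N})" for k
    proof (induction k)
      case (Suc k)
      then have "\<not> p ` {k * N..k * N + N} \<subseteq> p ` {..k * N}" using neg Suc_le_lessD by blast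
      then obtain j where j: "j \<in> {k * N..k * N + N}" "p j \<notin> p ` {..k * N}"
        unfolding image_subset_iff by blast
      have "insert (p j) (p ` {..k * N}) \<subseteq> p ` {..Suc k * N}" using j by auto
      then have "card (insert (p j) (p ` {..k * N})) \<le> card (p ` {..Suc k * N})"
        by (intro card_mono) auto
      then show ?case using Suc j(2) by simp
    qed simp
    from this[of N] have "Suc N \<le> card (p ` {..N * N})" by simp
    also have "\<dots> \<le> card Q" using fin p by (intro card_mono) auto
    finally show False by (simp add: N_def)
  qed
  then obtain k where k: "k < N" "p ` {k * N..k * N + N} \<subseteq> p ` {..k * N}" by blast
  \<comment> \<open>A window has \<open>N + 1\<close> positions but at most \<open>N\<close> states,
    so a state repeats inside it. All states of this window have already occurred at its first
    position or before.\<close>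
  have "card (p ` {k * N..k * N + N}) \<le> card Q" using fin p by (intro card_mono) auto
  then have "\<not> inj_on p {k * N..k * N + N}" using card_image[of p "{k * N..k * N + N}"] by (auto simp: N_def)
  then obtain i j where ij: "i \<in> {k * N..k * N + N}" "j \<in> {k * N..k * N + N}" "i < j" "p i = p j"
    unfolding inj_on_def by (metis linorder_neqE_nat)
  have "k * N + N \<le> N * N" using k(1) by (metis Suc_leI add.commute mult_Suc mult_le_mono1)
  moreover have "p l \<in> p ` {..i}" if "i < l" "l \<le> j" for l
  proof -
    have "p l \<in> p ` {..k * N}" using that ij k(2) by (auto simp: image_subset_iff)
    then show ?thesis using ij(1) by auto
  qed
  ultimately show ?thesis using ij by (intro exI[of _ i] exI[of _ j]) auto
qed

text \<open>The skeleton \<open>u\<close> with, at every position \<open>i\<close>, a power \<open>x (i, c)\<close> of every loop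
  \<open>c\<close>; the first position has index \<open>i\<close>.\<close>

definition loops_at :: "'x list list \<Rightarrow> nat \<Rightarrow> ('x + nat \<times> 'x list) list" where
  "loops_at cs i = map (\<lambda>c. Inr (i, c)) cs"

fun loop_template :: "'x list list \<Rightarrow> nat \<Rightarrow> 'x list \<Rightarrow> ('x + nat \<times> 'x list) list" where
  "loop_template cs i [] = loops_at cs i"
| "loop_template cs i (s # u) = loops_at cs i @ Inl s # loop_template cs (Suc i) u"

lemma Inr_loops_at: "Inr (j, c) \<in> set (loops_at cs i) \<longleftrightarrow> j = i \<and> c \<in> set cs"
  and Inl_loops_at: "Inl s \<notin> set (loops_at cs i)"
  by (auto simp: loops_at_def)

lemma Inr_loop_template:
  "Inr (j, c) \<in> set (loop_template cs i u) \<longleftrightarrow> i \<le> j \<and> j \<le> i + length u \<and> c \<in> set cs"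
proof (induction u arbitrary: i)
  case (Cons s u)
  show ?case unfolding loop_template.simps set_append set_simps Un_iff insert_iff Inr_loops_at Cons
    by (simp, linarith)
qed (auto simp: Inr_loops_at)

lemma Inl_loop_template: "Inl s \<in> set (loop_template cs i u) \<longleftrightarrow> s \<in> set u"
  by (induction u arbitrary: i) (auto simp: Inl_loops_at)

lemma count_loops_at:
  "distinct cs \<Longrightarrow> count_list (loops_at cs i) (Inr (j, c)) = (if j = i \<and> c \<in> set cs then 1 else 0)"
  unfolding loops_at_def by (induction cs) auto

lemma count_loop_template:
  "distinct cs \<Longrightarrow> c \<in> set cs \<Longrightarrow> i \<le> j \<Longrightarrow> j \<le> i + length u \<Longrightarrow>
    count_list (loop_template cs i u) (Inr (j, c)) = 1"
proof (induction u arbitrary: i)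
  case (Cons s u)
  show ?case
  proof (cases "j = i")
    case True
    have "Inr (j, c) \<notin> set (loop_template cs (Suc i) u)" using True by (simp add: Inr_loop_template)
    then show ?thesis using Cons.prems True by (simp add: count_loops_at count_list_0_iff)
  next
    case False
    then show ?thesis using Cons by (simp add: count_loops_at)
  qed
qed (simp add: count_loops_at)

lemma expand_loop_template_zero: "expand c (\<lambda>v. 0) (loop_template cs i u) = u"
proof (induction u arbitrary: i)
  have "expand c (\<lambda>v. 0) (loops_at cs i) = []" for i
    unfolding loops_at_def by (induction cs) auto
  note z = this
  case Nil
  show ?case using z by simp
  case (Cons s u)
  have "expand c (\<lambda>v. 0) (loops_at cs i) = []" for i
    unfolding loops_at_def by (induction cs) auto
  then show ?case using Cons by simp
qed

context va_group
begin

section \<open>Values of templates with loops\<close>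

definition loop_word :: "('x \<Rightarrow> 'a) \<Rightarrow> 'x list \<Rightarrow> bool" where
  "loop_word ev c \<longleftrightarrow> (\<forall>x\<in>set c. ev x \<in> carrier G) \<and> word_value G ev c \<in> A"

definition valid_template :: "('x \<Rightarrow> 'a) \<Rightarrow> ('v \<Rightarrow> 'x list) \<Rightarrow> ('x + 'v) list \<Rightarrow> bool" where
  "valid_template ev c tpl \<longleftrightarrow>
     (\<forall>a. Inl a \<in> set tpl \<longrightarrow> ev a \<in> carrier G) \<and> (\<forall>v. Inr v \<in> set tpl \<longrightarrow> loop_word ev (c v))"

lemma loop_word_power:
  assumes "loop_word ev c"
  shows "word_value G ev (word_power k c) = vec (\<lambda>i. int k * coord (word_value G ev c) i)"
proof (induction k)
  case (Suc k)
  have "word_value G ev (word_power (Suc k) c) = word_value G ev c \<otimes> word_value G ev (word_power k c)"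
    using assms set_word_power[of k c] by (auto simp: loop_word_def intro!: word_value_append)
  also have "\<dots> = vec (coord (word_value G ev c)) \<otimes> vec (\<lambda>i. int k * coord (word_value G ev c) i)"
    unfolding Suc using assms by (simp add: vec_coord loop_word_def)
  finally show ?case unfolding vec_add[symmetric] by (simp add: algebra_simps)
qed simp

lemma valid_template_letters:
  "valid_template ev c tpl \<Longrightarrow> a \<in> set (expand c x tpl) \<Longrightarrow> ev a \<in> carrier G"
  using set_expand[of c x tpl] by (auto simp: valid_template_def loop_word_def)

text \<open>The power of a loop is a multiple of a fixed vector of \<open>A\<close>, so exponents
  enter linearly and never change the coset.\<close>

lemma agmap_expand:
  assumes "valid_template ev c tpl" "\<And>v. Inr v \<in> set tpl \<Longrightarrow> (\<lambda>s. int (h s v)) \<in> lin F"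
  shows "agmap F (\<lambda>s. word_value G ev (expand c (h s) tpl))"
  using assms
proof (induction tpl)
  case Nil
  show ?case by (simp add: agmap_const)
next
  case (Cons y tpl)
  have v: "valid_template ev c tpl" using Cons.prems(1) by (simp add: valid_template_def)
  have IH: "agmap F (\<lambda>s. word_value G ev (expand c (h s) tpl))" using Cons v by simp
  show ?case
  proof (cases y)
    case (Inl a)
    then show ?thesis using IH Cons.prems(1) by (auto simp: valid_template_def intro!: agmap_mult agmap_const)
  next
    case (Inr v)
    have h: "(\<lambda>s. int (h s v)) \<in> lin F" using Cons.prems Inr by simp
    have cv: "loop_word ev (c v)" using Cons.prems(1) Inr by (simp add: valid_template_def)
    have "word_value G ev (expand c (h s) (y # tpl))
        = vec (\<lambda>i. int (h s v) * coord (word_value G ev (c v)) i) \<otimes> word_value G ev (expand c (h s) tpl)" for s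
    proof -
      have "word_value G ev (expand c (h s) (y # tpl))
        = word_value G ev (word_power (h s v) (c v)) \<otimes> word_value G ev (expand c (h s) tpl)"
        unfolding Inr expand_Inr
        using valid_template_letters[OF v] cv set_word_power[of "h s v" "c v"]
        by (intro word_value_append) (auto simp: loop_word_def)
      then show ?thesis by (simp only: loop_word_power[OF cv])
    qed
    moreover have "agmap F (\<lambda>s. vec (\<lambda>i. int (h s v) * coord (word_value G ev (c v)) i)
        \<otimes> word_value G ev (expand c (h s) tpl))"
      using h IH by (intro agmap_mult agmap_vec lin_intros)
    ultimately show ?thesis by simp
  qed
qed

lemma loops_at_value:
  assumes "\<And>c. c \<in> set cs \<Longrightarrow> loop_word ev c"
  shows "word_value G ev (expand snd x (loops_at cs i)) \<in> A"
  using assms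
proof (induction cs)
  case (Cons c cs)
  have valid: "valid_template ev snd (loops_at cs i)"
    using Cons.prems by (auto simp: valid_template_def loops_at_def)
  have c: "loop_word ev c" using Cons.prems by simp
  have "word_value G ev (word_power (x (i, c)) c @ expand snd x (loops_at cs i))
      = word_value G ev (word_power (x (i, c)) c) \<otimes> word_value G ev (expand snd x (loops_at cs i))"
    using valid_template_letters[OF valid] c set_word_power[of "x (i, c)" c]
    by (intro word_value_append) (auto simp: loop_word_def)
  also have "\<dots> \<in> A" using Cons loop_word_power[OF c] by (intro m_closed) auto
  finally show ?case by (simp add: loops_at_def)
qed (simp add: loops_at_def)

text \<open>Loops at the same position have values in \<open>A\<close> and commute, so the
  additional copy may be moved to the front.\<close>

lemma loops_at_increment:
  assumes "\<And>c. c \<in> set cs \<Longrightarrow> loop_word ev c" "distinct cs" "c \<in> set cs"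
  shows "word_value G ev (expand snd (x((i, c) := Suc (x (i, c)))) (loops_at cs i))
    = word_value G ev c \<otimes> word_value G ev (expand snd x (loops_at cs i))"
  using assms
proof (induction cs)
  case (Cons d cs)
  let ?x = "x((i, c) := Suc (x (i, c)))"
  have valid: "valid_template ev snd (loops_at cs i)"
    using Cons.prems by (auto simp: valid_template_def loops_at_def)
  have d: "loop_word ev d" and c: "loop_word ev c" using Cons.prems by auto
  have split: "word_value G ev (expand snd y (loops_at (d # cs) i))
      = word_value G ev (word_power (y (i, d)) d) \<otimes> word_value G ev (expand snd y (loops_at cs i))" for y
    unfolding loops_at_def list.map expand_Inr snd_conv
    using valid_template_letters[OF valid, unfolded loops_at_def] d set_word_power[of "y (i, d)" d]
    by (intro word_value_append) (auto simp: loop_word_def)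
  have A: "word_value G ev c \<in> A" "word_value G ev (expand snd x (loops_at cs i)) \<in> A"
    "word_value G ev (word_power k d) \<in> A" for k
    using c loops_at_value[of cs ev x i] Cons.prems loop_word_power[OF d] by (auto simp: loop_word_def)
  show ?case
  proof (cases "d = c")
    case True
    have "expand snd ?x (loops_at cs i) = expand snd x (loops_at cs i)"
      by (rule expand_cong) (use Cons.prems True in \<open>auto simp: loops_at_def\<close>)
    moreover have "word_value G ev (c @ word_power (x (i, c)) c)
        = word_value G ev c \<otimes> word_value G ev (word_power (x (i, c)) c)"
      using c set_word_power[of "x (i, c)" c] by (intro word_value_append) (auto simp: loop_word_def)
    ultimately show ?thesis unfolding split using True A A_carrier by (simp add: m_assoc)
  next
    case False
    then have "word_value G ev (expand snd ?x (loops_at cs i))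
      = word_value G ev c \<otimes> word_value G ev (expand snd x (loops_at cs i))"
      by (intro Cons.IH) (use Cons.prems in auto)
    then show ?thesis unfolding split using False A A_carrier by (simp add: A_left_comm)
  qed
qed simp

lemma valid_loop_template:
  assumes "\<And>c. c \<in> set cs \<Longrightarrow> loop_word ev c" "\<And>s. s \<in> set u \<Longrightarrow> ev s \<in> carrier G"
  shows "valid_template ev snd (loop_template cs i u)"
  using assms by (auto simp: valid_template_def Inr_loop_template Inl_loop_template)

text \<open>Pulled out to the front, the additional loop is conjugated by the skeleton before it.
  The conjugate lies in \<open>A\<close> and so passes the other inserted loops unchanged; hence
  only the skeleton prefix appears in the formula and not the exponents.\<close>

lemma loop_template_increment:
  assumes cs: "\<And>c. c \<in> set cs \<Longrightarrow> loop_word ev c" "distinct cs" "c \<in> set cs"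
    and "\<And>s. s \<in> set u \<Longrightarrow> ev s \<in> carrier G" "i \<le> k" "k \<le> i + length u"
  shows "word_value G ev (expand snd (x((k, c) := Suc (x (k, c)))) (loop_template cs i u))
    = word_value G ev (take (k - i) u) \<otimes> word_value G ev c \<otimes> inv (word_value G ev (take (k - i) u))
      \<otimes> word_value G ev (expand snd x (loop_template cs i u))"
  using assms(4-6)
proof (induction u arbitrary: i)
  case Nil
  then have k: "k = i" by simp
  have increment: "word_value G ev (expand snd (x((k, c) := Suc (x (k, c)))) (loop_template cs i []))
      = word_value G ev c \<otimes> word_value G ev (expand snd x (loop_template cs i []))"
    using loops_at_increment[OF cs(1,2,3), of x i] by (simp only: k loop_template.simps)
  show ?case
    by (subst increment)
      (use cs(1)[OF cs(3)] loops_at_value[of cs ev x i, OF cs(1)] A_carrier in \<open>simp add: loop_word_def\<close>)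
next
  case (Cons s u)
  let ?x = "x((k, c) := Suc (x (k, c)))"
  let ?v = "word_value G ev"
  let ?Z = "\<lambda>y. ?v (expand snd y (loops_at cs i))"
  let ?R = "\<lambda>y. ?v (expand snd y (loop_template cs (Suc i) u))"
  have s: "ev s \<in> carrier G" and u: "\<And>s. s \<in> set u \<Longrightarrow> ev s \<in> carrier G" using Cons.prems by auto
  have ZA: "?Z y \<in> A" for y using loops_at_value[OF cs(1)] .
  have validR: "valid_template ev snd (loop_template cs (Suc i) u)" using valid_loop_template[OF cs(1) u] .
  have validZ: "valid_template ev snd (loops_at cs i)" using valid_loop_template[of cs ev "[]" i] cs(1) by simp
  have Rc: "?R y \<in> carrier G" for y using valid_template_letters[OF validR] by (intro word_value_closed) auto
  have cA: "?v c \<in> A" using cs(1)[OF cs(3)] by (simp add: loop_word_def)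
  have split: "?v (expand snd y (loop_template cs i (s # u))) = ?Z y \<otimes> (ev s \<otimes> ?R y)" for y
  proof -
    have "?v (expand snd y (loops_at cs i) @ (s # expand snd y (loop_template cs (Suc i) u)))
      = ?Z y \<otimes> ?v (s # expand snd y (loop_template cs (Suc i) u))"
      using valid_template_letters[OF validR] valid_template_letters[OF validZ] s
      by (intro word_value_append) auto
    then show ?thesis by simp
  qed
  show ?case
  proof (cases "k = i")
    case True
    have "expand snd ?x (loop_template cs (Suc i) u) = expand snd x (loop_template cs (Suc i) u)"
      by (rule expand_cong) (auto simp: Inr_loop_template True)
    then show ?thesis
      unfolding split using True loops_at_increment[OF cs(1,2,3), of x i] ZA cA A_carrier Rc s
      by (simp add: m_assoc)
  next
    case False
    have Z: "?Z ?x = ?Z x"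
      by (intro arg_cong[where f = ?v] expand_cong) (auto simp: Inr_loops_at False)
    define P where "P = ?v (take (k - Suc i) u)"
    have Pc: "P \<in> carrier G" unfolding P_def using u by (intro word_value_closed) (auto dest: in_set_takeD)
    have take: "?v (take (k - i) (s # u)) = ev s \<otimes> P"
      using False Cons.prems by (simp add: P_def Suc_diff_le take_Cons' )
    have R: "?R ?x = P \<otimes> ?v c \<otimes> inv P \<otimes> ?R x"
      unfolding P_def using False Cons.prems u by (intro Cons.IH) auto
    let ?q = "(ev s \<otimes> P) \<otimes> ?v c \<otimes> inv (ev s \<otimes> P)"
    have qA: "?q \<in> A" using conj_A[of "ev s \<otimes> P" "?v c"] cA s Pc by simp
    have "?Z x \<otimes> (ev s \<otimes> (P \<otimes> ?v c \<otimes> inv P \<otimes> ?R x)) = ?Z x \<otimes> (?q \<otimes> (ev s \<otimes> ?R x))"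
      using s Pc cA A_carrier Rc by (simp add: m_assoc inv_mult_group flip: m_assoc[of "inv (ev s)"])
    also have "\<dots> = ?q \<otimes> (?Z x \<otimes> (ev s \<otimes> ?R x))"
      using ZA qA s Rc by (intro A_left_comm) auto
    finally show ?thesis unfolding split Z R take .
  qed
qed

end

section \<open>Skeletons of words and definability of weights\<close>

locale va_weighted = va_group G A bs T for G :: "('a, 'b) monoid_scheme" (structure) and A bs T +
  fixes \<Sigma> :: "'a set" and \<omega> :: "'a \<Rightarrow> nat"
  assumes gen: "finite_generating_set G \<Sigma>"
begin

abbreviation val :: "'a list \<Rightarrow> 'a" where "val \<equiv> word_value G id"

lemma finite_\<Sigma>: "finite \<Sigma>" and \<Sigma>_carrier: "s \<in> \<Sigma> \<Longrightarrow> s \<in> carrier G"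
  and ex_word: "g \<in> carrier G \<Longrightarrow> \<exists>w\<in>lists \<Sigma>. val w = g"
  using gen by (auto simp: finite_generating_set_def)

lemma val_closed: "w \<in> lists \<Sigma> \<Longrightarrow> val w \<in> carrier G"
  using \<Sigma>_carrier by (intro word_value_closed) auto

lemma val_append: "u \<in> lists \<Sigma> \<Longrightarrow> v \<in> lists \<Sigma> \<Longrightarrow> val (u @ v) = val u \<otimes> val v"
  using \<Sigma>_carrier by (intro word_value_append) auto

definition N where "N = card (rcosets A)"

definition loops where
  "loops = (SOME cs. distinct cs \<and> set cs = {c \<in> lists \<Sigma>. length c \<le> N \<and> val c \<in> A})"

lemma loops: "distinct loops" "set loops = {c \<in> lists \<Sigma>. length c \<le> N \<and> val c \<in> A}"
proof -
  have "finite {c. set c \<subseteq> \<Sigma> \<and> length c \<le> N}" using finite_\<Sigma> by (rule finite_lists_length_le)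
  then have "finite {c \<in> lists \<Sigma>. length c \<le> N \<and> val c \<in> A}"
    by (rule rev_finite_subset) (auto simp: lists_eq_set)
  from someI_ex[OF finite_distinct_list[OF this, unfolded conj_commute[of "set _ = _"]]]
  show "distinct loops" "set loops = {c \<in> lists \<Sigma>. length c \<le> N \<and> val c \<in> A}"
    unfolding loops_def by auto
qed

lemma loop_word_loops: "c \<in> set loops \<Longrightarrow> loop_word id c"
  using loops(2) \<Sigma>_carrier by (auto simp: loop_word_def)

definition visited :: "'a list \<Rightarrow> 'a set set" where
  "visited w = (\<lambda>i. A #> val (take i w)) ` {..length w}"

lemma coset_eq_iff:
  assumes "g \<in> carrier G" "h \<in> carrier G"
  shows "A #> g = A #> h \<longleftrightarrow> (\<exists>a\<in>A. h = a \<otimes> g)"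
proof
  assume "A #> g = A #> h"
  then have "h \<in> A #> g" using rcos_self[OF assms(2) subgroup_axioms] by simp
  then show "\<exists>a\<in>A. h = a \<otimes> g" by (auto simp: r_coset_def)
next
  assume "\<exists>a\<in>A. h = a \<otimes> g"
  then have "h \<in> A #> g" by (auto simp: r_coset_def)
  then show "A #> g = A #> h" using repr_independence[OF _ assms(1) subgroup_axioms] by blast
qed

text \<open>Two elements of a coset differ by a factor in \<open>A\<close>, which acts trivially on
  the abelian group \<open>A\<close>.\<close>

lemma conj_coset:
  assumes "g \<in> carrier G" "h \<in> carrier G" "A #> g = A #> h" "a \<in> A"
  shows "g \<otimes> a \<otimes> inv g = h \<otimes> a \<otimes> inv h"
proof -
  obtain b where b: "b \<in> A" "h = b \<otimes> g"
    using assms(3) unfolding coset_eq_iff[OF assms(1,2)] by blast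
  have q: "g \<otimes> a \<otimes> inv g \<in> A" using conj_A assms by blast
  have "h \<otimes> a \<otimes> inv h = b \<otimes> (g \<otimes> a \<otimes> inv g) \<otimes> inv b"
    unfolding b(2) using b assms A_carrier by (simp add: inv_mult_group m_assoc)
  also have "\<dots> = (g \<otimes> a \<otimes> inv g) \<otimes> (b \<otimes> inv b)"
    unfolding A_comm[OF b(1) q] using b q A_carrier by (simp add: m_assoc)
  finally show ?thesis using b q A_carrier by simp
qed

text \<open>\<open>window_repetition\<close> is applied to the walk of the prefixes through the
  cosets of \<open>A\<close>. Every coset met inside the part that is cut out has been met before
  it, so none is lost.\<close>

lemma removable_loop:
  assumes w: "w \<in> lists \<Sigma>" and len: "N * N \<le> length w"
  shows "\<exists>i j. i < j \<and> j \<le> length w \<and> j - i \<le> N \<and> A #> val (take i w) = A #> val (take j w) \<and>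
    visited (take i w @ drop j w) = visited w"
proof -
  let ?p = "\<lambda>i. A #> val (take i w)"
  have tk: "take i w \<in> lists \<Sigma>" for i using w by (auto dest: in_set_takeD)
  have dr: "drop i w \<in> lists \<Sigma>" for i using w by (auto dest: in_set_dropD)
  have p: "?p i \<in> rcosets A" for i using val_closed[OF tk] subset by (intro rcosetsI)
  obtain i j where ij: "i < j" "j \<le> N * N" "j - i \<le> N" "?p i = ?p j"
    "\<forall>k. i < k \<and> k \<le> j \<longrightarrow> ?p k \<in> ?p ` {..i}"
    using window_repetition[OF finite_rcosets, of ?p, OF p] unfolding N_def by blast
  let ?w = "take i w @ drop j w"
  have len_w: "length ?w = length w - (j - i)" using ij len by simp
  have 1: "A #> val (take k ?w) = ?p k" if "k \<le> i" for k
    using that ij len by simp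
  have 2: "A #> val (take (k - (j - i)) ?w) = ?p k" if "j \<le> k" for k
  proof -
    \<comment> \<open>Behind the cut all prefix values change by one left factor from
      \<open>A\<close>, which leaves their cosets alone.\<close>
    obtain a where a: "a \<in> A" "val (take j w) = a \<otimes> val (take i w)"
      using ij(4) unfolding coset_eq_iff[OF val_closed[OF tk] val_closed[OF tk]] by blast
    have dl: "take (k - j) (drop j w) \<in> lists \<Sigma>" using dr by (auto dest: in_set_takeD)
    have k: "k - (j - i) = i + (k - j)" using that ij by simp
    have "take (k - (j - i)) ?w = take i w @ take (k - j) (drop j w)"
      unfolding k using ij len by (simp add: min_def)
    then have v: "val (take (k - (j - i)) ?w) = val (take i w) \<otimes> val (take (k - j) (drop j w))"
      using val_append[OF tk dl] by simp
    have "take k w = take j w @ take (k - j) (drop j w)"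
      using that by (metis le_add_diff_inverse take_add)
    then have "val (take k w) = val (take j w) \<otimes> val (take (k - j) (drop j w))"
      using val_append[OF tk dl] by simp
    then have "val (take k w) = a \<otimes> val (take (k - (j - i)) ?w)"
      unfolding v a(2) using a(1) A_carrier val_closed[OF tk] val_closed[OF dl] by (simp add: m_assoc)
    moreover have "val (take (k - (j - i)) ?w) \<in> carrier G"
      unfolding v using val_closed[OF tk] val_closed[OF dl] by simp
    ultimately show ?thesis using coset_eq_iff[OF _ val_closed[OF tk]] a(1) by blast
  qed
  have "visited ?w = visited w"
  proof (intro equalityI subsetI)
    fix q assume "q \<in> visited ?w"
    then obtain k where k: "k \<le> length ?w" "q = A #> val (take k ?w)" by (auto simp: visited_def)
    show "q \<in> visited w"
    proof (cases "k \<le> i")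
      case True
      then show ?thesis using k 1 ij len by (auto simp: visited_def)
    next
      case False
      then have "q = ?p (k + (j - i))" using 2[of "k + (j - i)"] k ij by simp
      then show ?thesis using k len_w ij len by (auto simp: visited_def)
    qed
  next
    fix q assume "q \<in> visited w"
    then obtain k where k: "k \<le> length w" "q = ?p k" by (auto simp: visited_def)
    have early: "?p l \<in> visited ?w" if "l \<le> i" for l
      using 1[OF that] that ij len unfolding visited_def len_w by (intro image_eqI[of _ _ l]) auto
    consider "k \<le> i" | "i < k" "k \<le> j" | "j \<le> k" by linarith
    then show "q \<in> visited ?w"
    proof cases
      case 1
      then show ?thesis using early k by simp
    next
      case 2
      then have "?p k \<in> ?p ` {..i}" using ij(5) by simp
      then obtain l where "l \<le> i" "?p k = ?p l" by (elim imageE) simp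
      then show ?thesis using early[of l] k(2) by simp
    next
      case 3
      then show ?thesis using 2[OF 3] k ij len unfolding visited_def len_w
        by (intro image_eqI[of _ _ "k - (j - i)"]) auto
    qed
  qed
  then show ?thesis using ij len by (intro exI[of _ i] exI[of _ j]) auto
qed

text \<open>Loops are cut out one at a time and recorded as exponents. Equality of the sets
  \<open>visited\<close> is part of the claim because it guarantees a place for reinsertion. Letters
  are only moved, so the weight does not change.\<close>

lemma skeleton:
  assumes "w \<in> lists \<Sigma>"
  shows "\<exists>u x. u \<in> lists \<Sigma> \<and> length u \<le> N * N \<and> visited u = visited w \<and>
    val (expand snd x (loop_template loops 0 u)) = val w \<and>
    word_weight \<omega> (expand snd x (loop_template loops 0 u)) = word_weight \<omega> w"
  using assms
proof (induction "length w" arbitrary: w rule: less_induct)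
  case less
  show ?case
  proof (cases "length w \<le> N * N")
    case True
    then show ?thesis using less.prems
      by (intro exI[of _ w] exI[of _ "\<lambda>v. 0"]) (simp add: expand_loop_template_zero)
  next
    case False
    then obtain i j where ij: "i < j" "j \<le> length w" "j - i \<le> N"
      "A #> val (take i w) = A #> val (take j w)" "visited (take i w @ drop j w) = visited w"
      using removable_loop[OF less.prems] by auto
    define c where "c = take (j - i) (drop i w)"
    have l: "take i w \<in> lists \<Sigma>" "c \<in> lists \<Sigma>" "drop j w \<in> lists \<Sigma>" "take i w @ drop j w \<in> lists \<Sigma>"
      using less.prems by (auto simp: c_def dest: in_set_takeD in_set_dropD)
    have tj: "take j w = take i w @ c" unfolding c_def using ij by (simp add: take_add[symmetric])
    have w: "w = take i w @ c @ drop j w"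
      using tj by (metis append_assoc append_take_drop_id)
    have cA: "val c \<in> A"
    proof -
      obtain a where a: "a \<in> A" "val (take j w) = a \<otimes> val (take i w)"
        using ij(4) coset_eq_iff[OF val_closed val_closed] l(1) tj l(2) by (metis append_in_lists_conv)
      have "val (take i w) \<otimes> val c = a \<otimes> val (take i w)"
        using a(2) val_append[OF l(1,2)] tj by simp
      then have "val c = inv (val (take i w)) \<otimes> (a \<otimes> val (take i w))"
        using val_closed[OF l(1)] val_closed[OF l(2)] a(1) A_carrier by (simp add: inv_solve_left)
      then show ?thesis using inv_op_closed1[of "val (take i w)" a] a(1) val_closed[OF l(1)] A_carrier
        by (simp add: m_assoc)
    qed
    have c: "c \<in> set loops" using l(2) cA ij by (auto simp: loops(2) c_def)
    have "length (take i w @ drop j w) < length w" using ij by simp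
    from less.hyps[OF this l(4)] obtain u x where u: "u \<in> lists \<Sigma>" "length u \<le> N * N"
      "visited u = visited (take i w @ drop j w)"
      "val (expand snd x (loop_template loops 0 u)) = val (take i w @ drop j w)"
      "word_weight \<omega> (expand snd x (loop_template loops 0 u)) = word_weight \<omega> (take i w @ drop j w)"
      by (elim exE conjE)
    \<comment> \<open>The skeleton passes through the coset in which \<open>c\<close> was cut out;
      \<open>k\<close> is such a position.\<close>
    have "A #> val (take i w) \<in> visited w" using ij by (auto simp: visited_def)
    then have "A #> val (take i w) \<in> visited u" unfolding u(3) ij(5) .
    then obtain k where k: "k \<le> length u" "A #> val (take k u) = A #> val (take i w)"
      unfolding visited_def by auto
    have tk: "take k u \<in> lists \<Sigma>" using u(1) by (auto dest: in_set_takeD)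
    let ?x = "x((k, c) := Suc (x (k, c)))"
    \<comment> \<open>One more \<open>c\<close> at position \<open>k\<close> multiplies the value by
      a conjugate of \<open>c\<close>. By \<open>conj_coset\<close> this is the conjugate by
      \<open>take i w\<close>, the factor that the cut had removed.\<close>
    have "val (expand snd ?x (loop_template loops 0 u))
      = val (take (k - 0) u) \<otimes> val c \<otimes> inv (val (take (k - 0) u)) \<otimes> val (expand snd x (loop_template loops 0 u))"
      using u(1) \<Sigma>_carrier k by (intro loop_template_increment loop_word_loops loops c) auto
    also have "val (take (k - 0) u) \<otimes> val c \<otimes> inv (val (take (k - 0) u))
       = val (take i w) \<otimes> val c \<otimes> inv (val (take i w))"
      using conj_coset[OF val_closed[OF tk] val_closed[OF l(1)] k(2) cA] by simp
    also have "val (take i w) \<otimes> val c \<otimes> inv (val (take i w)) \<otimes> val (expand snd x (loop_template loops 0 u))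
       = val (take i w) \<otimes> val c \<otimes> val (drop j w)"
      unfolding u(4) val_append[OF l(1,3)]
      using val_closed[OF l(1)] val_closed[OF l(2)] val_closed[OF l(3)]
      by (simp add: m_assoc flip: m_assoc[of "inv (val (take i w))"])
    also have "\<dots> = val w"
      using val_append[OF l(1), of "c @ drop j w"] val_append[OF l(2,3)] l w
        val_closed[OF l(1)] val_closed[OF l(2)] val_closed[OF l(3)]
      by (metis append_in_lists_conv m_assoc)
    finally have "val (expand snd ?x (loop_template loops 0 u)) = val w" .
    moreover have "word_weight \<omega> (expand snd ?x (loop_template loops 0 u)) = word_weight \<omega> w"
    proof -
      have "count_list (loop_template loops 0 u) (Inr (k, c)) = 1"
        using count_loop_template[OF loops(1) c, of 0 k u] k(1) by simp
      then have "word_weight \<omega> (expand snd ?x (loop_template loops 0 u))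
          = word_weight \<omega> (take i w @ drop j w) + word_weight \<omega> c"
        by (simp add: word_weight_expand_increment u(5))
      also have "\<dots> = word_weight \<omega> (take i w @ c @ drop j w)" by simp
      finally show ?thesis unfolding w[symmetric] .
    qed
    ultimately show ?thesis using u(1,2,3) ij(5) by blast
  qed
qed

definition patterns where
  "patterns = loop_template loops 0 ` {u \<in> lists \<Sigma>. length u \<le> N * N}"

lemma finite_patterns: "finite patterns"
proof -
  have "finite {c. set c \<subseteq> \<Sigma> \<and> length c \<le> N * N}" using finite_\<Sigma> by (rule finite_lists_length_le)
  then show ?thesis unfolding patterns_def
    by (intro finite_imageI) (rule rev_finite_subset, auto simp: lists_eq_set)
qed

lemma valid_patterns: "tpl \<in> patterns \<Longrightarrow> valid_template id snd tpl"
  unfolding patterns_def using \<Sigma>_carrier by (auto intro!: valid_loop_template loop_word_loops)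

lemma patterns_letters:
  assumes "tpl \<in> patterns"
  shows "tpl \<in> lists (Inl ` \<Sigma> \<union> Inr ` {v. snd v \<in> lists \<Sigma>})" "expand snd x tpl \<in> lists \<Sigma>"
proof -
  obtain u where u: "u \<in> lists \<Sigma>" "tpl = loop_template loops 0 u"
    using assms by (auto simp: patterns_def)
  have Inl: "a \<in> \<Sigma>" if "Inl a \<in> set tpl" for a
    using that u by (auto simp: Inl_loop_template)
  have Inr: "snd v \<in> lists \<Sigma>" if "Inr v \<in> set tpl" for v
    using that u loops(2) by (cases v) (auto simp: Inr_loop_template)
  have "y \<in> Inl ` \<Sigma> \<union> Inr ` {v. snd v \<in> lists \<Sigma>}" if "y \<in> set tpl" for y
  proof (cases y)
    case (Inl a)
    then show ?thesis using that \<open>\<And>a. Inl a \<in> set tpl \<Longrightarrow> a \<in> \<Sigma>\<close>[of a] by simp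
  next
    case (Inr v)
    then show ?thesis using that \<open>\<And>v. Inr v \<in> set tpl \<Longrightarrow> snd v \<in> lists \<Sigma>\<close>[of v] by simp
  qed
  then show "tpl \<in> lists (Inl ` \<Sigma> \<union> Inr ` {v. snd v \<in> lists \<Sigma>})" by blast
  show "expand snd x tpl \<in> lists \<Sigma>" using set_expand[of snd x tpl] Inl Inr by fastforce
qed

lemma weight_attained:
  assumes "g \<in> carrier G"
  shows "\<exists>w\<in>lists \<Sigma>. val w = g \<and> word_weight \<omega> w = weight G \<Sigma> \<omega> g"
proof -
  obtain w where "w \<in> lists \<Sigma>" "val w = g" using ex_word[OF assms] by blast
  then have "\<exists>n. \<exists>w\<in>lists \<Sigma>. val w = g \<and> word_weight \<omega> w = n" by blast
  from LeastI_ex[OF this] show ?thesis unfolding weight_def .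
qed

lemma weight_le: "w \<in> lists \<Sigma> \<Longrightarrow> weight G \<Sigma> \<omega> (val w) \<le> word_weight \<omega> w"
  unfolding weight_def by (rule Least_le) blast

lemma weight_pattern:
  assumes "g \<in> carrier G"
  shows "\<exists>tpl\<in>patterns. \<exists>x. val (expand snd x tpl) = g \<and> word_weight \<omega> (expand snd x tpl) = weight G \<Sigma> \<omega> g"
proof -
  obtain w where w: "w \<in> lists \<Sigma>" "val w = g" "word_weight \<omega> w = weight G \<Sigma> \<omega> g"
    using weight_attained[OF assms] by blast
  from skeleton[OF w(1)] show ?thesis unfolding w patterns_def by blast
qed

text \<open>The weight is a minimum over all words, but an upper bound on it is an existential
  statement, and by \<open>weight_pattern\<close> it is enough to search the finitely many patterns.
  Equality then follows from two such bounds.\<close>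

lemma presb_weight_le:
  assumes \<Phi>: "agmap F \<Phi>" and f: "f \<in> lin F" and fin: "finite F"
  shows "presb F (\<lambda>s. int (weight G \<Sigma> \<omega> (\<Phi> s)) \<le> f s)"
proof -
  let ?P = "\<lambda>tpl y. val (expand snd (snd y) tpl) = \<Phi> (fst y) \<and> int (word_weight \<omega> (expand snd (snd y) tpl)) \<le> f (fst y)"
  have "int (weight G \<Sigma> \<omega> (\<Phi> s)) \<le> f s \<longleftrightarrow> (\<exists>tpl\<in>patterns. \<exists>x. ?P tpl (s, x))" for s
  proof
    assume "int (weight G \<Sigma> \<omega> (\<Phi> s)) \<le> f s"
    then show "\<exists>tpl\<in>patterns. \<exists>x. ?P tpl (s, x)"
      using weight_pattern[OF agmap_carrier[OF \<Phi>], of s] by force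
  next
    assume "\<exists>tpl\<in>patterns. \<exists>x. ?P tpl (s, x)"
    then obtain tpl x where x: "tpl \<in> patterns" "?P tpl (s, x)" by blast
    then show "int (weight G \<Sigma> \<omega> (\<Phi> s)) \<le> f s"
      using weight_le[OF patterns_letters(2)[OF x(1)], of x] by simp
  qed
  moreover have "presb F (\<lambda>s. \<exists>x. ?P tpl (s, x))" if tpl: "tpl \<in> patterns" for tpl
  proof (rule presb_ex_nat[OF _ fin])
    let ?V = "{v. Inr v \<in> set tpl}"
    show "finite ?V" using finite_vimageI[of "set tpl" Inr] by (simp add: vimage_def)
    have snd: "(\<lambda>y. int (snd y v)) \<in> lin (pairvars F ?V)" if "Inr v \<in> set tpl" for v
      using that by (intro lin_pairvars_snd) simp
    show "presb (pairvars F ?V) (?P tpl)"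
    proof (intro presb_conj presb_agmap_eq presb_le)
      show "agmap (pairvars F ?V) (\<lambda>y. val (expand snd (snd y) tpl))"
        by (rule agmap_expand[OF valid_patterns[OF tpl] snd])
      show "agmap (pairvars F ?V) (\<lambda>y. \<Phi> (fst y))"
        by (rule agmap_subst[OF \<Phi>]) (rule lin_pairvars_fst[OF lin_base])
      show "(\<lambda>y. int (word_weight \<omega> (expand snd (snd y) tpl))) \<in> lin (pairvars F ?V)"
        by (rule lin_weight_expand[OF snd])
    qed (rule lin_pairvars_fst[OF f])
  qed
  ultimately show ?thesis using finite_patterns by (simp only:) (rule presb_bex)
qed

lemma presb_weight_eq:
  assumes \<Phi>: "agmap F \<Phi>" and f: "f \<in> lin F" and fin: "finite F"
  shows "presb F (\<lambda>s. int (weight G \<Sigma> \<omega> (\<Phi> s)) = f s)"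
proof -
  have "(\<lambda>s. f s - 1) \<in> lin F" using f by (intro lin_intros)
  with assms have "presb F (\<lambda>s. int (weight G \<Sigma> \<omega> (\<Phi> s)) \<le> f s \<and> \<not> int (weight G \<Sigma> \<omega> (\<Phi> s)) \<le> f s - 1)"
    by (intro presb_conj presb_not presb_weight_le)
  moreover have "(int (weight G \<Sigma> \<omega> (\<Phi> s)) \<le> f s \<and> \<not> int (weight G \<Sigma> \<omega> (\<Phi> s)) \<le> f s - 1)
      \<longleftrightarrow> int (weight G \<Sigma> \<omega> (\<Phi> s)) = f s" for s by linarith
  ultimately show ?thesis by simp
qed

end

context va_group
begin

lemma presb_linear_length:
  assumes K: "linear_length_constraint G m K" and \<Phi>: "\<And>j. j < m \<Longrightarrow> agmap F (\<Phi> j)" and fin: "finite F"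
  shows "presb F (\<lambda>s. map (\<lambda>j. \<Phi> j s) [0..<m] \<in> K)"
proof -
  obtain \<Sigma> \<omega> conds where gen: "weighted_generating_set G \<Sigma> \<omega>" and conds: "finite conds"
    and K: "K = {gs \<in> tuples G m. \<forall>c\<in>conds. satisfies_linear m (\<lambda>i. int (weight G \<Sigma> \<omega> (gs ! i))) c}"
    using K unfolding linear_length_constraint_def by blast
  \<comment> \<open>Each length constraint brings its own generating set and weights; the
    coordinates stay those of \<open>A\<close>.\<close>
  interpret va_weighted G A bs T \<Sigma> \<omega>
    using gen by unfold_locales (simp add: weighted_generating_set_def)
  have cong: "satisfies_linear m x c \<longleftrightarrow> satisfies_linear m y c" if "\<And>i. i < m \<Longrightarrow> x i = y i" for x y c
    using that by (cases c) auto
  \<comment> \<open>Weights are not affine in \<open>s\<close>, so they are named by existentially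
    quantified naturals, in which the conditions are linear.\<close>
  let ?P = "\<lambda>y. (\<forall>j\<in>{..<m}. int (weight G \<Sigma> \<omega> (\<Phi> j (fst y))) = int (snd y j)) \<and>
     (\<forall>c\<in>conds. satisfies_linear m (\<lambda>i. int (snd y i)) c)"
  have "map (\<lambda>j. \<Phi> j s) [0..<m] \<in> K \<longleftrightarrow> (\<exists>k. ?P (s, k))" for s
  proof
    assume "map (\<lambda>j. \<Phi> j s) [0..<m] \<in> K"
    then have "\<forall>c\<in>conds. satisfies_linear m (\<lambda>i. int (weight G \<Sigma> \<omega> (map (\<lambda>j. \<Phi> j s) [0..<m] ! i))) c"
      by (simp add: K)
    then have "\<forall>c\<in>conds. satisfies_linear m (\<lambda>i. int (weight G \<Sigma> \<omega> (\<Phi> i s))) c"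
      using cong[of "\<lambda>i. int (weight G \<Sigma> \<omega> (map (\<lambda>j. \<Phi> j s) [0..<m] ! i))" "\<lambda>i. int (weight G \<Sigma> \<omega> (\<Phi> i s))"]
      by simp
    then show "\<exists>k. ?P (s, k)" by (intro exI[of _ "\<lambda>j. weight G \<Sigma> \<omega> (\<Phi> j s)"]) simp
  next
    assume "\<exists>k. ?P (s, k)"
    then obtain k where k: "?P (s, k)" by (rule exE)
    then have "\<forall>c\<in>conds. satisfies_linear m (\<lambda>i. int (weight G \<Sigma> \<omega> (map (\<lambda>j. \<Phi> j s) [0..<m] ! i))) c"
      using cong[of "\<lambda>i. int (weight G \<Sigma> \<omega> (map (\<lambda>j. \<Phi> j s) [0..<m] ! i))" "\<lambda>i. int (k i)"] by simp
    then show "map (\<lambda>j. \<Phi> j s) [0..<m] \<in> K" using agmap_tuples[OF \<Phi>] by (simp add: K)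
  qed
  moreover have "presb F (\<lambda>s. \<exists>k. ?P (s, k))"
  proof (rule presb_ex_nat[OF _ fin])
    show "finite {..<m}" by simp
    have snd: "(\<lambda>y. int (snd y j)) \<in> lin (pairvars F {..<m})" if "j < m" for j
      using that by (intro lin_pairvars_snd) simp
    have \<Phi>': "agmap (pairvars F {..<m}) (\<lambda>y. \<Phi> j (fst y))" if "j < m" for j
      by (rule agmap_subst[OF \<Phi>[OF that]]) (rule lin_pairvars_fst[OF lin_base])
    have fin': "finite (pairvars F {..<m})" using fin by (intro finite_pairvars) auto
    have "presb (pairvars F {..<m}) (\<lambda>y. satisfies_linear m (\<lambda>i. int (snd y i)) c)" for c
    proof (cases c)
      case (LinEq \<alpha> \<beta>)
      then show ?thesis by (simp, intro presb_eq lin_intros snd) simp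
    next
      case (LinLe \<alpha> \<beta>)
      then show ?thesis by (simp, intro presb_le lin_intros snd) simp
    qed
    then show "presb (pairvars F {..<m}) ?P"
      using conds snd \<Phi>' fin' by (intro presb_conj presb_ball presb_weight_eq) auto
  qed
  ultimately show ?thesis by simp
qed

end

section \<open>Context-free constraints\<close>

context va_group
begin

text \<open>A transducer with state set \<open>T\<close>: reading \<open>x\<close> in state
  \<open>q\<close> leads to the state \<open>tr q x\<close> and emits the vector
  \<open>dl q x\<close>.\<close>

definition tr :: "'a \<Rightarrow> 'a \<Rightarrow> 'a" where
  "tr q x = (SOME t. t \<in> T \<and> q \<otimes> x \<otimes> inv t \<in> A)"

definition dl :: "'a \<Rightarrow> 'a \<Rightarrow> nat \<Rightarrow> int" where
  "dl q x = coord (q \<otimes> x \<otimes> inv (tr q x))"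

lemma tr_dl:
  assumes "q \<in> carrier G" "x \<in> carrier G"
  shows "tr q x \<in> T" "q \<otimes> x = vec (dl q x) \<otimes> tr q x"
proof -
  obtain a t where a: "a \<in> A" "t \<in> T" "q \<otimes> x = a \<otimes> t" using ex_transversal[of "q \<otimes> x"] assms by auto
  then have "q \<otimes> x \<otimes> inv t = a" using A_carrier T_carrier by (simp add: m_assoc)
  then have "\<exists>t. t \<in> T \<and> q \<otimes> x \<otimes> inv t \<in> A" using a by auto
  from someI_ex[OF this] have tr: "tr q x \<in> T" "q \<otimes> x \<otimes> inv (tr q x) \<in> A" unfolding tr_def by auto
  then show "tr q x \<in> T" "q \<otimes> x = vec (dl q x) \<otimes> tr q x"
    using assms T_carrier by (simp_all add: dl_def vec_coord m_assoc)
qed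

text \<open>Annotating sentential forms with cosets as states makes the contributions of all letters
  elements of the abelian group \<open>A\<close>. So the order of symbols no longer matters: only the multiset
  of annotated nonterminals and the total contribution are kept.\<close>

inductive annot ::
    "'a \<Rightarrow> (nat + 'a) list \<Rightarrow> 'a \<Rightarrow> ('a \<times> nat \<times> 'a) multiset \<Rightarrow> (nat \<Rightarrow> int) \<Rightarrow> bool" where
  annot_Nil: "q \<in> T \<Longrightarrow> annot q [] q {#} (\<lambda>i. 0)"
| annot_Inr: "q \<in> T \<Longrightarrow> x \<in> carrier G \<Longrightarrow> annot (tr q x) \<gamma> q' M a \<Longrightarrow>
    annot q (Inr x # \<gamma>) q' M (\<lambda>i. dl q x i + a i)"
| annot_Inl: "q \<in> T \<Longrightarrow> annot p \<gamma> q' M a \<Longrightarrow> annot q (Inl B # \<gamma>) q' (add_mset (q, B, p) M) a"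

inductive_cases annot_NilE: "annot q [] q' M a"
inductive_cases annot_InrE: "annot q (Inr x # \<gamma>) q' M a"
inductive_cases annot_InlE: "annot q (Inl B # \<gamma>) q' M a"

lemma annot_T: "annot q \<gamma> q' M a \<Longrightarrow> q \<in> T \<and> q' \<in> T"
  by (induction rule: annot.induct) auto

lemma annot_append:
  "annot q \<gamma> p M a \<Longrightarrow> annot p \<delta> q' M' a' \<Longrightarrow> annot q (\<gamma> @ \<delta>) q' (M + M') (\<lambda>i. a i + a' i)"
proof (induction rule: annot.induct)
  case (annot_Inr q x \<gamma> q'' M a)
  from annot.annot_Inr[OF annot_Inr(1,2) annot_Inr.IH[OF annot_Inr.prems]]
  show ?case by (simp add: add.assoc)
next
  case (annot_Inl q p \<gamma> q'' M a B)
  from annot.annot_Inl[OF annot_Inl(1) annot_Inl.IH[OF annot_Inl.prems]]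
  show ?case by simp
qed simp

lemma annot_appendE:
  assumes "annot q (\<gamma> @ \<delta>) q' M'' a''"
  shows "\<exists>p M a M' a'. annot q \<gamma> p M a \<and> annot p \<delta> q' M' a' \<and> M'' = M + M' \<and> a'' = (\<lambda>i. a i + a' i)"
  using assms
proof (induction \<gamma> arbitrary: q M'' a'')
  case Nil
  then have "annot q [] q {#} (\<lambda>i. 0)" using annot_T annot_Nil by blast
  with Nil show ?case
    by (intro exI[of _ q] exI[of _ "{#}"] exI[of _ "\<lambda>i. 0"] exI[of _ M''] exI[of _ a'']) simp
next
  case (Cons y \<gamma>)
  show ?case
  proof (cases y)
    case (Inl B)
    with Cons.prems have "annot q (Inl B # (\<gamma> @ \<delta>)) q' M'' a''" by simp
    then obtain r M0 where r: "q \<in> T" "annot r (\<gamma> @ \<delta>) q' M0 a''" "M'' = add_mset (q, B, r) M0"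
      by (rule annot_InlE)
    from Cons.IH[OF r(2)] obtain p M a M' a' where
      p: "annot r \<gamma> p M a" "annot p \<delta> q' M' a'" "M0 = M + M'" "a'' = (\<lambda>i. a i + a' i)" by (elim exE conjE)
    from annot_Inl[OF r(1) p(1)] p r(3) Inl show ?thesis
      by (intro exI[of _ p] exI[of _ "add_mset (q, B, r) M"] exI[of _ a] exI[of _ M'] exI[of _ a']) simp
  next
    case (Inr x)
    with Cons.prems have "annot q (Inr x # (\<gamma> @ \<delta>)) q' M'' a''" by simp
    then obtain a0 where r: "q \<in> T" "x \<in> carrier G" "annot (tr q x) (\<gamma> @ \<delta>) q' M'' a0"
      "a'' = (\<lambda>i. dl q x i + a0 i)"
      by (rule annot_InrE)
    from Cons.IH[OF r(3)] obtain p M a M' a' where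
      p: "annot (tr q x) \<gamma> p M a" "annot p \<delta> q' M' a'" "M'' = M + M'" "a0 = (\<lambda>i. a i + a' i)" by (elim exE conjE)
    from annot_Inr[OF r(1,2) p(1)] p r(4) Inr show ?thesis
      by (intro exI[of _ p] exI[of _ M] exI[of _ "\<lambda>i. dl q x i + a i"] exI[of _ M'] exI[of _ a'])
        (simp add: add.assoc)
  qed
qed

text \<open>The multiset forgets positions. Recovering some occurrence of an annotated nonterminal
  is what allows a run on multisets to be replayed on sentential forms.\<close>

lemma annot_locate:
  "annot q \<gamma> q' M a \<Longrightarrow> (p, B, p') \<in># M \<Longrightarrow>
    \<exists>\<alpha> \<beta> M1 M3 a1 a3. \<gamma> = \<alpha> @ [Inl B] @ \<beta> \<and> annot q \<alpha> p M1 a1 \<and> annot p' \<beta> q' M3 a3 \<and>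
      M = add_mset (p, B, p') (M1 + M3) \<and> a = (\<lambda>i. a1 i + a3 i)"
proof (induction rule: annot.induct)
  case (annot_Nil q)
  then show ?case by simp
next
  case (annot_Inr q x \<gamma> q' M a)
  from annot_Inr.IH[OF annot_Inr.prems] obtain \<alpha> \<beta> M1 M3 a1 a3 where
    h: "\<gamma> = \<alpha> @ [Inl B] @ \<beta>" "annot (tr q x) \<alpha> p M1 a1" "annot p' \<beta> q' M3 a3"
      "M = add_mset (p, B, p') (M1 + M3)" "a = (\<lambda>i. a1 i + a3 i)" by (elim exE conjE)
  from annot.annot_Inr[OF annot_Inr(1,2) h(2)] h show ?case
    by (intro exI[of _ "Inr x # \<alpha>"] exI[of _ \<beta>] exI[of _ M1] exI[of _ M3]
      exI[of _ "\<lambda>i. dl q x i + a1 i"] exI[of _ a3]) (simp add: add.assoc)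
next
  case (annot_Inl q r \<gamma> q' M a D)
  show ?case
  proof (cases "(p, B, p') = (q, D, r)")
    case True
    have "annot q [] q {#} (\<lambda>i. 0)" using annot_Inl(1) by (rule annot_Nil)
    then show ?thesis using True annot_Inl(2)
      by (intro exI[of _ "[]"] exI[of _ \<gamma>] exI[of _ "{#}"] exI[of _ M]
        exI[of _ "\<lambda>i. 0"] exI[of _ a]) simp
  next
    case False
    then have "(p, B, p') \<in># M" using annot_Inl.prems by auto
    from annot_Inl.IH[OF this] obtain \<alpha> \<beta> M1 M3 a1 a3 where
      h: "\<gamma> = \<alpha> @ [Inl B] @ \<beta>" "annot r \<alpha> p M1 a1" "annot p' \<beta> q' M3 a3"
        "M = add_mset (p, B, p') (M1 + M3)" "a = (\<lambda>i. a1 i + a3 i)" by (elim exE conjE)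
    from annot.annot_Inl[OF annot_Inl(1) h(2), of D] h show ?thesis
      by (intro exI[of _ "Inl D # \<alpha>"] exI[of _ \<beta>] exI[of _ "add_mset (q, D, r) M1"] exI[of _ M3]
        exI[of _ a1] exI[of _ a3]) simp
  qed
qed

lemma annot_word:
  "q \<in> T \<Longrightarrow> w \<in> lists (carrier G) \<Longrightarrow> \<exists>q' a. annot q (map Inr w) q' {#} a"
proof (induction w arbitrary: q)
  case Nil
  then show ?case using annot_Nil by auto
next
  case (Cons x w)
  then have "tr q x \<in> T" using tr_dl T_carrier by simp
  then have "\<exists>q' a. annot (tr q x) (map Inr w) q' {#} a" using Cons.IH Cons.prems(2) by simp
  then obtain q' a where "annot (tr q x) (map Inr w) q' {#} a" by (elim exE)
  from annot_Inr[OF Cons.prems(1) _ this] show ?case using Cons.prems by auto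
qed

lemma annot_value:
  "annot q (map Inr w) q' M a \<Longrightarrow> q \<otimes> word_value G id w = vec a \<otimes> q'"
proof (induction w arbitrary: q a)
  case Nil
  then have "annot q [] q' M a" by simp
  then show ?case by (rule annot_NilE) (simp add: T_carrier)
next
  case (Cons x w)
  then have "annot q (Inr x # map Inr w) q' M a" by simp
  then obtain a0 where h: "q \<in> T" "x \<in> carrier G" "annot (tr q x) (map Inr w) q' M a0"
    "a = (\<lambda>i. dl q x i + a0 i)" by (rule annot_InrE)
  have closed: "word_value G id w \<in> carrier G"
  proof -
    have "Inr y \<in> set \<gamma> \<Longrightarrow> annot q \<gamma> q' M a \<Longrightarrow> y \<in> carrier G" for y q \<gamma> q' M a
      by (rotate_tac, induction rule: annot.induct) auto
    from this[OF _ h(3)] show ?thesis by (intro word_value_closed) auto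
  qed
  have q: "q \<in> carrier G" using h T_carrier by simp
  have "q \<otimes> word_value G id (x # w) = (q \<otimes> x) \<otimes> word_value G id w"
    using q h(2) closed by (simp add: m_assoc)
  also have "\<dots> = vec (dl q x) \<otimes> (tr q x \<otimes> word_value G id w)"
    using tr_dl[OF q h(2)] T_carrier closed by (simp add: m_assoc)
  also have "\<dots> = vec (dl q x) \<otimes> (vec a0 \<otimes> q')" unfolding Cons.IH[OF h(3)] ..
  also have "\<dots> = vec a \<otimes> q'"
    unfolding h(4) vec_add using annot_T[OF h(3)] T_carrier by (simp add: m_assoc)
  finally show ?case .
qed

lemma annot_empty: "annot q \<gamma> q' {#} a \<Longrightarrow> \<exists>w. \<gamma> = map Inr w"
proof (induction \<gamma> arbitrary: q a)
  case (Cons y \<gamma>)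
  show ?case
  proof (cases y)
    case (Inl B)
    with Cons.prems have "annot q (Inl B # \<gamma>) q' {#} a" by simp
    then show ?thesis by (rule annot_InlE) simp
  next
    case (Inr x)
    with Cons.prems have "annot q (Inr x # \<gamma>) q' {#} a" by simp
    then obtain a0 where "annot (tr q x) \<gamma> q' {#} a0" by (rule annot_InrE)
    from Cons.IH[OF this] obtain w where "\<gamma> = map Inr w" by (rule exE)
    then show ?thesis using Inr by (intro exI[of _ "x # w"]) simp
  qed
qed simp

text \<open>Terminals act deterministically; only the states behind nonterminals are guessed, from
  the finite set \<open>T\<close>.\<close>

lemma finite_annot: "finite {(q', M, a). annot q \<gamma> q' M a}"
proof (induction \<gamma> arbitrary: q)
  case Nil
  have "{(q', M, a). annot q [] q' M a} \<subseteq> {(q, {#}, \<lambda>i. 0)}" by (auto elim: annot_NilE)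
  then show ?case by (rule finite_subset) simp
next
  case (Cons y \<gamma>)
  show ?case
  proof (cases y)
    case (Inl B)
    have "{(q', M, a). annot q (Inl B # \<gamma>) q' M a} \<subseteq>
      (\<Union>p\<in>T. (\<lambda>(q', M, a). (q', add_mset (q, B, p) M, a)) ` {(q', M, a). annot p \<gamma> q' M a})"
    proof (clarify, elim annot_InlE)
      fix q' M a p M' assume h: "annot p \<gamma> q' M' a" "M = add_mset (q, B, p) M'"
      then have "p \<in> T" using annot_T by blast
      with h show "(q', M, a) \<in> (\<Union>p\<in>T. (\<lambda>(q', M, a). (q', add_mset (q, B, p) M, a)) ` {(q', M, a). annot p \<gamma> q' M a})"
        by (intro UN_I[of p] image_eqI[of _ _ "(q', M', a)"]) auto
    qed
    then show ?thesis unfolding Inl by (rule finite_subset) (use Cons finite_T in auto)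
  next
    case (Inr x)
    have "{(q', M, a). annot q (Inr x # \<gamma>) q' M a} \<subseteq>
      (\<lambda>(q', M, a). (q', M, \<lambda>i. dl q x i + a i)) ` {(q', M, a). annot (tr q x) \<gamma> q' M a}"
    proof (clarify, elim annot_InrE)
      fix q' M a a0 assume "annot (tr q x) \<gamma> q' M a0" "a = (\<lambda>i. dl q x i + a0 i)"
      then show "(q', M, a) \<in> (\<lambda>(q', M, a). (q', M, \<lambda>i. dl q x i + a i)) ` {(q', M, a). annot (tr q x) \<gamma> q' M a}"
        by (intro image_eqI[of _ _ "(q', M, a0)"]) auto
    qed
    then show ?thesis unfolding Inr by (rule finite_subset) (use Cons in auto)
  qed
qed

text \<open>The triple construction of Bar-Hillel: \<open>(q, B, q')\<close> stands for derivations
  from \<open>B\<close> of words that lead from \<open>q\<close> to \<open>q'\<close>. The label is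
  the vector emitted by the terminals of the right-hand side.\<close>

definition grammar_rules :: "(nat \<times> (nat + 'a) list) set \<Rightarrow> ('a \<times> nat \<times> 'a, nat \<Rightarrow> int) mrule set" where
  "grammar_rules P = {((q, B, q'), M, a) | q B q' M a. \<exists>\<gamma>. (B, \<gamma>) \<in> P \<and> annot q \<gamma> q' M a}"

lemma finite_grammar_rules: "finite P \<Longrightarrow> finite (grammar_rules P)"
proof -
  assume P: "finite P"
  have "grammar_rules P \<subseteq> (\<Union>(B, \<gamma>)\<in>P. \<Union>q\<in>T. (\<lambda>(q', M, a). ((q, B, q'), M, a)) ` {(q', M, a). annot q \<gamma> q' M a})"
  proof
    fix r assume "r \<in> grammar_rules P"
    then obtain q B q' M a \<gamma> where r: "r = ((q, B, q'), M, a)" "(B, \<gamma>) \<in> P" "annot q \<gamma> q' M a"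
      unfolding grammar_rules_def by blast
    then have "q \<in> T" using annot_T by blast
    with r show "r \<in> (\<Union>(B, \<gamma>)\<in>P. \<Union>q\<in>T. (\<lambda>(q', M, a). ((q, B, q'), M, a)) ` {(q', M, a). annot q \<gamma> q' M a})"
      by (intro UN_I[of "(B, \<gamma>)"]) (auto intro!: bexI[of _ q] image_eqI[of _ _ "(q', M, a)"])
  qed
  moreover have "finite (\<Union>(B, \<gamma>)\<in>P. \<Union>q\<in>T. (\<lambda>(q', M, a). ((q, B, q'), M, a)) ` {(q', M, a). annot q \<gamma> q' M a})"
    using P finite_T finite_annot by auto
  ultimately show ?thesis by (rule finite_subset)
qed

abbreviation contrib :: "('a \<times> nat \<times> 'a, nat \<Rightarrow> int) mrule \<Rightarrow> nat \<Rightarrow> int" where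
  "contrib r \<equiv> snd (snd r)"

text \<open>The annotation of the derived word determines one of every earlier form, so the
  induction goes backwards from the end of the derivation.\<close>

lemma annot_derivation:
  assumes "(cfg_step P)\<^sup>*\<^sup>* \<gamma> \<gamma>'" "annot q \<gamma>' q' {#} a'"
  shows "\<exists>M a rs. annot q \<gamma> q' M a \<and> mrun (grammar_rules P) M rs \<and>
    (\<forall>i. a' i = a i + (\<Sum>r\<leftarrow>rs. contrib r i))"
  using assms(1)
proof (induction rule: converse_rtranclp_induct)
  case base
  show ?case using assms(2) mrun_Nil by (intro exI[of _ "{#}"] exI[of _ a'] exI[of _ "[]"]) simp
next
  case (step \<gamma> \<gamma>1)
  then obtain M1 a1 rs where 1: "annot q \<gamma>1 q' M1 a1" "mrun (grammar_rules P) M1 rs"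
    "\<forall>i. a' i = a1 i + (\<Sum>r\<leftarrow>rs. contrib r i)" by (elim exE conjE)
  from step(1) obtain B \<delta> \<alpha> \<beta> where s: "\<gamma> = \<alpha> @ [Inl B] @ \<beta>" "\<gamma>1 = \<alpha> @ \<delta> @ \<beta>" "(B, \<delta>) \<in> P"
    by (rule cfg_step.cases) simp
  from annot_appendE[OF 1(1)[unfolded s(2)]] obtain p Ma aa M' a'' where a: "annot q \<alpha> p Ma aa" "annot p (\<delta> @ \<beta>) q' M' a''"
    "M1 = Ma + M'" "a1 = (\<lambda>i. aa i + a'' i)" by (elim exE conjE)
  from annot_appendE[OF a(2)] obtain p' Md ad Mb ab where d: "annot p \<delta> p' Md ad" "annot p' \<beta> q' Mb ab"
    "M' = Md + Mb" "a'' = (\<lambda>i. ad i + ab i)" by (elim exE conjE)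
  have pT: "p \<in> T" using annot_T[OF a(1)] by simp
  have r: "((p, B, p'), Md, ad) \<in> grammar_rules P"
    unfolding grammar_rules_def using s(3) d(1) by blast
  let ?M = "Ma + add_mset (p, B, p') Mb"
  have "annot q \<gamma> q' ?M (\<lambda>i. aa i + ab i)"
    unfolding s(1) using annot_append[OF a(1) annot_Inl[OF pT d(2), of B]] by simp
  moreover have "mrun (grammar_rules P) ?M (((p, B, p'), Md, ad) # rs)"
  proof (rule mrun_Cons[OF r])
    show "mrun (grammar_rules P) (?M - {#lhs ((p, B, p'), Md, ad)#} + rhs ((p, B, p'), Md, ad)) rs"
      using 1(2) unfolding a(3) d(3) by (simp add: ac_simps)
  qed simp
  moreover have "\<forall>i. a' i = aa i + ab i + (\<Sum>r\<leftarrow>((p, B, p'), Md, ad) # rs. contrib r i)"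
    using 1(3) unfolding a(4) d(4) by simp
  ultimately show ?case by blast
qed

text \<open>A run may apply rules in any order, but each of them rewrites some occurrence present in
  the current sentential form.\<close>

lemma derivation_annot:
  assumes "mrun (grammar_rules P) M rs" "annot q \<gamma> q' M a"
  shows "\<exists>w a'. (cfg_step P)\<^sup>*\<^sup>* \<gamma> (map Inr w) \<and> annot q (map Inr w) q' {#} a' \<and>
    (\<forall>i. a' i = a i + (\<Sum>r\<leftarrow>rs. contrib r i))"
  using assms
proof (induction arbitrary: \<gamma> a rule: mrun.induct)
  case mrun_Nil
  from annot_empty[OF this] obtain w where "\<gamma> = map Inr w" by (rule exE)
  then show ?case using mrun_Nil by (intro exI[of _ w] exI[of _ a]) simp
next
  case (mrun_Cons r M rs)
  obtain p B p' Md ad \<delta> where r: "r = ((p, B, p'), Md, ad)" "(B, \<delta>) \<in> P" "annot p \<delta> p' Md ad"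
    using mrun_Cons(1) unfolding grammar_rules_def by blast
  have "(p, B, p') \<in># M" using mrun_Cons(2) r(1) by simp
  from annot_locate[OF mrun_Cons.prems this] obtain \<alpha> \<beta> M1 M3 a1 a3 where
    h: "\<gamma> = \<alpha> @ [Inl B] @ \<beta>" "annot q \<alpha> p M1 a1" "annot p' \<beta> q' M3 a3"
      "M = add_mset (p, B, p') (M1 + M3)" "a = (\<lambda>i. a1 i + a3 i)" by (elim exE conjE)
  have "annot q (\<alpha> @ \<delta> @ \<beta>) q' (M1 + (Md + M3)) (\<lambda>i. a1 i + (ad i + a3 i))"
    by (rule annot_append[OF h(2) annot_append[OF r(3) h(3)]])
  moreover have "M1 + (Md + M3) = M - {#lhs r#} + rhs r" unfolding r(1) h(4) by (simp add: ac_simps)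
  ultimately have "annot q (\<alpha> @ \<delta> @ \<beta>) q' (M - {#lhs r#} + rhs r) (\<lambda>i. a1 i + (ad i + a3 i))" by simp
  from mrun_Cons.IH[OF this] obtain w a' where w: "(cfg_step P)\<^sup>*\<^sup>* (\<alpha> @ \<delta> @ \<beta>) (map Inr w)"
    "annot q (map Inr w) q' {#} a'" "\<forall>i. a' i = a1 i + (ad i + a3 i) + (\<Sum>r\<leftarrow>rs. contrib r i)"
    by (elim exE conjE)
  have "cfg_step P \<gamma> (\<alpha> @ \<delta> @ \<beta>)" unfolding h(1) using r(2) by (rule cfg_step.intros)
  then have "(cfg_step P)\<^sup>*\<^sup>* \<gamma> (map Inr w)" using w(1) by (rule converse_rtranclp_into_rtranclp)
  moreover have "\<forall>i. a' i = a i + (\<Sum>r\<leftarrow>r # rs. contrib r i)" using w(3) h(5) r(1) by simp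
  ultimately show ?case using w(2) by blast
qed

lemma cfg_letters:
  assumes "(cfg_step P)\<^sup>*\<^sup>* \<gamma> \<gamma>'" "\<forall>(B, \<delta>)\<in>P. \<delta> \<in> lists (range Inl \<union> Inr ` X)"
    "\<gamma> \<in> lists (range Inl \<union> Inr ` X)"
  shows "\<gamma>' \<in> lists (range Inl \<union> Inr ` X)"
  using assms(1)
proof (induction rule: rtranclp_induct)
  case (step \<gamma>1 \<gamma>2)
  from step(2) obtain B \<delta> \<alpha> \<beta> where s: "\<gamma>1 = \<alpha> @ [Inl B] @ \<beta>" "\<gamma>2 = \<alpha> @ \<delta> @ \<beta>" "(B, \<delta>) \<in> P"
    by (rule cfg_step.cases) simp
  have "\<delta> \<in> lists (range Inl \<union> Inr ` X)" using assms(2) s(3) by blast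
  then show ?case using step.IH unfolding s(1,2) append_in_lists_conv by simp
qed (rule assms(3))

lemma presb_context_free:
  assumes K: "context_free_constraint G m K" and \<Phi>: "\<And>j. j < m \<Longrightarrow> agmap F (\<Phi> j)" and fin: "finite F"
  shows "presb F (\<lambda>s. map (\<lambda>j. \<Phi> j s) [0..<m] \<in> K)"
proof -
  obtain S L k where gen: "finite_generating_set G S" and cf: "context_free_language S L" and k: "k < m"
    and K: "K = {gs \<in> tuples G m. gs ! k \<in> word_value G id ` L}"
    using K unfolding context_free_constraint_def by blast
  have SG: "S \<subseteq> carrier G" using gen by (simp add: finite_generating_set_def)
  obtain P s0 where P: "finite P" "\<forall>(B, \<delta>)\<in>P. \<delta> \<in> lists (range Inl \<union> Inr ` S)"
    and L: "L = {w \<in> lists S. (cfg_step P)\<^sup>*\<^sup>* [Inl s0] (map Inr w)}"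
    using cf unfolding context_free_language_def by blast
  \<comment> \<open>The identity may be missing from \<open>T\<close>, so the transducer starts in
    some state \<open>q\<close>, and values are compared after left multiplication by
    \<open>q\<close>.\<close>
  obtain q where q: "q \<in> T" using ex_transversal[of \<one>] by auto
  have qG: "q \<in> carrier G" using q T_carrier by simp
  define R where "R = grammar_rules P"
  have finR: "finite R" using finite_grammar_rules[OF P(1)] by (simp add: R_def)
  have "agmap F (\<lambda>s. q \<otimes> \<Phi> k s)" by (intro agmap_mult agmap_const qG \<Phi> k)
  then obtain t c where t: "t \<in> T" "\<forall>i<n. c i \<in> lin F" "\<forall>s. q \<otimes> \<Phi> k s = vec (\<lambda>i. c i s) \<otimes> t"
    by (rule agmapE)
  let ?start = "{#(q, s0, t)#}"
  have start: "annot q [Inl s0] t ?start (\<lambda>i. 0)"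
    by (rule annot_Inl[OF q annot_Nil[OF t(1)]])
  \<comment> \<open>\<open>snd y\<close> counts rule applications: they must come from a complete
    run and emit the coordinates of the given element.\<close>
  let ?Q = "\<lambda>y. (\<exists>rs. mrun R ?start rs \<and> (\<forall>r\<in>R. count_list rs r = snd y r)) \<and>
     (\<forall>i\<in>{..<n}. c i (fst y) = (\<Sum>r\<in>R. int (snd y r) * contrib r i))"
  have sum: "(\<Sum>r\<leftarrow>rs. contrib r i) = (\<Sum>r\<in>R. int (count_list rs r) * contrib r i)"
    if "mrun R ?start rs" for rs i
    using mrun_flow[OF that finR] by (intro sum_list_count_list[OF finR]) simp
  have iff: "\<Phi> k s \<in> word_value G id ` L \<longleftrightarrow> (\<exists>x. ?Q (s, x))" for s
  proof
    assume "\<Phi> k s \<in> word_value G id ` L"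
    then obtain w where w: "w \<in> lists S" "(cfg_step P)\<^sup>*\<^sup>* [Inl s0] (map Inr w)" "\<Phi> k s = word_value G id w"
      unfolding L by auto
    have "w \<in> lists (carrier G)" using w(1) SG by auto
    from annot_word[OF q this] obtain q' a' where a': "annot q (map Inr w) q' {#} a'" by (elim exE)
    \<comment> \<open>Uniqueness of the decomposition into coordinates and representative forces the
      final state to be \<open>t\<close>.\<close>
    have "vec a' \<otimes> q' = vec (\<lambda>i. c i s) \<otimes> t" 
      using annot_value[OF a'] t(3)[rule_format, of s] unfolding w(3) by (rule trans[OF sym])
    then have q': "q' = t" and ac: "\<forall>i<n. a' i = c i s"
      using vec_transversal_eq_iff[of q' t] annot_T[OF a'] t(1) by auto
    from annot_derivation[OF w(2) a'[unfolded q']] obtain M a rs where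
      h: "annot q [Inl s0] t M a" "mrun R M rs" "\<forall>i. a' i = a i + (\<Sum>r\<leftarrow>rs. contrib r i)"
      unfolding R_def by (elim exE conjE)
    from h(1) have "M = ?start \<and> a = (\<lambda>i. 0)"
      by (auto elim!: annot_InlE annot_NilE)
    then have M: "mrun R ?start rs" "\<forall>i<n. c i s = (\<Sum>r\<leftarrow>rs. contrib r i)" using h(2,3) ac by auto
    then have "?Q (s, count_list rs)" using sum[OF M(1)] by auto
    then show "\<exists>x. ?Q (s, x)" by (rule exI[where x = "count_list rs"])
  next
    assume "\<exists>x. ?Q (s, x)"
    then obtain x rs where x: "mrun R ?start rs" "\<forall>r\<in>R. count_list rs r = x r"
      "\<forall>i\<in>{..<n}. c i s = (\<Sum>r\<in>R. int (x r) * contrib r i)" by auto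
    from derivation_annot[OF x(1)[unfolded R_def] start] obtain w a' where
      w: "(cfg_step P)\<^sup>*\<^sup>* [Inl s0] (map Inr w)" "annot q (map Inr w) t {#} a'"
      "\<forall>i. a' i = (\<Sum>r\<leftarrow>rs. contrib r i)" by auto
    have "a' i = c i s" if "i < n" for i
      using w(3) sum[OF x(1), of i] x(2,3) that by simp
    then have "vec a' = vec (\<lambda>i. c i s)" by (rule vec_cong)
    then have eq: "q \<otimes> word_value G id w = q \<otimes> \<Phi> k s" using annot_value[OF w(2)] t(3) by simp
    have "(map Inr w :: (nat + 'a) list) \<in> lists (range Inl \<union> Inr ` S)"
      by (rule cfg_letters[OF w(1) P(2)]) simp
    then have wS: "w \<in> lists S" by (auto simp: in_lists_conv_set)
    have "word_value G id w \<in> carrier G" using wS SG by (intro word_value_closed) auto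
    then have "word_value G id w = \<Phi> k s" using eq qG agmap_carrier[OF \<Phi>[OF k]] by simp
    then show "\<Phi> k s \<in> word_value G id ` L"
      using wS w(1) unfolding L by (intro image_eqI[of _ _ w]) simp_all
  qed
  have "map (\<lambda>j. \<Phi> j s) [0..<m] \<in> K \<longleftrightarrow> (\<exists>x. ?Q (s, x))" for s
    using iff[of s] agmap_tuples[OF \<Phi>] k by (simp add: K)
  moreover have "presb F (\<lambda>s. \<exists>x. ?Q (s, x))"
  proof (rule presb_ex_nat[OF finR fin])
    have "presb (pairvars F R) (\<lambda>y. \<exists>rs. mrun R ?start rs \<and> (\<forall>r\<in>R. count_list rs r = snd y r))"
      by (rule presb_subst[OF mrun_presb[OF finR]]) (auto simp: natvars_def intro: lin_pairvars_snd)
    moreover have "presb (pairvars F R) (\<lambda>y. \<forall>i\<in>{..<n}. c i (fst y) = (\<Sum>r\<in>R. int (snd y r) * contrib r i))"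
      using t(2) by (intro presb_ball presb_eq lin_pairvars_fst lin_intros lin_pairvars_snd) auto
    ultimately show "presb (pairvars F R) ?Q" by (rule presb_conj)
  qed
  ultimately show ?thesis by simp
qed

end

section \<open>The subgroup-transversal normal form and lexicographic constraints\<close>

lemma st_word_Nil [simp]: "st_word [] ks t = [Rep t]"
  and st_word_Cons [simp]: "st_word (b # cs) (k # ks) t = basis_power b k @ st_word cs ks t"
  by (simp_all add: st_word_def)

declare basis_power.simps [simp del]

lemma st_word_nonempty: "st_word cs ks t \<noteq> []"
  by (simp add: st_word_def)

lemma hd_st_word:
  assumes "length ks = length cs"
  shows "hd (st_word cs ks t) \<in> BasisGen ` set cs \<union> BasisInv ` set cs \<union> {Rep t}"
  using assms
proof (induction cs arbitrary: ks)
  case (Cons b cs)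
  then obtain k ks' where k: "ks = k # ks'" by (cases ks) auto
  show ?case
  proof (cases "k = 0")
    case True
    then show ?thesis using Cons k by (auto simp: basis_power.simps)
  next
    case False
    then obtain x where "hd (basis_power b k) = x" "x \<in> {BasisGen b, BasisInv b}" "basis_power b k \<noteq> []"
      by (auto simp: basis_power.simps)
    then show ?thesis using k by auto
  qed
qed simp

lemma hd_basis_power:
  "hd (basis_power b k @ u) = (if k > 0 then BasisGen b else if k < 0 then BasisInv b else hd u)"
  by (auto simp: basis_power.simps hd_append)

lemma lexord_replicate:
  assumes R: "irrefl R" and u: "u \<noteq> []" "hd u \<noteq> x" and ij: "i < j"
  shows "(replicate i x @ u, replicate j x @ v) \<in> lexord R \<longleftrightarrow> (hd u, x) \<in> R"
    and "(replicate j x @ v, replicate i x @ u) \<in> lexord R \<longleftrightarrow> (x, hd u) \<in> R"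
proof -
  obtain k where j: "j = i + Suc k" using ij less_iff_Suc_add by auto
  obtain y u' where u': "u = y # u'" using u(1) by (cases u) auto
  have rep: "replicate j x @ v = replicate i x @ x # (replicate k x @ v)"
    by (simp add: j replicate_add replicate_append_same)
  show "(replicate i x @ u, replicate j x @ v) \<in> lexord R \<longleftrightarrow> (hd u, x) \<in> R"
    "(replicate j x @ v, replicate i x @ u) \<in> lexord R \<longleftrightarrow> (x, hd u) \<in> R"
    unfolding rep lexord_same_pref_if_irrefl[OF R] using u(2) by (auto simp: u')
qed

lemma lexord_basis_power:
  assumes R: "irrefl R" and u: "u \<noteq> []" "hd u \<noteq> BasisGen b" "hd u \<noteq> BasisInv b"
    and v: "v \<noteq> []" "hd v \<noteq> BasisGen b" "hd v \<noteq> BasisInv b"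
  shows "(basis_power b k @ u, basis_power b l @ v) \<in> lexord R \<longleftrightarrow>
    (k = l \<and> (u, v) \<in> lexord R) \<or>
    (0 \<le> k \<and> k < l \<and> (hd u, BasisGen b) \<in> R) \<or> (0 \<le> l \<and> l < k \<and> (BasisGen b, hd v) \<in> R) \<or>
    (k \<le> 0 \<and> l < k \<and> (hd u, BasisInv b) \<in> R) \<or> (l \<le> 0 \<and> k < l \<and> (BasisInv b, hd v) \<in> R) \<or>
    (0 < k \<and> l < 0 \<and> (BasisGen b, BasisInv b) \<in> R) \<or> (k < 0 \<and> 0 < l \<and> (BasisInv b, BasisGen b) \<in> R)"
proof -
  have hdl: "(w, w') \<in> lexord R \<longleftrightarrow> (hd w, hd w') \<in> R" if "w \<noteq> []" "w' \<noteq> []" "hd w \<noteq> hd w'" for w w'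
    using that by (cases w; cases w') auto
  have pos: "basis_power b k = replicate (nat k) (BasisGen b)" if "0 \<le> k" for k
    using that by (simp add: basis_power.simps)
  have neg: "basis_power b k = replicate (nat (- k)) (BasisInv b)" if "k \<le> 0" for k
    using that by (auto simp: basis_power.simps)
  consider "k = l" | "0 \<le> k" "k < l" | "0 \<le> l" "l < k" | "k \<le> 0" "l < k" | "l \<le> 0" "k < l"
    | "0 < k" "l < 0" | "k < 0" "0 < l" by linarith
  then show ?thesis
  proof cases
    case 1
    then show ?thesis using lexord_same_pref_if_irrefl[OF R] by auto
  next
    case 2
    have "(basis_power b k @ u, basis_power b l @ v) \<in> lexord R \<longleftrightarrow> (hd u, BasisGen b) \<in> R"
      using lexord_replicate(1)[OF R u(1,2), of "nat k" "nat l" v] 2 by (simp add: pos)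
    then show ?thesis using 2 by auto
  next
    case 3
    have "(basis_power b k @ u, basis_power b l @ v) \<in> lexord R \<longleftrightarrow> (BasisGen b, hd v) \<in> R"
      using lexord_replicate(2)[OF R v(1,2), of "nat l" "nat k" u] 3 by (simp add: pos)
    then show ?thesis using 3 by auto
  next
    case 4
    have "(basis_power b k @ u, basis_power b l @ v) \<in> lexord R \<longleftrightarrow> (hd u, BasisInv b) \<in> R"
      using lexord_replicate(1)[OF R u(1,3), of "nat (- k)" "nat (- l)" v] 4 by (simp add: neg)
    then show ?thesis using 4 by auto
  next
    case 5
    have "(basis_power b k @ u, basis_power b l @ v) \<in> lexord R \<longleftrightarrow> (BasisInv b, hd v) \<in> R"
      using lexord_replicate(2)[OF R v(1,3), of "nat (- l)" "nat (- k)" u] 5 by (simp add: neg)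
    then show ?thesis using 5 by auto
  next
    case 6
    have "(basis_power b k @ u, basis_power b l @ v) \<in> lexord R \<longleftrightarrow> (BasisGen b, BasisInv b) \<in> R"
      using 6 u(1) v(1) by (subst hdl) (auto simp: hd_basis_power)
    then show ?thesis using 6 by auto
  next
    case 7
    have "(basis_power b k @ u, basis_power b l @ v) \<in> lexord R \<longleftrightarrow> (BasisInv b, BasisGen b) \<in> R"
      using 7 u(1) v(1) by (subst hdl) (auto simp: hd_basis_power)
    then show ?thesis using 7 by auto
  qed
qed

text \<open>The first letter is decided by the first nonzero exponent and its sign.\<close>

lemma presb_hd_st_word:
  assumes "length fs = length cs" "set fs \<subseteq> lin F"
  shows "presb F (\<lambda>s. hd (st_word cs (map (\<lambda>f. f s) fs) t) \<in> X)"
  using assms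
proof (induction cs arbitrary: fs)
  case Nil
  then show ?case by (simp add: presb_const)
next
  case (Cons b cs)
  then obtain f fs' where f: "fs = f # fs'" by (cases fs) auto
  have "hd (st_word (b # cs) (map (\<lambda>f. f s) fs) t) \<in> X \<longleftrightarrow>
    (0 < f s \<and> BasisGen b \<in> X) \<or> (f s < 0 \<and> BasisInv b \<in> X) \<or>
    (f s = 0 \<and> hd (st_word cs (map (\<lambda>f. f s) fs') t) \<in> X)" for s
    unfolding f list.map st_word_Cons hd_basis_power by auto
  moreover have "presb F (\<lambda>s. hd (st_word cs (map (\<lambda>f. f s) fs') t) \<in> X)"
    using Cons f by simp
  then have "presb F (\<lambda>s. (0 < f s \<and> BasisGen b \<in> X) \<or> (f s < 0 \<and> BasisInv b \<in> X) \<or>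
    (f s = 0 \<and> hd (st_word cs (map (\<lambda>f. f s) fs') t) \<in> X))"
    using Cons.prems f by (intro presb_intros lin_const) auto
  ultimately show ?case by simp
qed

text \<open>One basis element is peeled off at a time; as the list is distinct, the remaining words
  do not begin with it, as \<open>lexord_basis_power\<close> requires.\<close>

lemma presb_lexord_st_word:
  assumes "irrefl R" "distinct cs" "length fs = length cs" "set fs \<subseteq> lin F"
    "length gs = length cs" "set gs \<subseteq> lin F"
  shows "presb F (\<lambda>s. (st_word cs (map (\<lambda>f. f s) fs) t, st_word cs (map (\<lambda>f. f s) gs) t') \<in> lexord R)"
  using assms(2-)
proof (induction cs arbitrary: fs gs)
  case Nil
  then show ?case by (simp add: presb_const)
next
  case (Cons b cs)
  then obtain f fs' where f: "fs = f # fs'" by (cases fs) auto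
  from Cons obtain g gs' where g: "gs = g # gs'" by (cases gs) auto
  define u where "u s = st_word cs (map (\<lambda>f. f s) fs') t" for s
  define v where "v s = st_word cs (map (\<lambda>f. f s) gs') t'" for s
  have len: "length fs' = length cs" "length gs' = length cs" and lin: "set fs' \<subseteq> lin F" "set gs' \<subseteq> lin F"
    "f \<in> lin F" "g \<in> lin F" using Cons.prems f g by auto
  have u: "u s \<noteq> []" "hd (u s) \<noteq> BasisGen b" "hd (u s) \<noteq> BasisInv b" for s
    using hd_st_word[of "map (\<lambda>f. f s) fs'" cs t] len Cons.prems(1)
    by (auto simp: u_def st_word_nonempty)
  have v: "v s \<noteq> []" "hd (v s) \<noteq> BasisGen b" "hd (v s) \<noteq> BasisInv b" for s
    using hd_st_word[of "map (\<lambda>f. f s) gs'" cs t'] len Cons.prems(1)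
    by (auto simp: v_def st_word_nonempty)
  have hu: "presb F (\<lambda>s. (hd (u s), x) \<in> R)" for x
    using presb_hd_st_word[OF len(1) lin(1), of t "{y. (y, x) \<in> R}"] by (simp add: u_def)
  have hv: "presb F (\<lambda>s. (x, hd (v s)) \<in> R)" for x
    using presb_hd_st_word[OF len(2) lin(2), of t' "{y. (x, y) \<in> R}"] by (simp add: v_def)
  have IH: "presb F (\<lambda>s. (u s, v s) \<in> lexord R)"
    unfolding u_def v_def using Cons.prems len lin by (intro Cons.IH) auto
  have split: "(\<lambda>s. (st_word (b # cs) (map (\<lambda>f. f s) fs) t, st_word (b # cs) (map (\<lambda>f. f s) gs) t') \<in> lexord R)
    = (\<lambda>s. (basis_power b (f s) @ u s, basis_power b (g s) @ v s) \<in> lexord R)"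
    unfolding f g list.map st_word_Cons u_def v_def ..
  show ?case
    unfolding split lexord_basis_power[OF assms(1) u v]
    by (intro presb_intros lin lin_const hu hv IH)
qed

context va_group
begin

section \<open>Evaluation of subgroup-transversal words\<close>

lemma basis_power_value:
  assumes "b \<in> carrier G"
  shows "word_value G (st_value G) (basis_power b k) = b [^] k"
proof -
  have rep: "word_value G (st_value G) (replicate m x) = st_value G x [^] m"
    if "st_value G x \<in> carrier G" for m :: nat and x
  proof (induction m)
    case (Suc m)
    have "st_value G x \<otimes> st_value G x [^] m = st_value G x [^] Suc m"
      using nat_pow_Suc2[OF that] by simp
    then show ?case using Suc by simp
  qed simp
  show ?thesis
  proof (cases "k \<ge> 0")
    case True
    then have "b [^] k = b [^] nat k" using int_pow_int[of G b "nat k"] by simp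
    then show ?thesis using True assms rep[of "BasisGen b"] by (simp add: basis_power.simps)
  next
    case False
    then have "b [^] k = inv (b [^] nat (- k))" using int_pow_neg_int[OF assms, of "nat (- k)"] by simp
    also have "\<dots> = (inv b) [^] nat (- k)" using nat_pow_inv[OF assms] by simp
    finally show ?thesis using False assms rep[of "BasisInv b"] by (simp add: basis_power.simps)
  qed
qed

lemma set_basis_power: "set (basis_power b k) \<subseteq> {BasisGen b, BasisInv b}"
  by (auto simp: basis_power.simps)

lemma st_word_value:
  assumes "set cs \<subseteq> A" "length ks = length cs" "t \<in> T"
  shows "word_value G (st_value G) (st_word cs ks t) = basis_prod cs ks \<otimes> t"
  using assms
proof (induction cs arbitrary: ks)
  case Nil
  then show ?case by (simp add: T_carrier)
next
  case (Cons b cs)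
  then obtain k ks' where k: "ks = k # ks'" by (cases ks) auto
  have b: "b \<in> carrier G" using Cons.prems A_carrier by auto
  have bp: "basis_prod cs ks' \<in> carrier G" using basis_prod_A[of cs ks'] Cons.prems k A_carrier by auto
  have letters: "\<And>x. x \<in> set (st_word cs ks' t) \<Longrightarrow> st_value G x \<in> carrier G"
  proof -
    have "set (st_word cs ks t) \<subseteq> BasisGen ` set cs \<union> BasisInv ` set cs \<union> {Rep t}"
      if "length ks = length cs" for cs ks
      using that
    proof (induction cs arbitrary: ks)
      case (Cons b cs)
      then obtain k ks' where "ks = k # ks'" by (cases ks) auto
      then show ?case using Cons set_basis_power[of b k] by force
    qed simp
    from this[of ks' cs] show "\<And>x. x \<in> set (st_word cs ks' t) \<Longrightarrow> st_value G x \<in> carrier G"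
      using Cons.prems k A_carrier T_carrier by fastforce
  qed
  have "word_value G (st_value G) (basis_power b k @ st_word cs ks' t) =
    word_value G (st_value G) (basis_power b k) \<otimes> word_value G (st_value G) (st_word cs ks' t)"
    using b letters set_basis_power[of b k] by (intro word_value_append) auto
  also have "\<dots> = (b [^] k) \<otimes> (basis_prod cs ks' \<otimes> t)"
    using basis_power_value[OF b] Cons k by simp
  finally show ?case using k b bp Cons.prems(3) T_carrier by (simp add: m_assoc)
qed

lemma st_word_vec_value:
  "t \<in> T \<Longrightarrow> word_value G (st_value G) (st_word bs (map f [0..<n]) t) = vec f \<otimes> t"
  using st_word_value[OF bs_A] by (simp add: vec_def)

lemma st_normal_form_vec:
  assumes "t \<in> T"
  shows "st_normal_form G bs T (vec f \<otimes> t) = st_word bs (map f [0..<n]) t"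
  unfolding st_normal_form_def
proof (rule the_equality)
  show "(\<exists>ks ta. length ks = n \<and> ta \<in> T \<and> st_word bs (map f [0..<n]) t = st_word bs ks ta) \<and>
    word_value G (st_value G) (st_word bs (map f [0..<n]) t) = vec f \<otimes> t"
    using assms st_word_vec_value[OF assms] by (intro conjI exI[of _ "map f [0..<n]"] exI[of _ t]) auto
next
  fix w assume w: "(\<exists>ks ta. length ks = n \<and> ta \<in> T \<and> w = st_word bs ks ta) \<and>
    word_value G (st_value G) w = vec f \<otimes> t"
  then obtain ks u where ks: "length ks = n" "u \<in> T" "w = st_word bs ks u" by blast
  have kmap: "ks = map ((!) ks) [0..<n]" using ks(1) map_nth[of ks] by simp
  have "vec ((!) ks) \<otimes> u = vec f \<otimes> t"
    using w st_word_vec_value[OF ks(2), of "(!) ks"] kmap ks(3) by simp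
  then have "u = t" "\<forall>i<n. ks ! i = f i" using vec_transversal_eq_iff[OF ks(2) assms] by auto
  then have "map ((!) ks) [0..<n] = map f [0..<n]" by simp
  then show "w = st_word bs (map f [0..<n]) t" using ks(3) kmap \<open>u = t\<close> by simp
qed

lemma st_normal_form_value:
  "g \<in> carrier G \<Longrightarrow> word_value G (st_value G) (st_normal_form G bs T g) = g"
  using ex_vec_transversal[of g] st_normal_form_vec st_word_vec_value by fastforce

lemma presb_lex_order:
  assumes K: "lex_order_constraint G bs T r m K" and \<Phi>: "\<And>j. j < m \<Longrightarrow> agmap F (\<Phi> j)"
  shows "presb F (\<lambda>s. map (\<lambda>j. \<Phi> j s) [0..<m] \<in> K)"
proof -
  obtain i j where ij: "i < m" "j < m" and K: "K = {gs \<in> tuples G m.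
      lex_le r (st_normal_form G bs T (gs ! i)) (st_normal_form G bs T (gs ! j))}"
    using K unfolding lex_order_constraint_def by blast
  obtain c t where t: "t \<in> T" "\<forall>i<n. c i \<in> lin F" "\<forall>s. \<Phi> i s = vec (\<lambda>i. c i s) \<otimes> t"
    using \<Phi>[OF ij(1)] by (rule agmapE)
  obtain d u where u: "u \<in> T" "\<forall>i<n. d i \<in> lin F" "\<forall>s. \<Phi> j s = vec (\<lambda>i. d i s) \<otimes> u"
    using \<Phi>[OF ij(2)] by (rule agmapE)
  have eta: "st_normal_form G bs T (\<Phi> i s) = st_word bs (map (\<lambda>f. f s) (map c [0..<n])) t"
    "st_normal_form G bs T (\<Phi> j s) = st_word bs (map (\<lambda>f. f s) (map d [0..<n])) u" for s
    using st_normal_form_vec t u by (simp_all add: comp_def)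
  \<comment> \<open>A normal form determines its element, so equality of words becomes equality in
    the group.\<close>
  have "st_normal_form G bs T (\<Phi> i s) = st_normal_form G bs T (\<Phi> j s) \<longleftrightarrow> \<Phi> i s = \<Phi> j s" for s
    using st_normal_form_value agmap_carrier[OF \<Phi>[OF ij(1)]] agmap_carrier[OF \<Phi>[OF ij(2)]] by metis
  then have "map (\<lambda>j. \<Phi> j s) [0..<m] \<in> K \<longleftrightarrow> \<Phi> i s = \<Phi> j s \<or>
     (st_word bs (map (\<lambda>f. f s) (map c [0..<n])) t, st_word bs (map (\<lambda>f. f s) (map d [0..<n])) u) \<in> lexord (r - Id)" for s
    using agmap_tuples[OF \<Phi>, where s = s] ij by (simp add: K lex_le_def eta)
  moreover have "presb F (\<lambda>s. \<Phi> i s = \<Phi> j s \<or>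
     (st_word bs (map (\<lambda>f. f s) (map c [0..<n])) t, st_word bs (map (\<lambda>f. f s) (map d [0..<n])) u) \<in> lexord (r - Id))"
    using t(2) u(2) ij distinct_bs
    by (intro presb_disj presb_agmap_eq \<Phi> presb_lexord_st_word) (auto simp: irrefl_def)
  ultimately show ?thesis by simp
qed

end

section \<open>Languages of normal forms\<close>

text \<open>The number \<open>j\<close> of the component keeps the exponents of different components
  independent when they use the same template.\<close>

definition tag_template :: "nat \<Rightarrow> ('x + 'v) list \<Rightarrow> ('x hashed + nat \<times> 'v) list" where
  "tag_template j tpl = map (map_sum Letter (Pair j)) tpl"

fun join_templates :: "('x hashed + 'v) list list \<Rightarrow> ('x hashed + 'v) list" where
  "join_templates [] = []"
| "join_templates [w] = w"
| "join_templates (w # v # ws) = w @ [Inl Hash] @ join_templates (v # ws)"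

lemma map_word_power: "map f (word_power k w) = word_power k (map f w)"
  by (induction k) auto

lemma expand_tag_template:
  "expand (\<lambda>(j, v). map Letter (c v)) x (tag_template j tpl) = map Letter (expand c (\<lambda>v. x (j, v)) tpl)"
proof (induction tpl)
  case (Cons y tpl)
  then show ?case by (cases y) (auto simp: tag_template_def map_word_power)
qed (simp add: tag_template_def)

lemma expand_join_templates:
  assumes "\<And>i. i \<in> set is \<Longrightarrow> expand c x (f i) = map Letter (g i)"
  shows "expand c x (join_templates (map f is)) = hash_join (map g is)"
  using assms by (induction "is" rule: induct_list012) auto

lemma set_join_templates: "set (join_templates ws) \<subseteq> insert (Inl Hash) (\<Union>w\<in>set ws. set w)"
  by (induction ws rule: join_templates.induct) auto

abbreviation template_vars :: "('x + 'v) list \<Rightarrow> 'v set" where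
  "template_vars tpl \<equiv> {v. Inr v \<in> set tpl}"

lemma finite_template_vars: "finite (template_vars tpl)"
  using finite_vimageI[of "set tpl" Inr] by (simp add: vimage_def)

context va_group
begin

text \<open>The type argument fixes the type of parameters \<open>s\<close>, over which the definition cannot
  quantify.\<close>

definition definable :: "nat \<Rightarrow> 'a list set \<Rightarrow> 's itself \<Rightarrow> bool" where
  "definable m S _ \<longleftrightarrow> (\<forall>(F :: ('s \<Rightarrow> int) set) \<Phi>. finite F \<longrightarrow> (\<forall>j<m. agmap F (\<Phi> j)) \<longrightarrow>
     presb F (\<lambda>s. map (\<lambda>j. \<Phi> j s) [0..<m] \<in> S))"

text \<open>Common frame of both normal forms: finitely many templates with choice conditions
  \<open>Ch\<close> that admit an expansion for every element, and only expansions that are normal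
  forms. Each choice of \<open>m\<close> templates yields one joint template, and membership of the
  tuple in \<open>S\<close> becomes a Presburger condition on its exponents.\<close>

lemma EDT0L_normal_form:
  fixes Pat :: "(('x + 'v) list \<times> (('v \<Rightarrow> nat) \<Rightarrow> bool)) set" and c :: "'v \<Rightarrow> 'x list"
  assumes fin: "finite Pat" "finite \<Omega>"
    and tpl: "\<And>tpl Ch. (tpl, Ch) \<in> Pat \<Longrightarrow> tpl \<in> lists (Inl ` \<Omega> \<union> Inr ` {v. c v \<in> lists \<Omega>}) \<and>
       valid_template ev c tpl \<and> presb (natvars (template_vars tpl)) Ch"
    and word: "\<And>tpl Ch x. (tpl, Ch) \<in> Pat \<Longrightarrow> Ch x \<Longrightarrow>
       \<mu> (word_value G ev (expand c x tpl)) = expand c x tpl"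
    and ex: "\<And>g. g \<in> carrier G \<Longrightarrow> \<exists>p\<in>Pat. \<exists>x. snd p x \<and> word_value G ev (expand c x (fst p)) = g"
    and S: "S \<subseteq> tuples G m" "definable m S TYPE(nat \<times> 'v \<Rightarrow> nat)"
  shows "expressed_as_EDT0L \<Omega> \<mu> S"
proof -
  let ?c = "\<lambda>(j :: nat, v). map Letter (c v)"
  define V where "V = {..<m} \<times> (\<Union>p\<in>Pat. template_vars (fst p))"
  define tup where "tup ps x = map (\<lambda>j. word_value G ev (expand c (\<lambda>v. x (j, v)) (fst (ps ! j)))) [0..<m]"
    for ps :: "(('x + 'v) list \<times> (('v \<Rightarrow> nat) \<Rightarrow> bool)) list" and x :: "nat \<times> 'v \<Rightarrow> nat"
  define jt where "jt ps = join_templates (map (\<lambda>j. tag_template j (fst (ps ! j))) [0..<m])"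
    for ps :: "(('x + 'v) list \<times> (('v \<Rightarrow> nat) \<Rightarrow> bool)) list"
  define Q where "Q ps x \<longleftrightarrow> (\<forall>j\<in>{..<m}. snd (ps ! j) (\<lambda>v. x (j, v))) \<and> tup ps x \<in> S"
    for ps :: "(('x + 'v) list \<times> (('v \<Rightarrow> nat) \<Rightarrow> bool)) list" and x :: "nat \<times> 'v \<Rightarrow> nat"
  define PS where "PS = {ps. set ps \<subseteq> Pat \<and> length ps = m}"
  have finV: "finite V" using fin(1) finite_template_vars by (auto simp: V_def)
  have finPS: "finite PS" unfolding PS_def by (rule finite_lists_length_eq[OF fin(1)])
  have mem: "(fst (ps ! j), snd (ps ! j)) \<in> Pat" if "ps \<in> PS" "j < m" for ps j
    using that by (auto simp: PS_def)
  have Vmem: "(j, v) \<in> V" if "ps \<in> PS" "j < m" "Inr v \<in> set (fst (ps ! j))" for ps j v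
    using mem[OF that(1,2)] that(2,3) unfolding V_def by force
  have letters: "a \<in> \<Omega>" if "ps \<in> PS" "j < m" "Inl a \<in> set (fst (ps ! j))" for ps j a
    using tpl[OF mem[OF that(1,2)]] that(3) by auto
  have cV: "c v \<in> lists \<Omega>" if jv: "(j, v) \<in> V" for j v
  proof -
    obtain p where p: "p \<in> Pat" "Inr v \<in> set (fst p)" using jv by (auto simp: V_def)
    have "fst p \<in> lists (Inl ` \<Omega> \<union> Inr ` {v. c v \<in> lists \<Omega>})" using tpl[of "fst p" "snd p"] p(1) by simp
    then have "Inr v \<in> Inl ` \<Omega> \<union> Inr ` {v. c v \<in> lists \<Omega>}" using p(2) unfolding in_lists_conv_set by blast
    then show ?thesis by auto
  qed
  have jt_letters: "jt ps \<in> lists (Inl ` (Letter ` \<Omega> \<union> {Hash}) \<union> Inr ` V)" if ps: "ps \<in> PS" for ps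
    unfolding in_lists_conv_set
  proof
    fix y assume "y \<in> set (jt ps)"
    then have "y \<in> insert (Inl Hash) (\<Union>w\<in>(\<lambda>j. tag_template j (fst (ps ! j))) ` {0..<m}. set w)"
      using set_join_templates[of "map (\<lambda>j. tag_template j (fst (ps ! j))) [0..<m]"]
      unfolding jt_def set_map set_upt by (rule subsetD[rotated])
    then consider "y = Inl Hash" | j z where "j < m" "z \<in> set (fst (ps ! j))" "y = map_sum Letter (Pair j) z"
      by (auto simp: tag_template_def)
    then show "y \<in> Inl ` (Letter ` \<Omega> \<union> {Hash}) \<union> Inr ` V"
    proof cases
      case 2
      then show ?thesis using letters[OF ps 2(1)] Vmem[OF ps 2(1)] by (cases z) auto
    qed simp
  qed
  have ag: "agmap (natvars V) (\<lambda>x. word_value G ev (expand c (\<lambda>v. x (j, v)) (fst (ps ! j))))"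
    if ps: "ps \<in> PS" and j: "j < m" for ps j
    using tpl[OF mem[OF ps j]] Vmem[OF ps j] by (intro agmap_expand lin_natvars) auto
  have presbQ: "presb (natvars V) (Q ps)" if ps: "ps \<in> PS" for ps
  proof -
    have "presb (natvars V) (\<lambda>x. tup ps x \<in> S)"
      unfolding tup_def
      using S(2)[unfolded definable_def, rule_format, of "natvars V"
          "\<lambda>j x. word_value G ev (expand c (\<lambda>v. x (j, v)) (fst (ps ! j)))"] ag[OF ps] finV
      by (simp add: natvars_def)
    moreover have "presb (natvars V) (\<lambda>x. snd (ps ! j) (\<lambda>v. x (j, v)))" if j: "j < m" for j
    proof (rule presb_subst[where P = "snd (ps ! j)" and h = "\<lambda>x v. x (j, v)"])
      show "presb (natvars (template_vars (fst (ps ! j)))) (snd (ps ! j))"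
        using tpl[OF mem[OF ps j]] by simp
      show "(\<lambda>x. f (\<lambda>v. x (j, v))) \<in> lin (natvars V)"
        if f: "f \<in> natvars (template_vars (fst (ps ! j)))" for f
      proof -
        obtain v where "Inr v \<in> set (fst (ps ! j))" "f = (\<lambda>x. int (x v))"
          using f by (auto simp: natvars_def)
        then show ?thesis using lin_natvars[OF Vmem[OF ps j]] by simp
      qed
    qed
    ultimately show ?thesis unfolding Q_def by (intro presb_conj presb_ball) auto
  qed
  have "EDT0L (Letter ` \<Omega> \<union> {Hash}) {expand ?c x tpl | tpl P x. (tpl, P) \<in> (\<lambda>ps. (jt ps, Q ps)) ` PS \<and> P x}"
  proof (rule EDT0L_presb_templates[OF _ finV])
    show "finite (Letter ` \<Omega> \<union> {Hash})" using fin(2) by simp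
    show "finite ((\<lambda>ps. (jt ps, Q ps)) ` PS)" using finPS by simp
    show "tpl \<in> lists (Inl ` (Letter ` \<Omega> \<union> {Hash}) \<union> Inr ` V) \<and> presb (natvars V) P"
      if tP: "(tpl, P) \<in> (\<lambda>ps. (jt ps, Q ps)) ` PS" for tpl P
    proof -
      obtain ps where "ps \<in> PS" "tpl = jt ps" "P = Q ps" using tP by auto
      then show ?thesis using jt_letters presbQ by simp
    qed
    show "?c v \<in> lists (Letter ` \<Omega> \<union> {Hash})" if "v \<in> V" for v
      using cV[of "fst v" "snd v"] that by (cases v) auto
  qed
  moreover have "{expand ?c x tpl | tpl P x. (tpl, P) \<in> (\<lambda>ps. (jt ps, Q ps)) ` PS \<and> P x}
      = (\<lambda>gs. hash_join (map \<mu> gs)) ` S" (is "?L = ?R")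
  proof -
    have exp: "expand ?c x (jt ps) = hash_join (map \<mu> (tup ps x))" if ps: "ps \<in> PS" and Q: "Q ps x" for ps x
    proof -
      have "expand ?c x (jt ps) = hash_join (map (\<lambda>j. expand c (\<lambda>v. x (j, v)) (fst (ps ! j))) [0..<m])"
        unfolding jt_def by (rule expand_join_templates) (rule expand_tag_template)
      also have "map (\<lambda>j. expand c (\<lambda>v. x (j, v)) (fst (ps ! j))) [0..<m] = map \<mu> (tup ps x)"
        unfolding tup_def map_map comp_def
      proof (rule map_cong[OF refl])
        fix j assume "j \<in> set [0..<m]"
        then have j: "j < m" by simp
        then have "snd (ps ! j) (\<lambda>v. x (j, v))" using Q by (simp add: Q_def)
        from word[OF mem[OF ps j] this]
        show "expand c (\<lambda>v. x (j, v)) (fst (ps ! j))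
          = \<mu> (word_value G ev (expand c (\<lambda>v. x (j, v)) (fst (ps ! j))))" by simp
      qed
      finally show ?thesis .
    qed
    show ?thesis
    proof (intro equalityI subsetI)
      fix w assume "w \<in> ?L"
      then obtain tpl P x where w: "w = expand ?c x tpl" "(tpl, P) \<in> (\<lambda>ps. (jt ps, Q ps)) ` PS" "P x"
        by blast
      then obtain ps where ps: "ps \<in> PS" "tpl = jt ps" "P = Q ps" by auto
      have "w = hash_join (map \<mu> (tup ps x))" using exp[OF ps(1)] w(1,3) ps(2,3) by simp
      moreover have "tup ps x \<in> S" using w(3) ps(3) by (simp add: Q_def)
      ultimately show "w \<in> ?R" by (rule image_eqI)
    next
      fix w assume "w \<in> ?R"
      then obtain gs where gs: "gs \<in> S" "w = hash_join (map \<mu> gs)" by auto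
      have len: "length gs = m" "set gs \<subseteq> carrier G" using gs(1) S(1) by (auto simp: tuples_def)
      have "\<forall>g\<in>carrier G. \<exists>px. fst px \<in> Pat \<and> snd (fst px) (snd px) \<and>
          word_value G ev (expand c (snd px) (fst (fst px))) = g"
      proof
        fix g assume "g \<in> carrier G"
        from ex[OF this] obtain p x where "p \<in> Pat" "snd p x" "word_value G ev (expand c x (fst p)) = g"
          by (elim bexE exE conjE)
        then show "\<exists>px. fst px \<in> Pat \<and> snd (fst px) (snd px) \<and>
          word_value G ev (expand c (snd px) (fst (fst px))) = g"
          by (intro exI[of _ "(p, x)"]) simp
      qed
      from bchoice[OF this] obtain px where px: "\<forall>g\<in>carrier G. fst (px g) \<in> Pat \<and>
          snd (fst (px g)) (snd (px g)) \<and> word_value G ev (expand c (snd (px g)) (fst (fst (px g)))) = g"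
        by (rule exE)
      define ps where "ps = map (\<lambda>g. fst (px g)) gs"
      \<comment> \<open>The exponents chosen for the element at position \<open>j\<close> are stored
        under the tag \<open>j\<close>.\<close>
      define x where "x jv = snd (px (gs ! fst jv)) (snd jv)" for jv
      have gj: "gs ! j \<in> carrier G" if "j < m" for j using that len by auto
      have ps: "ps \<in> PS" using px len by (auto simp: PS_def ps_def)
      have psj: "ps ! j = fst (px (gs ! j))" if "j < m" for j using that len by (simp add: ps_def)
      have tup: "tup ps x = gs"
      proof (rule nth_equalityI)
        show "length (tup ps x) = length gs" using len by (simp add: tup_def)
        fix j assume "j < length (tup ps x)"
        then have j: "j < m" by (simp add: tup_def)
        then show "tup ps x ! j = gs ! j"
          using px[rule_format, OF gj[OF j]] psj[OF j] by (simp add: tup_def x_def)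
      qed
      have "snd (ps ! j) (\<lambda>v. x (j, v))" if "j < m" for j
        using px[rule_format, OF gj[OF that]] psj[OF that] by (simp add: x_def)
      then have Q: "Q ps x" using tup gs(1) by (simp add: Q_def)
      have "w = expand ?c x (jt ps)" using exp[OF ps Q] tup gs(2) by simp
      then show "w \<in> ?L" using ps Q by blast
    qed
  qed
  ultimately show ?thesis unfolding expressed_as_EDT0L_def by simp
qed

lemma definable_solutions:
  assumes E: "finite_equation_system G m E" and fin: "finite \<K>"
    and K: "\<And>K. K \<in> \<K> \<Longrightarrow> linear_length_constraint G m K \<or> abelianisation_constraint G m K \<or>
           context_free_constraint G m K \<or> lex_order_constraint G bs T r m K"
    and S: "S = {gs \<in> equation_solutions G m E. \<forall>K\<in>\<K>. gs \<in> K}"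
  shows "S \<subseteq> tuples G m" "definable m S TYPE('s)"
proof -
  show "S \<subseteq> tuples G m"
    using equation_solutions_iff[of E m] E unfolding S finite_equation_system_def by blast
  show "definable m S TYPE('s)"
    unfolding definable_def
  proof (intro allI impI)
    fix F :: "('s \<Rightarrow> int) set" and \<Phi>
    assume F: "finite F" and \<Phi>: "\<forall>j<m. agmap F (\<Phi> j)"
    have "presb F (\<lambda>s. map (\<lambda>j. \<Phi> j s) [0..<m] \<in> K)" if "K \<in> \<K>" for K
      using K[OF that]
    proof (elim disjE)
      assume "linear_length_constraint G m K"
      then show ?thesis by (rule presb_linear_length) (use \<Phi> F in auto)
    next
      assume "abelianisation_constraint G m K"
      then show ?thesis by (rule presb_abelianisation) (use \<Phi> F in auto)
    next
      assume "context_free_constraint G m K"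
      then show ?thesis by (rule presb_context_free) (use \<Phi> F in auto)
    next
      assume "lex_order_constraint G bs T r m K"
      then show ?thesis by (rule presb_lex_order) (use \<Phi> in auto)
    qed
    then have "presb F (\<lambda>s. map (\<lambda>j. \<Phi> j s) [0..<m] \<in> equation_solutions G m E \<and>
        (\<forall>K\<in>\<K>. map (\<lambda>j. \<Phi> j s) [0..<m] \<in> K))"
      using \<Phi> by (intro presb_conj presb_ball presb_equations[OF E] fin) auto
    then show "presb F (\<lambda>s. map (\<lambda>j. \<Phi> j s) [0..<m] \<in> S)" by (simp add: S)
  qed
qed

text \<open>\<open>\<sigma>\<close> is a sign pattern, needed because exponents are naturals. An
  exponent 0 fits both signs; the resulting repetitions do not matter in a language.\<close>

definition st_template :: "bool list \<Rightarrow> 'a \<Rightarrow> ('a st_letter + nat \<times> 'a st_letter) list" where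
  "st_template \<sigma> t = map (\<lambda>i. Inr (i, if \<sigma> ! i then BasisGen (bs ! i) else BasisInv (bs ! i))) [0..<n] @ [Inl (Rep t)]"

abbreviation st_loop :: "nat \<times> 'a st_letter \<Rightarrow> 'a st_letter list" where
  "st_loop v \<equiv> [snd v]"

lemma expand_st_template:
  "expand st_loop x (st_template \<sigma> t) = st_word bs (map (\<lambda>i. if \<sigma> ! i then int (x (i, BasisGen (bs ! i)))
      else - int (x (i, BasisInv (bs ! i)))) [0..<n]) t" (is "_ = st_word bs (map ?f _) t")
proof -
  have wp: "word_power k [a] = replicate k a" for k and a :: "'a st_letter"
    by (induction k) auto
  have "expand st_loop x (map (\<lambda>i. Inr (i, if \<sigma> ! i then BasisGen (bs ! i) else BasisInv (bs ! i))) is @ [Inl (Rep t)])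
      = concat (map (\<lambda>i. basis_power (bs ! i) (?f i)) is) @ [Rep t]" for "is"
    by (induction "is") (auto simp: wp basis_power.simps)
  moreover have "map2 basis_power bs (map ?f [0..<n]) = map (\<lambda>i. basis_power (bs ! i) (?f i)) [0..<n]"
    by (rule nth_equalityI) auto
  ultimately show ?thesis by (simp add: st_template_def st_word_def)
qed

text \<open>The choice condition is \<open>True\<close>, as every expansion of
  \<open>st_template\<close> is a normal form already.\<close>

lemma EDT0L_st_normal_form:
  assumes S: "S \<subseteq> tuples G m" "definable m S TYPE(nat \<times> nat \<times> 'a st_letter \<Rightarrow> nat)"
  shows "expressed_as_EDT0L (st_alphabet bs T) (st_normal_form G bs T) S"
proof -
  define Sg where "Sg = {\<sigma> :: bool list. set \<sigma> \<subseteq> UNIV \<and> length \<sigma> = n}"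
  have finSg: "finite Sg" unfolding Sg_def by (rule finite_lists_length_eq) simp
  have eta: "st_normal_form G bs T (word_value G (st_value G) (expand st_loop x (st_template \<sigma> t)))
      = expand st_loop x (st_template \<sigma> t)" if "t \<in> T" for x \<sigma> t
    unfolding expand_st_template using st_word_vec_value[OF that] st_normal_form_vec[OF that] by simp
  show ?thesis
  proof (rule EDT0L_normal_form[OF _ _ _ _ _ S, where c = st_loop and ev = "st_value G" and
        Pat = "(\<lambda>(\<sigma>, t). (st_template \<sigma> t, \<lambda>x. True)) ` (Sg \<times> T)"])
    show "finite ((\<lambda>(\<sigma>, t). (st_template \<sigma> t, \<lambda>x :: nat \<times> 'a st_letter \<Rightarrow> nat. True)) ` (Sg \<times> T))"
      using finSg finite_T by simp
    show "finite (st_alphabet bs T)" using finite_T by (simp add: st_alphabet_def)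
    fix tpl and Ch :: "(nat \<times> 'a st_letter \<Rightarrow> nat) \<Rightarrow> bool"
    assume "(tpl, Ch) \<in> (\<lambda>(\<sigma>, t). (st_template \<sigma> t, \<lambda>x. True)) ` (Sg \<times> T)"
    then obtain \<sigma> t where t: "t \<in> T" "tpl = st_template \<sigma> t" "Ch = (\<lambda>x. True)" by auto
    have b: "bs ! i \<in> set bs" "bs ! i \<in> A" "bs ! i \<in> carrier G" "inv (bs ! i) \<in> A" "inv (bs ! i) \<in> carrier G"
      if "i < n" for i
    proof -
      show "bs ! i \<in> set bs" using that by simp
      then show "bs ! i \<in> A" using bs_A by blast
      then show "inv (bs ! i) \<in> A" by (rule m_inv_closed)
      then show "inv (bs ! i) \<in> carrier G" by (rule A_carrier)
      show "bs ! i \<in> carrier G" using \<open>bs ! i \<in> A\<close> by (rule A_carrier)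
    qed
    have "tpl \<in> lists (Inl ` st_alphabet bs T \<union> Inr ` {v. st_loop v \<in> lists (st_alphabet bs T)})"
      using t(1) b(1) unfolding t(2) st_template_def by (auto simp: st_alphabet_def)
    moreover have "valid_template (st_value G) st_loop tpl"
      using t(1) b unfolding t(2) st_template_def
      by (auto simp: valid_template_def loop_word_def T_carrier)
    ultimately show "tpl \<in> lists (Inl ` st_alphabet bs T \<union> Inr ` {v. st_loop v \<in> lists (st_alphabet bs T)}) \<and>
        valid_template (st_value G) st_loop tpl \<and> presb (natvars (template_vars tpl)) Ch"
      unfolding t(3) by (intro conjI presb_const)
    show "st_normal_form G bs T (word_value G (st_value G) (expand st_loop x tpl)) = expand st_loop x tpl" for x
      unfolding t(2) by (rule eta[OF t(1)])
  next
    fix g assume "g \<in> carrier G"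
    then obtain f t where g: "t \<in> T" "g = vec f \<otimes> t" using ex_vec_transversal by blast
    define \<sigma> where "\<sigma> = map (\<lambda>i. f i \<ge> 0) [0..<n]"
    define x :: "nat \<times> 'a st_letter \<Rightarrow> nat" where "x v = nat \<bar>f (fst v)\<bar>" for v
    have f: "map (\<lambda>i. if \<sigma> ! i then int (x (i, BasisGen (bs ! i))) else - int (x (i, BasisInv (bs ! i)))) [0..<n]
        = map f [0..<n]"
      by (auto simp: \<sigma>_def x_def)
    have "word_value G (st_value G) (expand st_loop x (st_template \<sigma> t)) = g"
      unfolding expand_st_template f g(2) by (rule st_word_vec_value[OF g(1)])
    moreover have "\<sigma> \<in> Sg" by (simp add: Sg_def \<sigma>_def)
    ultimately show "\<exists>p\<in>(\<lambda>(\<sigma>, t). (st_template \<sigma> t, \<lambda>x. True)) ` (Sg \<times> T). \<exists>x. snd p x \<and>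
        word_value G (st_value G) (expand st_loop x (fst p)) = g"
      using g(1) by (intro bexI[of _ "(st_template \<sigma> t, \<lambda>x. True)"] exI[of _ x]) auto
  qed
qed

end

section \<open>Choosing one geodesic word for every element\<close>

fun lex_least :: "'v list \<Rightarrow> ('v \<Rightarrow> nat) \<Rightarrow> ('v \<Rightarrow> nat) \<Rightarrow> bool" where
  "lex_least [] x y \<longleftrightarrow> True"
| "lex_least (v # vs) x y \<longleftrightarrow> x v < y v \<or> (x v = y v \<and> lex_least vs x y)"

lemma lex_least_antisym: "lex_least vs x y \<Longrightarrow> lex_least vs y x \<Longrightarrow> \<forall>v\<in>set vs. x v = y v"
  by (induction vs) auto

text \<open>Minimise the first coordinate and continue among its minimisers.\<close>

lemma lex_least_exists: "\<exists>x. P x \<Longrightarrow> \<exists>x. P x \<and> (\<forall>y. P y \<longrightarrow> lex_least vs x y)"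
proof (induction vs arbitrary: P)
  case (Cons v vs)
  define k where "k = (LEAST k. \<exists>x. P x \<and> x v = k)"
  have "\<exists>k x. P x \<and> x v = k" using Cons.prems by blast
  then have "\<exists>x. P x \<and> x v = k" unfolding k_def by (rule LeastI_ex)
  from Cons.IH[OF this] obtain x where x: "P x" "x v = k" "\<forall>y. P y \<and> y v = k \<longrightarrow> lex_least vs x y"
    by (elim exE conjE) simp
  have "lex_least (v # vs) x y" if y: "P y" for y
  proof -
    have "k \<le> y v" unfolding k_def by (rule Least_le) (use y in blast)
    then show ?thesis using x y by auto
  qed
  then show ?case using x(1) by blast
qed auto

lemma presb_lex_least:
  "set vs \<subseteq> V \<Longrightarrow> presb (pairvars (natvars V) V) (\<lambda>y. lex_least vs (fst y) (snd y))"
proof (induction vs)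
  case Nil
  show ?case by (simp add: presb_const)
next
  case (Cons v vs)
  then have v: "(\<lambda>y. int (fst y v)) \<in> lin (pairvars (natvars V) V)" "(\<lambda>y. int (snd y v)) \<in> lin (pairvars (natvars V) V)"
    using lin_pairvars_fst[OF lin_natvars] lin_pairvars_snd by auto
  have "presb (pairvars (natvars V) V) (\<lambda>y. int (fst y v) < int (snd y v) \<or>
      (int (fst y v) = int (snd y v) \<and> lex_least vs (fst y) (snd y)))"
    using Cons v by (intro presb_intros) auto
  then show ?case by simp
qed

context va_weighted
begin

definition pattern_list where
  "pattern_list = (SOME ps. set ps = patterns)"

lemma set_pattern_list: "set pattern_list = patterns"
  unfolding pattern_list_def using someI_ex[OF finite_list[OF finite_patterns]] .

definition geo :: "nat \<Rightarrow> (nat \<times> 'a list \<Rightarrow> nat) \<Rightarrow> 'a \<Rightarrow> bool" where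
  "geo i x g \<longleftrightarrow> val (expand snd x (pattern_list ! i)) = g \<and>
     word_weight \<omega> (expand snd x (pattern_list ! i)) = weight G \<Sigma> \<omega> g"

definition var_list :: "nat \<Rightarrow> (nat \<times> 'a list) list" where
  "var_list i = (SOME vs. set vs = template_vars (pattern_list ! i))"

lemma set_var_list: "set (var_list i) = template_vars (pattern_list ! i)"
  unfolding var_list_def using someI_ex[OF finite_list[OF finite_template_vars]] .

text \<open>The first pattern that yields a geodesic word for \<open>g\<close>, with least
  exponents. Minimality is phrased as the absence of a counterexample, so that elimination of an
  existential quantifier followed by negation applies directly.\<close>

definition chosen :: "nat \<Rightarrow> (nat \<times> 'a list \<Rightarrow> nat) \<Rightarrow> 'a \<Rightarrow> bool" where
  "chosen i x g \<longleftrightarrow> geo i x g \<and> (\<forall>j\<in>{..<i}. \<not> (\<exists>y. geo j y g)) \<and>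
     \<not> (\<exists>y. geo i y g \<and> \<not> lex_least (var_list i) x y)"

lemma ex_chosen:
  assumes "g \<in> carrier G"
  shows "\<exists>i<length pattern_list. \<exists>x. chosen i x g"
proof -
  obtain tpl x where "tpl \<in> patterns" "val (expand snd x tpl) = g"
    "word_weight \<omega> (expand snd x tpl) = weight G \<Sigma> \<omega> g"
    using weight_pattern[OF assms] by (elim bexE exE conjE)
  moreover from this(1) obtain i where "i < length pattern_list" "pattern_list ! i = tpl"
    using set_pattern_list by (metis in_set_conv_nth)
  ultimately have ex: "\<exists>i. i < length pattern_list \<and> (\<exists>x. geo i x g)"
    by (intro exI[of _ i] conjI exI[of _ x]) (auto simp: geo_def)
  define i where "i = (LEAST i. i < length pattern_list \<and> (\<exists>x. geo i x g))"
  have i: "i < length pattern_list" "\<exists>x. geo i x g" unfolding i_def using LeastI_ex[OF ex] by auto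
  have "\<not> (\<exists>y. geo j y g)" if "j < i" for j
    using not_less_Least[of j "\<lambda>i. i < length pattern_list \<and> (\<exists>x. geo i x g)"] that i(1) by (simp add: i_def)
  moreover obtain x where "geo i x g" "\<forall>y. geo i y g \<longrightarrow> lex_least (var_list i) x y"
    using lex_least_exists[OF i(2), of "var_list i"] by (elim exE conjE)
  ultimately have "chosen i x g" by (simp add: chosen_def)
  then show ?thesis using i(1) by blast
qed

lemma chosen_unique:
  assumes "chosen i x g" "chosen j y g"
  shows "expand snd x (pattern_list ! i) = expand snd y (pattern_list ! j)"
proof -
  have ij: "i = j" using assms unfolding chosen_def by (metis lessThan_iff linorder_neqE_nat)
  have eq: "\<forall>v\<in>set (var_list i). x v = y v"
    using assms unfolding ij chosen_def by (intro lex_least_antisym) auto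
  show ?thesis unfolding ij[symmetric] by (rule expand_cong) (use eq set_var_list in blast)
qed

definition geodesic_form :: "'a \<Rightarrow> 'a list" where
  "geodesic_form g = (SOME w. \<exists>i<length pattern_list. \<exists>x. chosen i x g \<and> w = expand snd x (pattern_list ! i))"

lemma geodesic_form_chosen:
  assumes "i < length pattern_list" "chosen i x g"
  shows "geodesic_form g = expand snd x (pattern_list ! i)"
proof -
  have "\<exists>w. \<exists>i<length pattern_list. \<exists>x. chosen i x g \<and> w = expand snd x (pattern_list ! i)"
    using assms by blast
  from someI_ex[OF this] obtain j y where "chosen j y g" "geodesic_form g = expand snd y (pattern_list ! j)"
    unfolding geodesic_form_def[symmetric] by (elim exE conjE)
  then show ?thesis using chosen_unique[OF assms(2)] by simp
qed

lemma geodesic_normal_form_geodesic_form: "geodesic_normal_form G \<Sigma> \<omega> geodesic_form"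
proof -
  have "geodesic_form g \<in> lists \<Sigma> \<and> val (geodesic_form g) = g \<and>
      word_weight \<omega> (geodesic_form g) = weight G \<Sigma> \<omega> g" if g: "g \<in> carrier G" for g
  proof -
    obtain i x where i: "i < length pattern_list" "chosen i x g" using ex_chosen[OF g] by blast
    then have "pattern_list ! i \<in> patterns" using set_pattern_list by (metis nth_mem)
    then have "expand snd x (pattern_list ! i) \<in> lists \<Sigma>" by (rule patterns_letters(2))
    then show ?thesis using i(2) unfolding geodesic_form_chosen[OF i] chosen_def geo_def by simp
  qed
  then show ?thesis by (simp add: geodesic_normal_form_def normal_form_def geodesic_def)
qed

text \<open>With \<open>g\<close> taken to be the value of the pattern itself, an affine map of the
  exponents \<open>x\<close>, every condition on \<open>g\<close> becomes one on \<open>x\<close>.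
  The exponents \<open>y\<close> of competing patterns are quantified away.\<close>

lemma presb_chosen:
  assumes i: "i < length pattern_list"
  shows "presb (natvars (template_vars (pattern_list ! i)))
    (\<lambda>x. chosen i x (val (expand snd x (pattern_list ! i))))"
proof -
  let ?tpl = "\<lambda>j. pattern_list ! j"
  let ?V = "\<lambda>j. template_vars (?tpl j)"
  let ?g = "\<lambda>x. val (expand snd x (?tpl i))"
  have valid: "valid_template id snd (?tpl j)" if "j < length pattern_list" for j
    using valid_patterns set_pattern_list that by (metis nth_mem)
  have fin: "finite (natvars (?V i))" by (intro finite_natvars finite_template_vars)
  have v: "(\<lambda>x. int (x v)) \<in> lin (natvars (?V i))" if "Inr v \<in> set (?tpl i)" for v
    using that by (intro lin_natvars) simp
  have ag: "agmap (natvars (?V i)) ?g" by (rule agmap_expand[OF valid[OF i] v])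
  have geo_i: "presb (natvars (?V i)) (\<lambda>x. geo i x (?g x))"
  proof -
    have "presb (natvars (?V i)) (\<lambda>x. int (weight G \<Sigma> \<omega> (?g x)) = int (word_weight \<omega> (expand snd x (?tpl i))))"
      by (intro presb_weight_eq ag lin_weight_expand v fin)
    then show ?thesis unfolding geo_def by (simp add: eq_commute)
  qed
  have geo_j: "presb (pairvars (natvars (?V i)) (?V j)) (\<lambda>y. geo j (snd y) (?g (fst y)))"
    if j: "j < length pattern_list" for j
  proof -
    let ?F = "pairvars (natvars (?V i)) (?V j)"
    have finF: "finite ?F" by (intro finite_pairvars fin finite_template_vars)
    have s: "(\<lambda>y. int (snd y v)) \<in> lin ?F" if "Inr v \<in> set (?tpl j)" for v
      using that by (intro lin_pairvars_snd) simp
    have g: "agmap ?F (\<lambda>y. ?g (fst y))"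
      by (rule agmap_subst[OF ag]) (rule lin_pairvars_fst[OF lin_base])
    have "presb ?F (\<lambda>y. val (expand snd (snd y) (?tpl j)) = ?g (fst y))"
      by (intro presb_agmap_eq agmap_expand[OF valid[OF j]] s g)
    moreover have "presb ?F (\<lambda>y. int (weight G \<Sigma> \<omega> (?g (fst y))) = int (word_weight \<omega> (expand snd (snd y) (?tpl j))))"
      by (intro presb_weight_eq g lin_weight_expand s finF)
    ultimately have "presb ?F (\<lambda>y. val (expand snd (snd y) (?tpl j)) = ?g (fst y) \<and>
        int (weight G \<Sigma> \<omega> (?g (fst y))) = int (word_weight \<omega> (expand snd (snd y) (?tpl j))))"
      by (rule presb_conj)
    then show ?thesis unfolding geo_def by (simp add: eq_commute)
  qed
  have "presb (natvars (?V i)) (\<lambda>x. \<exists>y. geo j y (?g x))" if "j < i" for j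
    using presb_ex_nat[OF finite_template_vars fin geo_j] that i by simp
  moreover have "presb (natvars (?V i)) (\<lambda>x. \<exists>y. geo i y (?g x) \<and> \<not> lex_least (var_list i) x y)"
    using presb_ex_nat[OF finite_template_vars fin presb_conj[OF geo_j[OF i]
          presb_not[OF presb_lex_least[of "var_list i" "?V i"]]]] set_var_list by simp
  ultimately show ?thesis unfolding chosen_def
    using geo_i by (intro presb_conj presb_ball presb_not) auto
qed

lemma EDT0L_geodesic_form:
  assumes S: "S \<subseteq> tuples G m" "definable m S TYPE(nat \<times> nat \<times> 'a list \<Rightarrow> nat)"
  shows "expressed_as_EDT0L \<Sigma> geodesic_form S"
proof (rule EDT0L_normal_form[OF _ finite_\<Sigma> _ _ _ S, where c = snd and ev = id and
      Pat = "(\<lambda>i. (pattern_list ! i, \<lambda>x. chosen i x (val (expand snd x (pattern_list ! i))))) ` {..<length pattern_list}"])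
  fix tpl Ch
  assume "(tpl, Ch) \<in> (\<lambda>i. (pattern_list ! i, \<lambda>x. chosen i x (val (expand snd x (pattern_list ! i))))) ` {..<length pattern_list}"
  then obtain i where i: "i < length pattern_list" "tpl = pattern_list ! i"
    "Ch = (\<lambda>x. chosen i x (val (expand snd x (pattern_list ! i))))" by auto
  have "tpl \<in> patterns" unfolding i(2) using i(1) set_pattern_list by (metis nth_mem)
  then show "tpl \<in> lists (Inl ` \<Sigma> \<union> Inr ` {v. snd v \<in> lists \<Sigma>}) \<and> valid_template id snd tpl \<and>
      presb (natvars (template_vars tpl)) Ch"
    using patterns_letters(1) valid_patterns presb_chosen[OF i(1)] unfolding i(3) i(2) by blast
  show "geodesic_form (val (expand snd x tpl)) = expand snd x tpl" if "Ch x" for x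
    using that geodesic_form_chosen[OF i(1)] unfolding i(2,3) by simp
next
  fix g assume "g \<in> carrier G"
  then obtain i x where i: "i < length pattern_list" "chosen i x g" using ex_chosen by blast
  then have "val (expand snd x (pattern_list ! i)) = g" by (simp add: chosen_def geo_def)
  with i show "\<exists>p\<in>(\<lambda>i. (pattern_list ! i, \<lambda>x. chosen i x (val (expand snd x (pattern_list ! i))))) ` {..<length pattern_list}.
      \<exists>x. snd p x \<and> val (expand snd x (fst p)) = g"
    by (intro bexI[of _ "(pattern_list ! i, \<lambda>x. chosen i x (val (expand snd x (pattern_list ! i))))"] exI[of _ x]) auto
qed simp

end

theorem corollary1p3:
  fixes G :: "('a, 'b) monoid_scheme"
    and A :: "'a set" and bs :: "'a list" and T :: "'a set"
    and rT :: "('a \<times> 'a) set" and r :: "('a st_letter \<times> 'a st_letter) set"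
    and m :: nat
    and E :: "'a fp_letter list set set"
    and \<K> :: "'a list set set"
    and S :: "'a list set"
  assumes "finitely_generated_group G"
    and "virtually_abelian_group G"
    and "subgroup_transversal_data G A bs T"
    and "st_letter_order bs T rT r"
    and "finite_equation_system G m E"
    and "finite \<K>"
    and "\<And>K. K \<in> \<K> \<Longrightarrow>
           linear_length_constraint G m K \<or> abelianisation_constraint G m K \<or>
           context_free_constraint G m K \<or> lex_order_constraint G bs T r m K"
    and "S = {gs \<in> equation_solutions G m E. \<forall>K\<in>\<K>. gs \<in> K}"
  shows "expressed_as_EDT0L (st_alphabet bs T) (st_normal_form G bs T) S \<and>
         (\<forall>\<Sigma> \<omega>. weighted_generating_set G \<Sigma> \<omega> \<longrightarrow>
           (\<exists>\<mu>. geodesic_normal_form G \<Sigma> \<omega> \<mu> \<and> expressed_as_EDT0L \<Sigma> \<mu> S))"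
proof -
  interpret va_group G A bs T
    by (rule va_group.intro) (use assms(1,3) in \<open>simp_all add: finitely_generated_group_def\<close>)
  note S = definable_solutions[OF assms(5-8)]
  show ?thesis
  proof (intro conjI allI impI)
    show "expressed_as_EDT0L (st_alphabet bs T) (st_normal_form G bs T) S"
      by (rule EDT0L_st_normal_form[OF S])
    fix \<Sigma> \<omega> assume "weighted_generating_set G \<Sigma> \<omega>"
    then interpret va_weighted G A bs T \<Sigma> \<omega>
      by unfold_locales (simp add: weighted_generating_set_def)
    show "\<exists>\<mu>. geodesic_normal_form G \<Sigma> \<omega> \<mu> \<and> expressed_as_EDT0L \<Sigma> \<mu> S"
      using geodesic_normal_form_geodesic_form EDT0L_geodesic_form[OF S] by blast
  qed
qed

end
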